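(* Let $\zeta\in[0,1)$ and suppose that the finite-difference scheme used in the cone kernels $K_{\delta t,\zeta}$ has accuracy order $p\ge 4$. Then the induced metric tensor $h$ at $a\in\mathcal{M}$ associated with the cone kernels is given by $$h=\frac{1}{\|v\|_g^2}\left(g-\zeta\,\frac{v^*\otimes v^*}{\|v\|_g^2}\right),$$ where $g$ is the ambient-space induced metric and $v^*=g(v,\cdot)$ is the dual dynamical vector field with respect to $g$. Moreover, the volume forms $\nu$ and $\mu$ of $h$ and $g$, respectively, are related through $$\nu=(1-\zeta)^{1/2}\,\bar\nu,\qquad \bar\nu=\mu/\|v\|_g^m .$$
   Context: Setting: $\Phi_t:\mathcal{F}\to\mathcal{F}$ is a deterministic flow on a phase space $\mathcal{F}$, evolving on a smooth (of class $C^1$), compact, $m$-dimensional attractor $\mathcal{M}\subseteq\mathcal{F}$ without boundary. The flow is sufficiently smooth that the dynamical vector field $v$ on $\mathcal{M}$, $v(f)=\lim_{t\to0}(f(\Phi_ta)-f(a))/t$ for $a\in\mathcal{M}$, $f\in C^1\mathcal{M}$, is at least $C^1$; $v$ is nowhere vanishing. The observation map $F:\mathcal{F}\to\mathbb{R}^n$ is $C^2$ and is an embedding of $\mathcal{M}$ into $\mathbb{R}^n$ (one-to-one and of full rank on the tangent spaces of $\mathcal{M}$), with derivative $DF$; $\mathbb{R}^n$ carries an inner product $(\cdot,\cdot)$ with norm $\|\cdot\|$. The ambient-space induced metric on $\mathcal{M}$ is $g(u,u')=(DF\,u,DF\,u')$, with volume form $\mu$, and $\|v\|_g=\sqrt{g(v,v)}$.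 Finite differences: for a sampling interval $\delta t>0$ and $a\in\mathcal{M}$, $\xi(a)=\delta_pF(a)$, where $\delta_p$ is a $p$-th order finite-difference operator for the first time derivative, acting on the samples $F(\Phi_{j\,\delta t}a)$, $j$ integer, of the orbit through $a$ (nominally the central scheme $\sum_{j=-p}^{p}w_jF(\Phi_{j\,\delta t}a)$ with standard weights $w_j$), i.e. $\frac{df}{dt}=\frac{\delta_pf}{\delta t}+O(\delta t^p)$. Cone kernels: for $a_i,a_j\in\mathcal{M}$ put $\xi_i=\xi(a_i)$, $\xi_j=\xi(a_j)$, $\omega_{ij}=F(a_j)-F(a_i)$, $\cos\theta_i=\frac{(\xi_i,\omega_{ij})}{\|\xi_i\|\|\omega_{ij}\|}$, $\cos\theta_j=\frac{(\xi_j,\omega_{ij})}{\|\xi_j\|\|\omega_{ij}\|}$, and $$K_{\delta t,\zeta}(a_i,a_j)=\exp\left(-\frac{\|\omega_{ij}\|^2}{\|\xi_i\|\|\xi_j\|}\big[(1-\zeta\cos^2\theta_i)(1-\zeta\cos^2\theta_j)\big]^{1/2}\right)$$ (with value $1$ when $a_i=a_j$). Diffusion operator and induced metric: for sufficiently smooth scalar functions $f$ on $\mathcal{M}$ let $$H_{\delta t,\zeta}f(a)=\frac{1}{\delta t^m}\int_{\mathcal{M}}K_{\delta t,\zeta}(a,\cdot)f\,\mu,\quad \rho_{\delta t,\zeta}=H_{\delta t,\zeta}1,\quad \mathcal{P}_{\delta t,\zeta}f=\frac{H_{\delta t,\zeta}f}{\rho_{\delta t,\zeta}},\quad \mathcal{L}_{\delta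 t,\zeta}=\frac{\mathrm{Id}-\mathcal{P}_{\delta t,\zeta}}{\delta t^2}.$$ As $\delta t\to0$, $\mathcal{L}_{\delta t,\zeta}$ converges to a second-order self-adjoint operator $\Delta_\zeta=\lim_{\delta t\to0}\mathcal{L}_{\delta t,\zeta}$. This operator corresponds to a unique codifferential operator $\delta_\zeta$ and Riemannian metric $h$ (the induced metric associated with the kernel) such that $\Delta_\zeta=\delta_\zeta d$, where $(w,df)_h=(\delta_\zeta w,f)_h$ for any smooth 1-form field $w$ and scalar function $f$. Here $(\cdot,\cdot)_h$ are the Hodge inner products associated with $h$, $(w,df)_h=\int_{\mathcal{M}}h^{-1}(w,df)\,\nu$ and $(\delta_\zeta w,f)_h=\int_{\mathcal{M}}(\delta_\zeta w)f\,\nu$, where $\nu$ is the volume form of $h$ and $h^{-1}$ is the inverse metric on 1-forms.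
   Formalization: The induced metric is normalized by lim L = (1/4) δ_ζ d, since without the factor 1/4 the formula for h is off by 4; the Hodge inner products may carry any positive density s (s=1 is the stated case); M is taken of class C^2 so that a C^1 field v and C^2 map F make sense. *)

theory Defs
  imports "HOL-Analysis.Analysis" "HOL-Library.Landau_Symbols"
begin

section \<open>Functions of class C1 and C2 on open sets\<close>

definition C1_on :: "'x::real_normed_vector set \<Rightarrow> ('x \<Rightarrow> 'y::real_normed_vector) \<Rightarrow> bool" where
  "C1_on S f \<longleftrightarrow> (\<exists>f' :: 'x \<Rightarrow> 'x \<Rightarrow>\<^sub>L 'y.
     (\<forall>x\<in>S. (f has_derivative blinfun_apply (f' x)) (at x)) \<and> continuous_on S f')"

definition C2_on :: "'x::real_normed_vector set \<Rightarrow> ('x \<Rightarrow> 'y::real_normed_vector) \<Rightarrow> bool" where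
  "C2_on S f \<longleftrightarrow> (\<exists>f' :: 'x \<Rightarrow> 'x \<Rightarrow>\<^sub>L 'y.
     (\<forall>x\<in>S. (f has_derivative blinfun_apply (f' x)) (at x)) \<and> C1_on S f')"

section \<open>Manifolds inside the phase space\<close>

text \<open>
  The phase space is a topological space \<open>'a\<close> without further structure, so that it may be a
  manifold or an infinite-dimensional space. The differentiable structure of the subset
  \<open>M\<close> is an atlas of pairs (domain, coordinate map), and the dimension of \<open>M\<close> is \<open>CARD('m)\<close>.
  Chart images are open in \<open>real ^ 'm\<close>, so \<open>M\<close> has no boundary.
\<close>

type_synonym ('a, 'm) chart = "'a set \<times> ('a \<Rightarrow> real ^ 'm)"

abbreviation chart_inv :: "('a, 'm::finite) chart \<Rightarrow> real ^ 'm \<Rightarrow> 'a" where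
  "chart_inv c \<equiv> inv_into (fst c) (snd c)"

abbreviation chart_image :: "('a, 'm::finite) chart \<Rightarrow> (real ^ 'm) set" where
  "chart_image c \<equiv> snd c ` fst c"

definition C2_manifold :: "'a::topological_space set \<Rightarrow> ('a, 'm::finite) chart set \<Rightarrow> bool" where
  "C2_manifold M A \<longleftrightarrow>
     (\<Union>c\<in>A. fst c) = M \<and>
     (\<forall>c\<in>A. openin (top_of_set M) (fst c) \<and> open (chart_image c) \<and>
             homeomorphism (fst c) (chart_image c) (snd c) (chart_inv c)) \<and>
     (\<forall>c\<in>A. \<forall>d\<in>A. C2_on (snd c ` (fst c \<inter> fst d)) (snd d \<circ> chart_inv c))"

definition C1_fun :: "('a, 'm::finite) chart set \<Rightarrow> ('a \<Rightarrow> 'y::real_normed_vector) \<Rightarrow> bool" where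
  "C1_fun A f \<longleftrightarrow> (\<forall>c\<in>A. C1_on (chart_image c) (f \<circ> chart_inv c))"

definition C2_fun :: "('a, 'm::finite) chart set \<Rightarrow> ('a \<Rightarrow> 'y::real_normed_vector) \<Rightarrow> bool" where
  "C2_fun A f \<longleftrightarrow> (\<forall>c\<in>A. C2_on (chart_image c) (f \<circ> chart_inv c))"

section \<open>Tangent vectors, vector fields and 1-forms\<close>

text \<open>
  A tangent vector at \<open>a\<close> is the directional derivative \<open>f \<mapsto> u(f)\<close> on C1 functions. Only
  directional derivatives taken in charts are admitted, since for functions of finite
  differentiability class there are further derivations. Tangent vectors are set to 0 on the
  functions that are not C1, which makes equality of tangent vectors equality of functionals.
\<close>

type_synonym 'a tvec = "('a \<Rightarrow> real) \<Rightarrow> real"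

definition coord_tvec ::
    "('a, 'm::finite) chart set \<Rightarrow> ('a, 'm) chart \<Rightarrow> 'a \<Rightarrow> real ^ 'm \<Rightarrow> 'a tvec" where
  "coord_tvec A c a x =
     (\<lambda>f. if C1_fun A f then frechet_derivative (f \<circ> chart_inv c) (at (snd c a)) x else 0)"

definition tangent_space :: "('a, 'm::finite) chart set \<Rightarrow> 'a \<Rightarrow> 'a tvec set" where
  "tangent_space A a = {coord_tvec A c a x | c x. c \<in> A \<and> a \<in> fst c}"

definition C1_vector_field ::
    "'a set \<Rightarrow> ('a, 'm::finite) chart set \<Rightarrow> ('a \<Rightarrow> 'a tvec) \<Rightarrow> bool" where
  "C1_vector_field M A X \<longleftrightarrow>
     (\<forall>a\<in>M. X a \<in> tangent_space A a) \<and>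
     (\<forall>f::'a \<Rightarrow> real. C2_fun A f \<longrightarrow> C1_fun A (\<lambda>a. X a f))"

definition differential :: "('a \<Rightarrow> real) \<Rightarrow> 'a \<Rightarrow> 'a tvec \<Rightarrow> real" where
  "differential f a u = u f"

definition C1_form :: "('a, 'm::finite) chart set \<Rightarrow> ('a \<Rightarrow> 'a tvec \<Rightarrow> real) \<Rightarrow> bool" where
  "C1_form A w \<longleftrightarrow> (\<forall>c\<in>A.
     (\<forall>a\<in>fst c. linear (\<lambda>x. w a (coord_tvec A c a x))) \<and>
     (\<forall>x. C1_on (chart_image c) (\<lambda>y. w (chart_inv c y) (coord_tvec A c (chart_inv c y) x))))"

section \<open>Riemannian metrics, volume and codifferential\<close>

type_synonym 'a metric_tensor = "'a \<Rightarrow> 'a tvec \<Rightarrow> 'a tvec \<Rightarrow> real"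

definition riemannian_metric :: "('a, 'm::finite) chart set \<Rightarrow> 'a metric_tensor \<Rightarrow> bool" where
  "riemannian_metric A h \<longleftrightarrow> (\<forall>c\<in>A.
     (\<forall>a\<in>fst c. bilinear (\<lambda>x y. h a (coord_tvec A c a x) (coord_tvec A c a y)) \<and>
        (\<forall>u\<in>tangent_space A a. \<forall>u'\<in>tangent_space A a. h a u u' = h a u' u) \<and>
        (\<forall>u\<in>tangent_space A a. u \<noteq> (\<lambda>_. 0) \<longrightarrow> h a u u > 0)) \<and>
     (\<forall>x x'. C1_on (chart_image c) (\<lambda>y.
        h (chart_inv c y) (coord_tvec A c (chart_inv c y) x) (coord_tvec A c (chart_inv c y) x'))))"

text \<open>
  The value of the volume form of \<open>h\<close> on the tangent vectors \<open>u i\<close>, up to sign; the sign would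
  depend on an orientation, which \<open>M\<close> need not have.
\<close>

definition volume_density :: "'a metric_tensor \<Rightarrow> 'a \<Rightarrow> ('m::finite \<Rightarrow> 'a tvec) \<Rightarrow> real" where
  "volume_density h a u = sqrt (det (\<chi> i j. h a (u i) (u j)))"

text \<open>
  The measure on \<open>M\<close> given by integration of the volume form of \<open>h\<close>; since the chart domains
  cover the compact set \<open>M\<close>, this condition determines \<open>N\<close>.
\<close>

definition volume_measure ::
    "'a::topological_space set \<Rightarrow> ('a, 'm::finite) chart set \<Rightarrow> 'a metric_tensor \<Rightarrow>
     'a measure \<Rightarrow> bool" where
  "volume_measure M A h N \<longleftrightarrow>
     sets N = sets (restrict_space borel M) \<and>
     (\<forall>c\<in>A. \<forall>B\<in>sets N. B \<subseteq> fst c \<longrightarrow>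
        emeasure N B = (\<integral>\<^sup>+ y. ennreal (volume_density h (chart_inv c y)
             (\<lambda>i::'m. coord_tvec A c (chart_inv c y) (axis i 1))) * indicator (snd c ` B) y \<partial>lborel))"

definition sharp ::
    "('a, 'm::finite) chart set \<Rightarrow> 'a metric_tensor \<Rightarrow> 'a \<Rightarrow> ('a tvec \<Rightarrow> real) \<Rightarrow> 'a tvec" where
  "sharp A h a w =
     (THE u. u \<in> tangent_space A a \<and> (\<forall>u'\<in>tangent_space A a. h a u u' = w u'))"

definition inverse_metric ::
    "('a, 'm::finite) chart set \<Rightarrow> 'a metric_tensor \<Rightarrow> 'a \<Rightarrow>
     ('a tvec \<Rightarrow> real) \<Rightarrow> ('a tvec \<Rightarrow> real) \<Rightarrow> real" where
  "inverse_metric A h a w w' = h a (sharp A h a w) (sharp A h a w')"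

text \<open>
  The codifferential, i.e. the adjoint of the differential for the Hodge inner products of the
  inverse metric of \<open>h\<close> and the measure \<open>N\<close>. It is the classical one when \<open>N\<close> is the volume
  measure of \<open>h\<close>. Continuity of \<open>D w\<close> makes its values unique at every point.
\<close>

definition codifferential ::
    "'a::topological_space set \<Rightarrow> ('a, 'm::finite) chart set \<Rightarrow> 'a metric_tensor \<Rightarrow>
     'a measure \<Rightarrow> (('a \<Rightarrow> 'a tvec \<Rightarrow> real) \<Rightarrow> 'a \<Rightarrow> real) \<Rightarrow> bool" where
  "codifferential M A h N D \<longleftrightarrow> (\<forall>w. C1_form A w \<longrightarrow>
     continuous_on M (D w) \<and>
     (\<forall>f. C2_fun A f \<longrightarrow>
        (\<integral>a. inverse_metric A h a (w a) (differential f a) \<partial>N) = (\<integral>a. D w a * f a \<partial>N)))"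

section \<open>The flow and the observation map\<close>

definition is_flow :: "(real \<Rightarrow> 'a \<Rightarrow> 'a) \<Rightarrow> bool" where
  "is_flow \<Phi> \<longleftrightarrow> \<Phi> 0 = id \<and> (\<forall>s t. \<Phi> (s + t) = \<Phi> s \<circ> \<Phi> t)"

definition dynamical_vector_field ::
    "'a set \<Rightarrow> ('a, 'm::finite) chart set \<Rightarrow> (real \<Rightarrow> 'a \<Rightarrow> 'a) \<Rightarrow> ('a \<Rightarrow> 'a tvec) \<Rightarrow> bool" where
  "dynamical_vector_field M A \<Phi> v \<longleftrightarrow> C1_vector_field M A v \<and>
     (\<forall>a\<in>M. \<forall>f. C1_fun A f \<longrightarrow> ((\<lambda>t. (f (\<Phi> t a) - f a) / t) \<longlongrightarrow> v a f) (at 0))"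

definition pushforward :: "('a \<Rightarrow> 'b::euclidean_space) \<Rightarrow> 'a tvec \<Rightarrow> 'b" where
  "pushforward F u = (\<Sum>e\<in>Basis. u (\<lambda>b. F b \<bullet> e) *\<^sub>R e)"

definition C2_embedding ::
    "'a set \<Rightarrow> ('a, 'm::finite) chart set \<Rightarrow> ('a \<Rightarrow> 'b::euclidean_space) \<Rightarrow> bool" where
  "C2_embedding M A F \<longleftrightarrow> C2_fun A F \<and> inj_on F M \<and>
     (\<forall>c\<in>A. \<forall>a\<in>fst c. inj (frechet_derivative (F \<circ> chart_inv c) (at (snd c a))))"

definition ambient_metric :: "('a \<Rightarrow> 'b::euclidean_space) \<Rightarrow> 'a metric_tensor" where
  "ambient_metric F a u u' = pushforward F u \<bullet> pushforward F u'"

definition field_norm :: "'a metric_tensor \<Rightarrow> ('a \<Rightarrow> 'a tvec) \<Rightarrow> 'a \<Rightarrow> real" where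
  "field_norm g v a = sqrt (g a (v a) (v a))"

section \<open>Cone kernels and the diffusion operator\<close>

text \<open>
  A scheme is a set \<open>J\<close> of sample indices with weights \<open>w\<close>; the central scheme
  has \<open>J = {-p..p}\<close>.
\<close>

definition fd_accuracy :: "int set \<Rightarrow> (int \<Rightarrow> real) \<Rightarrow> nat \<Rightarrow> bool" where
  "fd_accuracy J w p \<longleftrightarrow>
     (\<forall>f :: real \<Rightarrow> real. (\<forall>i. (deriv ^^ i) f differentiable_on UNIV) \<longrightarrow>
       (\<forall>t. (\<lambda>dt. deriv f t - (\<Sum>j\<in>J. w j * f (t + of_int j * dt)) / dt)
              \<in> O[at_right 0](\<lambda>dt. dt ^ p)))"

definition fd_velocity ::
    "int set \<Rightarrow> (int \<Rightarrow> real) \<Rightarrow> (real \<Rightarrow> 'a \<Rightarrow> 'a) \<Rightarrow> ('a \<Rightarrow> 'b::euclidean_space) \<Rightarrow>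
     real \<Rightarrow> 'a \<Rightarrow> 'b" where
  "fd_velocity J w \<Phi> F dt a = (\<Sum>j\<in>J. w j *\<^sub>R F (\<Phi> (of_int j * dt) a))"

definition cos_angle :: "'b::euclidean_space \<Rightarrow> 'b \<Rightarrow> real" where
  "cos_angle x y = (x \<bullet> y) / (norm x * norm y)"

text \<open>In the kernels, \<open>\<xi> dt a\<close> is the finite-difference velocity at \<open>a\<close> for the interval \<open>dt\<close>.\<close>

definition cone_kernel ::
    "(real \<Rightarrow> 'a \<Rightarrow> 'b) \<Rightarrow> ('a \<Rightarrow> 'b::euclidean_space) \<Rightarrow> real \<Rightarrow> real \<Rightarrow> 'a \<Rightarrow> 'a \<Rightarrow> real" where
  "cone_kernel \<xi> F \<zeta> dt a b =
     (let \<omega> = F b - F a in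
      if a = b then 1
      else exp (- (norm \<omega>)\<^sup>2 / (norm (\<xi> dt a) * norm (\<xi> dt b)) *
             sqrt ((1 - \<zeta> * (cos_angle (\<xi> dt a) \<omega>)\<^sup>2) * (1 - \<zeta> * (cos_angle (\<xi> dt b) \<omega>)\<^sup>2))))"

definition diffusion_H ::
    "nat \<Rightarrow> 'a measure \<Rightarrow> (real \<Rightarrow> 'a \<Rightarrow> 'a \<Rightarrow> real) \<Rightarrow> real \<Rightarrow> ('a \<Rightarrow> real) \<Rightarrow> 'a \<Rightarrow> real" where
  "diffusion_H m \<mu> K dt f a = (1 / dt ^ m) * (\<integral>b. K dt a b * f b \<partial>\<mu>)"

definition diffusion_P ::
    "nat \<Rightarrow> 'a measure \<Rightarrow> (real \<Rightarrow> 'a \<Rightarrow> 'a \<Rightarrow> real) \<Rightarrow> real \<Rightarrow> ('a \<Rightarrow> real) \<Rightarrow> 'a \<Rightarrow> real" where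
  "diffusion_P m \<mu> K dt f a = diffusion_H m \<mu> K dt f a / diffusion_H m \<mu> K dt (\<lambda>_. 1) a"

definition diffusion_L ::
    "nat \<Rightarrow> 'a measure \<Rightarrow> (real \<Rightarrow> 'a \<Rightarrow> 'a \<Rightarrow> real) \<Rightarrow> real \<Rightarrow> ('a \<Rightarrow> real) \<Rightarrow> 'a \<Rightarrow> real" where
  "diffusion_L m \<mu> K dt f a = (f a - diffusion_P m \<mu> K dt f a) / dt\<^sup>2"

text \<open>
  \<open>h\<close> is an induced metric of the kernel family \<open>K\<close>: the limit of the diffusion operators is
  a codifferential composed with \<open>d\<close>. Two points of normalization:

  The factor 1/4 belongs to kernels of the form \<open>exp (- r\<^sup>2 / dt\<^sup>2)\<close>. Already on the real line,
  the mean of \<open>f\<close> against this Gaussian is \<open>f a + (dt\<^sup>2 / 4) * f'' a + o(dt\<^sup>2)\<close>, so the limit is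
  one quarter of the Laplacian of the metric \<open>r\<^sup>2\<close>.

  The Hodge inner products are taken with respect to \<open>s\<close> times the volume measure \<open>\<nu>\<close> of \<open>h\<close>,
  where \<open>s\<close> is a positive density; the plain Hodge inner products of \<open>h\<close> are the case \<open>s = 1\<close>.
  The operators average against \<open>\<mu>\<close>, which in general is not a constant multiple of \<open>\<nu>\<close>, and
  their limit is then self-adjoint with respect to a weighted measure.
\<close>

definition induced_metric ::
    "'a::topological_space set \<Rightarrow> ('a, 'm::finite) chart set \<Rightarrow> 'a measure \<Rightarrow>
     (real \<Rightarrow> 'a \<Rightarrow> 'a \<Rightarrow> real) \<Rightarrow> 'a metric_tensor \<Rightarrow> 'a measure \<Rightarrow> ('a \<Rightarrow> real) \<Rightarrow> bool" where
  "induced_metric M A \<mu> K h \<nu> s \<longleftrightarrow>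
     riemannian_metric A h \<and> volume_measure M A h \<nu> \<and> C1_fun A s \<and> (\<forall>a\<in>M. s a > 0) \<and>
     (\<exists>D. codifferential M A h (density \<nu> (\<lambda>a. ennreal (s a))) D \<and>
        (\<forall>f. C2_fun A f \<longrightarrow> (\<forall>a\<in>M.
           ((\<lambda>dt. diffusion_L CARD('m) \<mu> K dt f a) \<longlongrightarrow> D (differential f) a / 4) (at_right 0))))"

end

theory Submission
  imports Defs "HOL-Probability.Distributions"
begin

text \<open>
  Only the principal symbol of the limit operator is needed. With \<open>f = F \<bullet> e\<close>, the combination
  \<open>L (f\<^sup>2) - 2 * f a * L f\<close> at \<open>a\<close> equals, up to sign, the mean of \<open>((f - f a) / dt)\<^sup>2\<close> against the
  kernel. Rescaling a chart around \<open>a\<close> by \<open>dt\<close> turns the kernel into the Gaussian of the quadratic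
  form \<open>B x x = (\<parallel>DF x\<parallel>\<^sup>2 - \<zeta> (V \<bullet> DF x)\<^sup>2 / \<parallel>V\<parallel>\<^sup>2) / \<parallel>V\<parallel>\<^sup>2\<close>, whose second moments are half
  its inverse; for this it is enough that the finite differences converge to \<open>dt V\<close> with a uniform
  relative error \<open>o(1)\<close>. On the other side the product rule for the codifferential, with any
  density \<open>s\<close>, gives \<open>-2\<close> times the inverse metric at \<open>df\<close> for the same combination. The
  differentials of the functions \<open>F \<bullet> e\<close> exhaust the cotangent space, so \<open>h\<close> and \<open>B\<close> have the same
  inverse and hence agree. The volume forms follow from the determinant of a rank-one update.
\<close>

section \<open>Maps of class C1 and C2\<close>

text \<open>The first-order part of the limit operator depends on \<open>s\<close> and on
  corrections to the kernel beyond leading order. The combination with the square of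
  \<open>f\<close> removes it: on the kernel side the identity is exact before any limit, and the
  integrand \<open>((f - f a) / dt)\<^sup>2\<close> is already of order one, so only the leading
  Gaussian survives. The constants then fit: the Gaussian contributes minus one half of the inverse
  form, the codifferential -2 times the inverse metric, and the factor 1/4 in
  \<open>induced_metric\<close> makes these equal.

  Three obstacles shape the details. The codifferential is known only through integrals, while the
  kernel limit is pointwise; density of polynomials in \<open>F\<close> and the full support of the
  volume measure bridge the two. The phase space carries no metric, so every uniform estimate is
  measured in the image of \<open>F\<close>. Integrability of the kernel sections is not given and
  has to come from the convergence itself, which forces a limit along a well-chosen sequence of
  sampling intervals.\<close>

lemma C1_on_imp_continuous_on: "C1_on S f \<Longrightarrow> continuous_on S f"
  unfolding C1_on_def
  by (auto intro!: continuous_at_imp_continuous_on intro: has_derivative_continuous)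

lemma C1_on_imp_differentiable: "C1_on S f \<Longrightarrow> x \<in> S \<Longrightarrow> f differentiable (at x)"
  unfolding C1_on_def differentiable_def by blast

lemma C2_on_imp_C1_on: "C2_on S f \<Longrightarrow> C1_on S f"
  using C1_on_imp_continuous_on unfolding C2_on_def C1_on_def by blast

lemma C1_on_const: "C1_on S (\<lambda>x. c)"
  unfolding C1_on_def
  by (rule exI[of _ "\<lambda>_. 0"]) (auto simp: zero_blinfun.rep_eq)

lemma C1_on_add:
  assumes "C1_on S f" "C1_on S g" shows "C1_on S (\<lambda>x. f x + g x)"
proof -
  obtain f' g' where "\<And>x. x \<in> S \<Longrightarrow> (f has_derivative blinfun_apply (f' x)) (at x)" "continuous_on S f'"
    "\<And>x. x \<in> S \<Longrightarrow> (g has_derivative blinfun_apply (g' x)) (at x)" "continuous_on S g'"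
    using assms unfolding C1_on_def by metis
  then show ?thesis unfolding C1_on_def
    by (intro exI[of _ "\<lambda>x. f' x + g' x"])
       (auto intro!: continuous_intros has_derivative_add simp: plus_blinfun.rep_eq)
qed

lemma C1_on_bilinear:
  assumes "bounded_bilinear B" "C1_on S f" "C1_on S g" shows "C1_on S (\<lambda>x. B (f x) (g x))"
proof -
  interpret bounded_bilinear B by fact
  obtain f' g' where *: "\<And>x. x \<in> S \<Longrightarrow> (f has_derivative blinfun_apply (f' x)) (at x)" "continuous_on S f'"
    "\<And>x. x \<in> S \<Longrightarrow> (g has_derivative blinfun_apply (g' x)) (at x)" "continuous_on S g'"
    using assms unfolding C1_on_def by metis
  have "continuous_on S f" "continuous_on S g"
    using assms by (auto intro: C1_on_imp_continuous_on)
  \<comment> \<open>The product rule is restated through bounded operators because class C1 asks for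
    a derivative that is continuous in operator norm.\<close>
  moreover have "blinfun_apply ((prod_right (f x) o\<^sub>L g' x) + (prod_left (g x) o\<^sub>L f' x)) =
      (\<lambda>h. B (f x) (g' x h) + B (f' x h) (g x))" for x
    by (simp add: fun_eq_iff blinfun.add_left)
  ultimately show ?thesis using * unfolding C1_on_def
    by (intro exI[of _ "\<lambda>x. (prod_right (f x) o\<^sub>L g' x) + (prod_left (g x) o\<^sub>L f' x)"])
       (auto intro!: continuous_intros FDERIV bounded_linear.continuous_on[OF bounded_linear_prod_left]
         bounded_linear.continuous_on[OF bounded_linear_prod_right])
qed

lemmas C1_on_scaleR = C1_on_bilinear[OF bounded_bilinear_scaleR]
lemmas C1_on_inner = C1_on_bilinear[OF bounded_bilinear_inner]

lemma C1_on_linear_compose: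
  assumes "bounded_linear L" "C1_on S f" shows "C1_on S (\<lambda>x. L (f x))"
proof -
  obtain f' where *: "\<And>x. x \<in> S \<Longrightarrow> (f has_derivative blinfun_apply (f' x)) (at x)" "continuous_on S f'"
    using assms unfolding C1_on_def by metis
  have "blinfun_apply (Blinfun L o\<^sub>L f' a) = (\<lambda>x. L (f' a x))" for a
    by (simp add: bounded_linear_Blinfun_apply[OF assms(1)] fun_eq_iff)
  with * show ?thesis unfolding C1_on_def
    by (intro exI[of _ "\<lambda>x. Blinfun L o\<^sub>L f' x"])
       (auto intro!: continuous_intros bounded_linear.has_derivative[OF assms(1)] simp del: blinfun_apply_blinfun_compose)
qed

lemma C2_on_const: "C2_on S (\<lambda>x. c)"
  unfolding C2_on_def
  by (rule exI[of _ "\<lambda>_. 0"]) (auto simp: zero_blinfun.rep_eq C1_on_const)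

lemma C2_on_add:
  assumes "C2_on S f" "C2_on S g" shows "C2_on S (\<lambda>x. f x + g x)"
proof -
  obtain f' g' where "\<And>x. x \<in> S \<Longrightarrow> (f has_derivative blinfun_apply (f' x)) (at x)" "C1_on S f'"
    "\<And>x. x \<in> S \<Longrightarrow> (g has_derivative blinfun_apply (g' x)) (at x)" "C1_on S g'"
    using assms unfolding C2_on_def by metis
  then show ?thesis unfolding C2_on_def
    by (intro exI[of _ "\<lambda>x. f' x + g' x"])
       (auto intro!: C1_on_add has_derivative_add simp: plus_blinfun.rep_eq)
qed

lemma C2_on_mult:
  fixes f g :: "'x::real_normed_vector \<Rightarrow> real"
  assumes "C2_on S f" "C2_on S g" shows "C2_on S (\<lambda>x. f x * g x)"
proof -
  obtain f' g' where *: "\<And>x. x \<in> S \<Longrightarrow> (f has_derivative blinfun_apply (f' x)) (at x)" "C1_on S f'"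
    "\<And>x. x \<in> S \<Longrightarrow> (g has_derivative blinfun_apply (g' x)) (at x)" "C1_on S g'"
    using assms unfolding C2_on_def by metis
  have "C1_on S f" "C1_on S g"
    using assms by (auto intro: C2_on_imp_C1_on)
  with * show ?thesis unfolding C2_on_def
    by (intro exI[of _ "\<lambda>x. f x *\<^sub>R g' x + g x *\<^sub>R f' x"])
       (auto intro!: C1_on_add C1_on_scaleR derivative_eq_intros
         simp: blinfun.bilinear_simps fun_eq_iff)
qed

lemma C2_on_linear_compose:
  assumes "bounded_linear L" "C2_on S f" shows "C2_on S (\<lambda>x. L (f x))"
proof -
  obtain f' where *: "\<And>x. x \<in> S \<Longrightarrow> (f has_derivative blinfun_apply (f' x)) (at x)" "C1_on S f'"
    using assms unfolding C2_on_def by metis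
  have "blinfun_apply (Blinfun L o\<^sub>L f' a) = (\<lambda>x. L (f' a x))" for a
    by (simp add: bounded_linear_Blinfun_apply[OF assms(1)] fun_eq_iff)
  with * show ?thesis unfolding C2_on_def
    by (intro exI[of _ "\<lambda>x. Blinfun L o\<^sub>L f' x"])
       (auto intro!: C1_on_linear_compose[OF bounded_bilinear.bounded_linear_right[OF bounded_bilinear_blinfun_compose]]
         bounded_linear.has_derivative[OF assms(1)] simp del: blinfun_apply_blinfun_compose)
qed

lemma C1_on_cong:
  assumes "open S" "\<And>x. x \<in> S \<Longrightarrow> f x = g x" "C1_on S f" shows "C1_on S g"
  using assms unfolding C1_on_def by (metis has_derivative_transform_within_open)

text \<open>The derivative is unique, so \<open>frechet_derivative\<close> agrees with the
  operator-valued witness, and evaluation at a fixed vector is bounded linear on operators. This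
  makes the chart components of differentials and of the derivative of \<open>F\<close> C1.\<close>

lemma C1_on_frechet_derivative:
  assumes "open S" "C2_on S f" shows "C1_on S (\<lambda>y. frechet_derivative f (at y) x)"
proof -
  obtain f' where *: "\<And>x. x \<in> S \<Longrightarrow> (f has_derivative blinfun_apply (f' x)) (at x)" "C1_on S f'"
    using assms unfolding C2_on_def by metis
  have "C1_on S (\<lambda>y. f' y x)"
    by (rule C1_on_linear_compose[OF _ *(2)]) (rule blinfun.bounded_linear_left)
  moreover have "frechet_derivative f (at y) = f' y" if "y \<in> S" for y
    using frechet_derivative_at[OF *(1)[OF that]] by simp
  ultimately show ?thesis by (auto intro: C1_on_cong[OF assms(1), rotated])
qed

section \<open>Weights of finite-difference schemes\<close>

lemma higher_deriv_ident:
  "(deriv ^^ i) (\<lambda>x::real. x) = (if i = 0 then (\<lambda>x. x) else if i = 1 then (\<lambda>_. 1) else (\<lambda>_. 0))"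
proof (induction i)
  case (Suc i)
  have "deriv (\<lambda>x::real. x) = (\<lambda>_. 1)" "deriv (\<lambda>x::real. c) = (\<lambda>_. 0)" for c
    by (auto simp: fun_eq_iff intro!: DERIV_imp_deriv derivative_eq_intros)
  with Suc show ?case by auto
qed auto

lemma higher_deriv_const_differentiable: "(deriv ^^ i) (\<lambda>x::real. 1::real) differentiable_on UNIV"
proof -
  have "\<exists>c. (deriv ^^ i) (\<lambda>x::real. 1::real) = (\<lambda>_. c)"
  proof (induction i)
    case (Suc i)
    have "deriv (\<lambda>x::real. c) = (\<lambda>_. 0)" for c :: real
      by (auto simp: fun_eq_iff intro!: DERIV_imp_deriv derivative_eq_intros)
    with Suc show ?case by auto
  qed auto
  then show ?thesis by auto
qed

text \<open>Testing on 1 and on the identity suffices: for 1 the error is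
  \<open>- (\<Sum>j\<in>J. w j) / dt\<close>, which stays bounded only if the sum vanishes; for the
  identity at time 0 the error is a constant, which must then be 0. These two moment conditions
  carry the accuracy assumption into the rest of the proof.\<close>

lemma fd_accuracy_weights:
  assumes acc: "fd_accuracy J w p" and p: "p \<ge> 1"
  shows "(\<Sum>j\<in>J. w j) = 0" "(\<Sum>j\<in>J. w j * of_int j) = 1"
proof -
  have pw: "((\<lambda>dt::real. dt ^ p) \<longlongrightarrow> 0) (at_right 0)"
    using p by (auto intro!: tendsto_eq_intros)
  have lim: "((\<lambda>dt. deriv f t - (\<Sum>j\<in>J. w j * f (t + of_int j * dt)) / dt) \<longlongrightarrow> 0) (at_right 0)"
    if "\<forall>i. (deriv ^^ i) f differentiable_on UNIV" for f :: "real \<Rightarrow> real" and t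
  proof -
    have "(\<lambda>dt. deriv f t - (\<Sum>j\<in>J. w j * f (t + of_int j * dt)) / dt) \<in> O[at_right 0](\<lambda>dt. dt ^ p)"
      using acc that unfolding fd_accuracy_def by blast
    then obtain c where "eventually (\<lambda>dt. norm (deriv f t - (\<Sum>j\<in>J. w j * f (t + of_int j * dt)) / dt) \<le> c * norm (dt ^ p)) (at_right 0)"
      by (elim landau_o.bigE)
    moreover have "((\<lambda>dt::real. c * norm (dt ^ p)) \<longlongrightarrow> 0) (at_right 0)"
      using tendsto_mult_right_zero[OF tendsto_norm_zero[OF pw], of c] by simp
    ultimately show ?thesis by (rule Lim_null_comparison)
  qed
  have "((\<lambda>dt. dt * (0 - (\<Sum>j\<in>J. w j) / dt)) \<longlongrightarrow> 0 * 0) (at_right 0)"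
    using lim[of "\<lambda>_. 1" 0] higher_deriv_const_differentiable
    by (intro tendsto_intros) (auto simp: )
  moreover have "eventually (\<lambda>dt. dt * (0 - (\<Sum>j\<in>J. w j) / dt) = - (\<Sum>j\<in>J. w j)) (at_right 0)"
    by (auto simp: eventually_at_filter)
  ultimately have "((\<lambda>dt. - (\<Sum>j\<in>J. w j)) \<longlongrightarrow> 0 * 0) (at_right (0::real))"
    by (rule Lim_transform_eventually)
  then show "(\<Sum>j\<in>J. w j) = 0" by (simp add: tendsto_const_iff)
  have "\<forall>i. (deriv ^^ i) (\<lambda>x::real. x) differentiable_on UNIV"
    by (simp add: higher_deriv_ident)
  from lim[OF this, of 0]
  have "((\<lambda>dt. 1 - (\<Sum>j\<in>J. w j * (of_int j * dt)) / dt) \<longlongrightarrow> 0) (at_right 0)" by simp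
  moreover have "eventually (\<lambda>dt. 1 - (\<Sum>j\<in>J. w j * (of_int j * dt)) / dt = 1 - (\<Sum>j\<in>J. w j * of_int j)) (at_right 0)"
  proof -
    have "(\<Sum>j\<in>J. w j * (of_int j * dt)) = (\<Sum>j\<in>J. w j * of_int j) * dt" for dt :: real
      by (simp only: sum_distrib_right mult.assoc)
    then show ?thesis by (auto simp: eventually_at_filter)
  qed
  ultimately have "((\<lambda>dt. 1 - (\<Sum>j\<in>J. w j * of_int j)) \<longlongrightarrow> 0) (at_right (0::real))"
    by (rule Lim_transform_eventually)
  then show "(\<Sum>j\<in>J. w j * of_int j) = 1" by (simp add: tendsto_const_iff)
qed

section \<open>Gaussian integrals\<close>

lemma integrable_gaussian:
  fixes c :: real assumes c: "c > 0"
  shows "integrable lborel (\<lambda>x::'e::euclidean_space. exp (- c * (norm x)\<^sup>2))"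
proof (rule integrableI_bounded)
  show "(\<lambda>x::'e. exp (- c * (norm x)\<^sup>2)) \<in> borel_measurable lborel"
    by measurable
  have eq: "exp (- c * (norm x)\<^sup>2) = (\<Prod>b\<in>Basis. exp (- c * (x \<bullet> b)\<^sup>2))" for x :: 'e
    by (subst (1) euclidean_inner[of x x, folded power2_norm_eq_inner])
       (simp add: exp_sum[symmetric] sum_distrib_left power2_eq_square)
  \<comment> \<open>With this \<sigma>, \<open>1 / (2 * \<sigma>\<^sup>2) = c\<close>, so each
    one-dimensional factor is a multiple of a normal density.\<close>
  define \<sigma> where "\<sigma> = sqrt (1 / (2 * c))"
  have s: "\<sigma> > 0" "2 * \<sigma>\<^sup>2 = 1 / c" using c by (auto simp: \<sigma>_def)
  have "exp (- c * x\<^sup>2) = sqrt (2 * pi * \<sigma>\<^sup>2) * normal_density 0 \<sigma> x" for x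
    using s c by (simp add: normal_density_def)
  then have i: "integrable lborel (\<lambda>x::real. exp (- c * x\<^sup>2))"
    using s by simp
  have "(\<integral>\<^sup>+(x::'e). ennreal (norm (exp (- c * (norm x)\<^sup>2))) \<partial>lborel) =
      (\<integral>\<^sup>+(x::'e). (\<Prod>b\<in>Basis. ennreal (exp (- c * (x \<bullet> b)\<^sup>2))) \<partial>lborel)"
    by (simp only: eq) (simp add: prod_ennreal prod_nonneg)
  also have "\<dots> = (\<Prod>b\<in>(Basis::'e set). (\<integral>\<^sup>+x. ennreal (exp (- c * x\<^sup>2)) \<partial>lborel))"
    by (rule nn_integral_lborel_prod) auto
  also have "\<dots> < \<infinity>"
    using i by (subst nn_integral_eq_integral) (auto simp: ennreal_power)
  finally show "(\<integral>\<^sup>+(x::'e). ennreal (norm (exp (- c * (norm x)\<^sup>2))) \<partial>lborel) < \<infinity>" .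
qed

text \<open>The quadratic factor is at most \<open>2 * exp r\<close>, and completing the square pays
  for the remaining linear exponent \<open>(K + 1) * r\<close> with half of the Gaussian
  rate.\<close>

lemma gaussian_absorbs:
  fixes c K :: real assumes "c > 0"
  obtains C where "C \<ge> 0" "\<And>r. r \<ge> 0 \<Longrightarrow> r\<^sup>2 * exp (K * r) * exp (- c * r\<^sup>2) \<le> C * exp (- (c / 2) * r\<^sup>2)"
proof
  show "(0::real) \<le> 2 * exp ((K + 1)\<^sup>2 / (2 * c))" by simp
  fix r :: real assume r: "r \<ge> 0"
  have "r\<^sup>2 \<le> 2 * exp r"
    using exp_lower_Taylor_quadratic[OF r] r by (simp add: field_simps)
  then have "r\<^sup>2 * exp (K * r) * exp (- c * r\<^sup>2) \<le> 2 * exp r * exp (K * r) * exp (- c * r\<^sup>2)"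
    by (intro mult_right_mono) auto
  also have "\<dots> = 2 * exp ((K + 1) * r - c * r\<^sup>2)"
    by (simp add: exp_add[symmetric] algebra_simps)
  also have "\<dots> \<le> 2 * exp ((K + 1)\<^sup>2 / (2 * c) - (c / 2) * r\<^sup>2)"
  proof -
    have "0 \<le> (c * r - (K + 1))\<^sup>2 / (2 * c)" using assms by simp
    also have "\<dots> = (K + 1)\<^sup>2 / (2 * c) - (c / 2) * r\<^sup>2 - ((K + 1) * r - c * r\<^sup>2)"
      using assms by (simp add: field_simps power2_eq_square)
    finally show ?thesis by simp
  qed
  also have "\<dots> = 2 * exp ((K + 1)\<^sup>2 / (2 * c)) * exp (- (c / 2) * r\<^sup>2)"
    by (simp add: exp_add[symmetric] exp_diff exp_minus field_simps)
  finally show "r\<^sup>2 * exp (K * r) * exp (- c * r\<^sup>2) \<le> 2 * exp ((K + 1)\<^sup>2 / (2 * c)) * exp (- (c / 2) * r\<^sup>2)" .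
qed

text \<open>Taylor's formula with Lagrange remainder for \<open>exp y\<close> and
  \<open>exp (- y)\<close>: the linear terms cancel and the two remainders average. The bounds later
  serve twice, for a pointwise limit and for its dominating function.\<close>

lemma exp_second_difference_bounds:
  fixes y :: real
  shows "y\<^sup>2 * exp (- \<bar>y\<bar>) \<le> exp y + exp (- y) - 2" "exp y + exp (- y) - 2 \<le> y\<^sup>2 * exp \<bar>y\<bar>"
proof -
  obtain s where s: "\<bar>s\<bar> \<le> \<bar>y\<bar>" "exp y = 1 + y + exp s / 2 * y\<^sup>2"
    using Maclaurin_exp_le[of y 2] by (auto simp: numeral_2_eq_2)
  obtain s' where s': "\<bar>s'\<bar> \<le> \<bar>y\<bar>" "exp (- y) = 1 - y + exp s' / 2 * y\<^sup>2"
    using Maclaurin_exp_le[of "-y" 2] by (auto simp: numeral_2_eq_2)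
  have eq: "exp y + exp (- y) - 2 = y\<^sup>2 * ((exp s + exp s') / 2)"
    by (simp add: s s' field_simps)
  have "exp (- \<bar>y\<bar>) \<le> exp s" "exp (- \<bar>y\<bar>) \<le> exp s'" "exp s \<le> exp \<bar>y\<bar>" "exp s' \<le> exp \<bar>y\<bar>"
    using s s' by auto
  then have "exp (- \<bar>y\<bar>) \<le> (exp s + exp s') / 2" and "(exp s + exp s') / 2 \<le> exp \<bar>y\<bar>"
    by argo+
  then show "y\<^sup>2 * exp (- \<bar>y\<bar>) \<le> exp y + exp (- y) - 2" "exp y + exp (- y) - 2 \<le> y\<^sup>2 * exp \<bar>y\<bar>"
    unfolding eq by (intro mult_left_mono; simp)+
qed

text \<open>Translating the Gaussian by \<open>t *\<^sub>R u\<close> leaves its integral unchanged; the second moment is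
  the coefficient of \<open>t\<^sup>2\<close> of this identity.\<close>

lemma gaussian_second_moment:
  fixes B :: "'e::euclidean_space \<Rightarrow> 'e \<Rightarrow> real"
  assumes bil: "bilinear B" and sym: "\<And>x y. B x y = B y x"
    and c: "c > 0" "\<And>x. B x x \<ge> c * (norm x)\<^sup>2"
  shows "integrable lborel (\<lambda>x. exp (- B x x))"
    and "integrable lborel (\<lambda>x. exp (- B x x) * (B u x)\<^sup>2)"
    and "(\<integral>x. exp (- B x x) * (B u x)\<^sup>2 \<partial>lborel) = B u u / 2 * (\<integral>x. exp (- B x x) \<partial>lborel)"
proof -
  have mB: "(\<lambda>x. B x x) \<in> borel_measurable borel" "(\<lambda>x. B u x) \<in> borel_measurable borel"
    by (intro borel_measurable_continuous_onI bilinear_continuous_on_compose[OF _ _ bil] continuous_intros)+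
  note [measurable] = mB
  show int1: "integrable lborel (\<lambda>x. exp (- B x x))"
    by (rule Bochner_Integration.integrable_bound[OF integrable_gaussian[OF c(1)]])
       (use c in auto)
  obtain K where K: "\<And>x. \<bar>B u x\<bar> \<le> K * norm x" "K \<ge> 0"
  proof -
    have "bounded_linear (B u)" using bil by (simp add: bilinear_def linear_linear)
    then obtain K where "\<And>x. norm (B u x) \<le> norm x * K" "K \<ge> 0"
      using bounded_linear.nonneg_bounded by blast
    then show ?thesis using that[of K] by (simp add: mult.commute)
  qed
  \<comment> \<open>Up to the factor 4 this dominates all second difference quotients
    \<open>D t\<close> below with 0 < t \<le> 1, since their exponent \<open>2 * t * B u x\<close>
    is then at most \<open>2 * \<bar>B u x\<bar>\<close> in absolute value.\<close>
  define G where "G = (\<lambda>x. (B u x)\<^sup>2 * exp (2 * \<bar>B u x\<bar>) * exp (- B x x))"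
  have intG: "integrable lborel G"
  proof -
    obtain C where C: "C \<ge> 0" "\<And>r. r \<ge> 0 \<Longrightarrow> r\<^sup>2 * exp (2 * K * r) * exp (- c * r\<^sup>2) \<le> C * exp (- (c / 2) * r\<^sup>2)"
      using gaussian_absorbs[OF c(1), of "2 * K"] by auto
    have "integrable lborel (\<lambda>x::'e. K\<^sup>2 * (C * exp (- (c / 2) * (norm x)\<^sup>2)))"
      using integrable_gaussian[where ?'e='e, of "c/2"] c(1) by simp
    then show ?thesis
    proof (rule Bochner_Integration.integrable_bound)
      show "G \<in> borel_measurable lborel" unfolding G_def by measurable
      have "norm (G x) \<le> norm (K\<^sup>2 * (C * exp (- (c / 2) * (norm x)\<^sup>2)))" for x
      proof -
        have "(B u x)\<^sup>2 \<le> (K * norm x)\<^sup>2"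
          using power_mono[OF K(1)[of x], of 2] by simp
        then have "G x \<le> (K * norm x)\<^sup>2 * exp (2 * K * norm x) * exp (- c * (norm x)\<^sup>2)"
          unfolding G_def
        proof (intro mult_mono)
          show "exp (2 * \<bar>B u x\<bar>) \<le> exp (2 * K * norm x)" using K(1)[of x] by simp
          show "exp (- B x x) \<le> exp (- c * (norm x)\<^sup>2)" using c(2)[of x] by simp
        qed (use K in simp_all)
        also have "\<dots> = K\<^sup>2 * ((norm x)\<^sup>2 * exp (2 * K * norm x) * exp (- c * (norm x)\<^sup>2))"
          by (simp add: power_mult_distrib)
        also have "\<dots> \<le> K\<^sup>2 * (C * exp (- (c / 2) * (norm x)\<^sup>2))"
          using C(2)[of "norm x"] by (intro mult_left_mono) auto
        finally show ?thesis unfolding G_def using C(1) by simp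
      qed
      then show "AE x in lborel. norm (G x) \<le> norm (K\<^sup>2 * (C * exp (- (c / 2) * (norm x)\<^sup>2)))" by simp
    qed
  qed
  show int2: "integrable lborel (\<lambda>x. exp (- B x x) * (B u x)\<^sup>2)"
    by (rule Bochner_Integration.integrable_bound[OF intG])
       (auto simp: G_def abs_mult intro!: AE_I2 mult_right_mono mult_left_mono[of 1 "exp _" "(_)\<^sup>2", simplified])
  define Z where "Z = (\<integral>x. exp (- B x x) \<partial>lborel)"
  have expand: "B (x + t *\<^sub>R u) (x + t *\<^sub>R u) = B x x + 2 * t * B u x + t\<^sup>2 * B u u" for x t
    using bil sym[of x u] by (simp add: bilinear_ladd bilinear_radd bilinear_lmul bilinear_rmul
        power2_eq_square algebra_simps)
  \<comment> \<open>Expanding the translated form and moving \<open>exp (t\<^sup>2 * B u u)\<close>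
    to the other side yields the Laplace transform of \<open>B u x\<close> under the Gaussian
    weight.\<close>
  have shift: "has_bochner_integral lborel (\<lambda>x. exp (- B x x) * exp (- (2 * t * B u x))) (Z * exp (t\<^sup>2 * B u u))" for t
  proof -
    have "integrable (distr lborel borel (\<lambda>x. t *\<^sub>R u + x)) (\<lambda>x. exp (- B x x))"
      "integral\<^sup>L (distr lborel borel (\<lambda>x. t *\<^sub>R u + x)) (\<lambda>x. exp (- B x x)) = Z"
      using int1 unfolding Z_def by (simp_all add: lborel_distr_plus)
    then have "has_bochner_integral lborel (\<lambda>x. exp (- B (t *\<^sub>R u + x) (t *\<^sub>R u + x))) Z"
      unfolding has_bochner_integral_iff by (simp add: integrable_distr_eq integral_distr)
    then have "has_bochner_integral lborel (\<lambda>x. exp (- B (t *\<^sub>R u + x) (t *\<^sub>R u + x)) * exp (t\<^sup>2 * B u u)) (Z * exp (t\<^sup>2 * B u u))"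
      by (rule has_bochner_integral_mult_left)
    moreover have "exp (- B (t *\<^sub>R u + x) (t *\<^sub>R u + x)) * exp (t\<^sup>2 * B u u) = exp (- B x x) * exp (- (2 * t * B u x))" for x
      using expand[of x t] by (simp add: exp_add[symmetric] add.commute)
    ultimately show ?thesis by simp
  qed
  \<comment> \<open>The symmetric second difference of the Laplace transform: summing over t and -t
    cancels the odd part, so division by \<open>t\<^sup>2\<close> isolates the second
    moment.\<close>
  define D where "D = (\<lambda>t x. exp (- B x x) * ((exp (2 * t * B u x) + exp (- (2 * t * B u x)) - 2) / t\<^sup>2))"
  have D: "integral\<^sup>L lborel (D t) = 2 * Z * (exp (t\<^sup>2 * B u u) - 1) / t\<^sup>2" for t
  proof -
    have "has_bochner_integral lborel (\<lambda>x. (exp (- B x x) * exp (- (2 * (- t) * B u x)) + exp (- B x x) * exp (- (2 * t * B u x))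
        - exp (- B x x) * 2) / t\<^sup>2) ((Z * exp ((- t)\<^sup>2 * B u u) + Z * exp (t\<^sup>2 * B u u) - Z * 2) / t\<^sup>2)"
      by (intro has_bochner_integral_divide_zero has_bochner_integral_diff has_bochner_integral_add shift has_bochner_integral_mult_left)
         (use int1 in \<open>simp add: Z_def has_bochner_integral_integrable\<close>)
    then have "has_bochner_integral lborel (D t) ((Z * exp ((- t)\<^sup>2 * B u u) + Z * exp (t\<^sup>2 * B u u) - Z * 2) / t\<^sup>2)"
      unfolding D_def by (simp add: algebra_simps)
    then show ?thesis by (simp add: has_bochner_integral_integral_eq algebra_simps)
  qed
  have t: "(\<lambda>n. 1 / real (Suc n)) \<longlonglongrightarrow> 0" by (rule LIMSEQ_Suc[OF lim_1_over_n])
  have lim1: "(\<lambda>n. integral\<^sup>L lborel (D (1 / real (Suc n)))) \<longlonglongrightarrow> (\<integral>x. exp (- B x x) * (2 * B u x)\<^sup>2 \<partial>lborel)"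
  proof (rule integral_dominated_convergence[where w="\<lambda>x. 4 * G x"])
    show "(\<lambda>x. exp (- B x x) * (2 * B u x)\<^sup>2) \<in> borel_measurable lborel" by measurable
    show "D (1 / real (Suc n)) \<in> borel_measurable lborel" for n unfolding D_def by measurable
    show "integrable lborel (\<lambda>x. 4 * G x)" using intG by simp
    have b: "(2 * B u x)\<^sup>2 * exp (- \<bar>2 * t * B u x\<bar>) \<le> (exp (2 * t * B u x) + exp (- (2 * t * B u x)) - 2) / t\<^sup>2"
      "(exp (2 * t * B u x) + exp (- (2 * t * B u x)) - 2) / t\<^sup>2 \<le> (2 * B u x)\<^sup>2 * exp \<bar>2 * t * B u x\<bar>"
      if "t \<noteq> 0" for t x
      using exp_second_difference_bounds[of "2 * t * B u x"] that
      by (simp_all add: field_simps power_mult_distrib)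
    show "AE x in lborel. (\<lambda>n. D (1 / real (Suc n)) x) \<longlonglongrightarrow> exp (- B x x) * (2 * B u x)\<^sup>2"
    proof (rule AE_I2)
      fix x
      have "(\<lambda>n. (exp (2 * (1 / real (Suc n)) * B u x) + exp (- (2 * (1 / real (Suc n)) * B u x)) - 2) / (1 / real (Suc n))\<^sup>2) \<longlonglongrightarrow> (2 * B u x)\<^sup>2"
      proof (rule tendsto_sandwich)
        have "(\<lambda>n. (2 * B u x)\<^sup>2 * exp (- \<bar>2 * (1 / real (Suc n)) * B u x\<bar>)) \<longlonglongrightarrow> (2 * B u x)\<^sup>2 * exp (- \<bar>2 * 0 * B u x\<bar>)"
          by (intro tendsto_intros t)
        then show "(\<lambda>n. (2 * B u x)\<^sup>2 * exp (- \<bar>2 * (1 / real (Suc n)) * B u x\<bar>)) \<longlonglongrightarrow> (2 * B u x)\<^sup>2" by simp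
        have "(\<lambda>n. (2 * B u x)\<^sup>2 * exp (\<bar>2 * (1 / real (Suc n)) * B u x\<bar>)) \<longlonglongrightarrow> (2 * B u x)\<^sup>2 * exp (\<bar>2 * 0 * B u x\<bar>)"
          by (intro tendsto_intros t)
        then show "(\<lambda>n. (2 * B u x)\<^sup>2 * exp (\<bar>2 * (1 / real (Suc n)) * B u x\<bar>)) \<longlonglongrightarrow> (2 * B u x)\<^sup>2" by simp
      qed (intro always_eventually allI b, simp)+
      then show "(\<lambda>n. D (1 / real (Suc n)) x) \<longlonglongrightarrow> exp (- B x x) * (2 * B u x)\<^sup>2"
        unfolding D_def by (intro tendsto_mult tendsto_const)
    qed
    fix n
    show "AE x in lborel. norm (D (1 / real (Suc n)) x) \<le> 4 * G x"
    proof (rule AE_I2)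
      fix x
      let ?t = "1 / real (Suc n)"
      have tt: "?t \<noteq> 0" "0 < ?t" "?t \<le> 1" by auto
      have "0 \<le> (2 * B u x)\<^sup>2 * exp (- \<bar>2 * ?t * B u x\<bar>)" by simp
      also note b(1)[OF tt(1)]
      finally have "norm (D ?t x) = exp (- B x x) * ((exp (2 * ?t * B u x) + exp (- (2 * ?t * B u x)) - 2) / ?t\<^sup>2)"
        by (simp only: D_def real_norm_def abs_mult abs_exp_cancel abs_of_nonneg)
      also have "\<dots> \<le> exp (- B x x) * ((2 * B u x)\<^sup>2 * exp \<bar>2 * ?t * B u x\<bar>)"
        by (intro mult_left_mono b(2)[OF tt(1)]) auto
      also have "\<dots> \<le> exp (- B x x) * ((2 * B u x)\<^sup>2 * exp (2 * \<bar>B u x\<bar>))"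
      proof -
        have "\<bar>2 * ?t * B u x\<bar> \<le> 2 * \<bar>B u x\<bar>"
          using tt mult_right_mono[of ?t 1 "\<bar>B u x\<bar>"] by (simp add: abs_mult)
        then show ?thesis by (intro mult_left_mono) auto
      qed
      finally show "norm (D ?t x) \<le> 4 * G x" unfolding G_def by (simp add: power_mult_distrib mult_ac)
    qed
  qed
  \<comment> \<open>The closed form of the integral depends on t only through
    \<open>t\<^sup>2\<close>; in that variable it is a difference quotient of the exponential at
    0.\<close>
  have lim2: "(\<lambda>n. integral\<^sup>L lborel (D (1 / real (Suc n)))) \<longlonglongrightarrow> 2 * Z * B u u"
  proof -
    have "((\<lambda>t. (exp (t * B u u) - 1) / t) \<longlongrightarrow> B u u) (at 0)"
    proof -
      have "((\<lambda>t. exp (t * B u u)) has_field_derivative B u u) (at 0)"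
        by (auto intro!: derivative_eq_intros)
      then show ?thesis by (simp add: DERIV_def)
    qed
    moreover have "filterlim (\<lambda>n. (1 / real (Suc n))\<^sup>2) (at 0) sequentially"
      using tendsto_power[OF t, of 2] by (auto simp: filterlim_at simp del: of_nat_Suc)
    ultimately have "(\<lambda>n. (exp ((1 / real (Suc n))\<^sup>2 * B u u) - 1) / (1 / real (Suc n))\<^sup>2) \<longlonglongrightarrow> B u u"
      by (rule filterlim_compose)
    then have "(\<lambda>n. 2 * Z * ((exp ((1 / real (Suc n))\<^sup>2 * B u u) - 1) / (1 / real (Suc n))\<^sup>2)) \<longlonglongrightarrow> 2 * Z * B u u"
      by (intro tendsto_intros)
    then show ?thesis unfolding D by simp
  qed
  have "(\<integral>x. exp (- B x x) * (2 * B u x)\<^sup>2 \<partial>lborel) = 2 * Z * B u u"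
    using lim1 lim2 by (rule LIMSEQ_unique)
  moreover have "(\<integral>x. exp (- B x x) * (2 * B u x)\<^sup>2 \<partial>lborel) = 4 * (\<integral>x. exp (- B x x) * (B u x)\<^sup>2 \<partial>lborel)"
    by (subst integral_mult_right_zero[symmetric]) (simp add: power_mult_distrib algebra_simps)
  ultimately show "(\<integral>x. exp (- B x x) * (B u x)\<^sup>2 \<partial>lborel) = B u u / 2 * (\<integral>x. exp (- B x x) \<partial>lborel)"
    by (simp add: Z_def)
qed

section \<open>Positive definite forms and determinants\<close>

definition pos_def_form :: "('e::euclidean_space \<Rightarrow> 'e \<Rightarrow> real) \<Rightarrow> bool" where
  "pos_def_form B \<longleftrightarrow> bilinear B \<and> (\<forall>x y. B x y = B y x) \<and> (\<forall>x. x \<noteq> 0 \<longrightarrow> B x x > 0)"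

text \<open>Riesz representation in finite dimension: \<open>T\<close> records the values of
  \<open>B u\<close> on the basis, definiteness makes \<open>T\<close> injective, and equality of
  dimensions makes it surjective.\<close>

lemma pos_def_form_representation:
  fixes l :: "'e::euclidean_space \<Rightarrow> real"
  assumes B: "pos_def_form B" and l: "linear l"
  shows "\<exists>!u. \<forall>x. B u x = l x"
proof -
  have bil: "bilinear B" and pos: "\<And>x. x \<noteq> 0 \<Longrightarrow> B x x > 0"
    using B by (auto simp: pos_def_form_def)
  have lB: "linear (B u)" "linear (\<lambda>u. B u x)" for u x
    using bil by (auto simp: bilinear_def)
  define T where "T = (\<lambda>u. \<Sum>b\<in>Basis. B u b *\<^sub>R b)"
  have T: "T u \<bullet> b = B u b" if "b \<in> Basis" for u b
    using that by (simp add: T_def)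
  have eqI: "B u = f" if "linear f" "\<And>b. b \<in> Basis \<Longrightarrow> B u b = f b" for u f
    using linear_eq_stdbasis[OF lB(1) that(1)] that(2) by blast
  have linT: "linear T"
    unfolding T_def using lB(2)
    by (intro linear_compose_sum ballI) (auto simp: linear_iff scaleR_add_left)
  have inj: "u = u'" if "\<And>x. B u x = B u' x" for u u'
  proof (rule ccontr)
    assume "u \<noteq> u'"
    then have "B (u - u') (u - u') > 0" using pos by simp
    moreover have "B (u - u') (u - u') = 0"
      using that[of "u - u'"] linear_diff[OF lB(2)] by simp
    ultimately show False by simp
  qed
  have "inj T"
  proof (rule injI)
    fix u u' assume "T u = T u'"
    then have "B u b = B u' b" if "b \<in> Basis" for b using T[OF that] by metis
    then have "B u = B u'" by (intro eqI lB)
    then show "u = u'" by (intro inj) simp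
  qed
  with linT have "surj T" by (simp add: linear_injective_imp_surjective)
  then obtain u where "T u = (\<Sum>b\<in>Basis. l b *\<^sub>R b)" by (metis surjD)
  then have "B u b = l b" if "b \<in> Basis" for b
    using T[OF that, of u] that by simp
  then have "B u = l" by (intro eqI l)
  then show ?thesis using inj by auto
qed

text \<open>Legendre duality: \<open>B' x x\<close> is the maximum over all linear \<open>l\<close> of \<open>2 * l x - l u\<close>, where \<open>u\<close>
  represents \<open>l\<close> in \<open>B'\<close>, and \<open>l u\<close> is the value of the inverse form at \<open>l\<close>.\<close>

lemma pos_def_form_determined:
  assumes B: "pos_def_form B" "pos_def_form B'"
    and eq: "\<And>l u u'. linear l \<Longrightarrow> \<forall>x. B u x = l x \<Longrightarrow> \<forall>x. B' u' x = l x \<Longrightarrow> l u = l u'"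
  shows "B = B'"
proof -
  have le: "C x x \<le> C' x x"
    if C: "pos_def_form C" "pos_def_form C'"
      and e: "\<And>l u u'. linear l \<Longrightarrow> \<forall>x. C u x = l x \<Longrightarrow> \<forall>x. C' u' x = l x \<Longrightarrow> l u = l u'" for C C' :: "'a \<Rightarrow> 'a \<Rightarrow> real" and x
  proof -
    have b: "bilinear C'" and s: "C' p q = C' q p" and pos: "p \<noteq> 0 \<longrightarrow> C' p p > 0" for p q
      using C by (auto simp: pos_def_form_def)
    have l: "linear (C x)" using C by (simp add: pos_def_form_def bilinear_def)
    then obtain u where u: "\<forall>y. C' u y = C x y"
      using pos_def_form_representation[OF C(2)] by blast
    \<comment> \<open>The functional \<open>C x\<close> is represented in \<open>C\<close> by
      \<open>x\<close> itself and in \<open>C'\<close> by \<open>u\<close>, so the hypothesis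
      compares its values at these two vectors.\<close>
    have "C x u = C x x" using e[OF l _ u, of x] by simp
    then have uu: "C' u u = C x x" "C' u x = C x x" using u by auto
    have "0 \<le> C' (x - u) (x - u)"
      using pos[of "x - u"] b by (cases "x = u") (auto simp: bilinear_lzero less_imp_le)
    also have "\<dots> = C' x x - 2 * C' u x + C' u u"
      using b s[of x u] by (simp add: bilinear_lsub bilinear_rsub)
    finally show ?thesis using uu by simp
  qed
  have diag: "B x x = B' x x" for x
    using le[OF B eq, of x] le[OF B(2,1) eq[symmetric], of x] by (meson order_antisym)
  have "B x y = B' x y" for x y
  proof -
    have "C x y = (C (x + y) (x + y) - C x x - C y y) / 2" if "pos_def_form C" for C :: "'a \<Rightarrow> 'a \<Rightarrow> real"
    proof -
      have "bilinear C" "C y x = C x y" using that by (auto simp: pos_def_form_def)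
      then show ?thesis by (simp add: bilinear_ladd bilinear_radd)
    qed
    then show ?thesis using B diag by metis
  qed
  then show ?thesis by blast
qed

section \<open>Gram matrices: positivity, inversion and rank-one updates\<close>

definition form_matrix :: "(real ^ 'm \<Rightarrow> real ^ 'm \<Rightarrow> real) \<Rightarrow> real ^ 'm ^ 'm" where
  "form_matrix B = (\<chi> i j. B (axis i 1) (axis j 1))"

lemma linear_axis_expansion:
  fixes l :: "real ^ 'm \<Rightarrow> real"
  assumes "linear l" shows "l x = (\<Sum>i\<in>UNIV. x $ i * l (axis i 1))"
proof -
  have "l x = l (\<Sum>i\<in>UNIV. x $ i *\<^sub>R axis i 1)"
    by (simp add: basis_expansion scalar_mult_eq_scaleR[symmetric])
  then show ?thesis using assms by (simp add: linear_sum linear_scale)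
qed

lemma bilinear_form_matrix:
  fixes B :: "real ^ 'm \<Rightarrow> real ^ 'm \<Rightarrow> real"
  assumes "bilinear B" shows "B x y = x \<bullet> (form_matrix B *v y)"
proof -
  have "B x y = (\<Sum>i\<in>UNIV. x $ i * B (axis i 1) y)"
    using assms by (intro linear_axis_expansion) (auto simp: bilinear_def)
  also have "\<dots> = (\<Sum>i\<in>UNIV. x $ i * (\<Sum>j\<in>UNIV. y $ j * B (axis i 1) (axis j 1)))"
    using assms by (intro sum.cong refl arg_cong2[where f="(*)"] linear_axis_expansion) (auto simp: bilinear_def)
  finally show ?thesis
    by (simp add: inner_vec_def matrix_vector_mult_def form_matrix_def mult.commute)
qed

lemma det_form_matrix_nonzero:
  assumes "pos_def_form B" shows "det (form_matrix B) \<noteq> 0"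
proof -
  have "x = 0" if "form_matrix B *v x = 0" for x
  proof (rule ccontr)
    assume "x \<noteq> 0"
    then have "B x x > 0" using assms by (simp add: pos_def_form_def)
    then show False using bilinear_form_matrix[of B x x] assms that by (simp add: pos_def_form_def)
  qed
  then have "inj ((*v) (form_matrix B))"
    by (simp add: linear_injective_0[OF matrix_vector_mul_linear])
  then show ?thesis
    by (simp add: invertible_det_nz[symmetric] invertible_left_inverse matrix_left_invertible_injective)
qed

text \<open>The segment from the identity matrix to the given one consists of positive definite matrices.\<close>

lemma det_form_matrix_pos:
  fixes B :: "real ^ 'm \<Rightarrow> real ^ 'm \<Rightarrow> real"
  assumes B: "pos_def_form B" shows "det (form_matrix B) > 0"
proof (rule ccontr)
  define C where "C = (\<lambda>t x y. (1 - t) * (x \<bullet> y) + t * B x y)"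
  have posC: "pos_def_form (C t)" if "0 \<le> t" "t \<le> 1" for t
    unfolding pos_def_form_def
  proof (intro conjI allI impI)
    have b: "bilinear B" using B by (simp add: pos_def_form_def)
    show "bilinear (C t)"
      unfolding C_def bilinear_def linear_iff
      by (auto simp: inner_simps bilinear_ladd[OF b] bilinear_radd[OF b] bilinear_lmul[OF b] bilinear_rmul[OF b] algebra_simps)
    show "C t x y = C t y x" for x y
      using B unfolding C_def pos_def_form_def by (simp add: inner_commute)
    fix x :: "real ^ 'm" assume x: "x \<noteq> 0"
    then have "x \<bullet> x > 0" "B x x > 0" using B by (auto simp: pos_def_form_def)
    then show "C t x x > 0" unfolding C_def using that
      by (cases "t = 0") (auto intro: add_nonneg_pos)
  qed
  assume "\<not> det (form_matrix B) > 0"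
  moreover have "form_matrix (C 1) = form_matrix B" "form_matrix (C 0) = mat 1"
    by (simp_all add: C_def form_matrix_def vec_eq_iff mat_def inner_axis_axis)
  moreover have "continuous_on {0..1} (\<lambda>t. det (form_matrix (C t)))"
    unfolding det_def form_matrix_def C_def by (auto intro!: continuous_intros)
  ultimately obtain t where "0 \<le> t" "t \<le> 1" "det (form_matrix (C t)) = 0"
    using IVT2'[of "\<lambda>t. det (form_matrix (C t))" 1 0 0] by auto
  then show False using det_form_matrix_nonzero posC by blast
qed

text \<open>Cramer's rule expresses the coordinates of \<open>u y\<close> as quotients of
  determinants in the entries of \<open>B y\<close> and \<open>l y\<close>, which are continuous; so
  \<open>u\<close> can be any choice of representing vectors. The value \<open>l' y (u y)\<close> is
  the inverse form at the pair \<open>l y\<close>, \<open>l' y\<close>.\<close>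

lemma continuous_on_form_inverse:
  fixes B :: "'x::topological_space \<Rightarrow> real ^ 'm \<Rightarrow> real ^ 'm \<Rightarrow> real"
    and l l' :: "'x \<Rightarrow> real ^ 'm \<Rightarrow> real"
  assumes B: "\<And>y. y \<in> S \<Longrightarrow> pos_def_form (B y)"
    and cont: "\<And>x x'. continuous_on S (\<lambda>y. B y x x')"
    and l: "\<And>y. y \<in> S \<Longrightarrow> linear (l y)" "\<And>x. continuous_on S (\<lambda>y. l y x)"
    and l': "\<And>y. y \<in> S \<Longrightarrow> linear (l' y)" "\<And>x. continuous_on S (\<lambda>y. l' y x)"
    and u: "\<And>y x. y \<in> S \<Longrightarrow> B y (u y) x = l y x"
  shows "continuous_on S (\<lambda>y. l' y (u y))"
proof -
  define U where "U = (\<lambda>y k. det (\<chi> i j. if j = k then l y (axis i 1) else B y (axis i 1) (axis j 1)) / det (form_matrix (B y)))"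
  have "continuous_on S (\<lambda>y. U y k)" for k
  proof -
    have "continuous_on S (\<lambda>y. if j = k then l y (axis i 1) else B y (axis i 1) (axis j 1))" for i j
      by (cases "j = k") (auto intro: cont l)
    then show ?thesis
      unfolding U_def
      by (intro continuous_on_divide)
         (auto simp: det_form_matrix_nonzero B, auto simp: det_def form_matrix_def intro!: continuous_intros cont)
  qed
  then have "continuous_on S (\<lambda>y. \<Sum>k\<in>UNIV. U y k * l' y (axis k 1))"
    by (intro continuous_intros l')
  moreover have "l' y (u y) = (\<Sum>k\<in>UNIV. U y k * l' y (axis k 1))" if y: "y \<in> S" for y
  proof -
    have "form_matrix (B y) *v u y = (\<chi> i. l y (axis i 1))"
    proof -
      have "(form_matrix (B y) *v u y) $ i = l y (axis i 1)" for i
      proof -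
        have "(form_matrix (B y) *v u y) $ i = axis i 1 \<bullet> (form_matrix (B y) *v u y)"
          by (simp add: inner_axis')
        also have "\<dots> = B y (axis i 1) (u y)"
          using B[OF y] by (intro bilinear_form_matrix[symmetric]) (simp add: pos_def_form_def)
        also have "\<dots> = l y (axis i 1)"
          using B[OF y] u[OF y] unfolding pos_def_form_def by metis
        finally show ?thesis .
      qed
      then show ?thesis by (simp add: vec_eq_iff)
    qed
    then have "u y = (\<chi> k. U y k)"
      unfolding cramer[OF det_form_matrix_nonzero[OF B[OF y]]] U_def
      by (simp add: form_matrix_def cong: if_cong)
    then show ?thesis
      by (subst linear_axis_expansion[OF l'(1)[OF y]]) simp
  qed
  ultimately show ?thesis by (simp cong: continuous_on_cong_simp)
qed

text \<open>A change of basis sends the k-th unit vector to \<open>x\<close>, where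
  \<open>x $ k \<noteq> 0\<close>: with \<open>S\<close> the identity whose column k is replaced by
  \<open>x\<close>, the matrix \<open>P\<close> is similar to \<open>R\<close>, which differs from
  the identity only in row k. The determinant of \<open>R\<close> is its diagonal entry there,
  \<open>1 - z $ k\<close>, and \<open>z $ k = x \<bullet> y\<close>.\<close>

lemma det_identity_minus_rank_one:
  fixes x y :: "real ^ 'm"
  shows "det (\<chi> i j. (if i = j then 1 else 0) - x $ i * y $ j) = 1 - x \<bullet> y"
proof (cases "x = 0")
  case True
  then show ?thesis using det_I by (simp add: mat_def)
next
  case False
  then obtain k where k: "x $ k \<noteq> 0" by (auto simp: vec_eq_iff)
  define S :: "real ^ 'm ^ 'm" where "S = (\<chi> i j. if j = k then x $ i else if i = j then 1 else 0)"
  have replace: "det (\<chi> i j. if j = k then z $ i else if i = j then 1 else 0) = z $ k" for z :: "real ^ 'm"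
    using cramer_lemma[of k "mat 1" z] unfolding matrix_vector_mul_lid det_I by (simp add: mat_def cong: if_cong)
  have detS: "det S = x $ k" unfolding S_def by (rule replace)
  define z where "z = transpose S *v y"
  have zk: "z $ k = x \<bullet> y"
    by (simp add: z_def S_def transpose_def matrix_vector_mult_def inner_vec_def)
  define P :: "real ^ 'm ^ 'm" where "P = (\<chi> i j. (if i = j then 1 else 0) - x $ i * y $ j)"
  define R :: "real ^ 'm ^ 'm" where "R = (\<chi> i j. (if i = j then 1 else 0) - (if i = k then z $ j else 0))"
  have detR: "det R = 1 - z $ k"
  proof -
    \<comment> \<open>Transposing turns the exceptional row into an exceptional column, the shape
      that \<open>replace\<close> evaluates.\<close>
    have "transpose R = (\<chi> i j. if j = k then ((\<chi> l. (if l = k then 1 else 0) - z $ l) :: real ^ 'm) $ i else if i = j then 1 else 0)"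
      by (auto simp: R_def transpose_def vec_eq_iff)
    then have "det (transpose R) = 1 - z $ k" by (simp only: replace) simp
    then show ?thesis by (simp add: det_transpose)
  qed
  have "P ** S = S ** R"
  proof -
    have "(P ** S) $ i $ j = S $ i $ j - x $ i * z $ j" for i j
    proof -
      have "(P ** S) $ i $ j = (\<Sum>l\<in>UNIV. (if i = l then 1 else 0) * S $ l $ j) - (\<Sum>l\<in>UNIV. x $ i * (y $ l * S $ l $ j))"
        by (simp add: P_def matrix_matrix_mult_def left_diff_distrib sum_subtractf mult.assoc)
      also have "(\<Sum>l\<in>UNIV. (if i = l then 1 else 0) * S $ l $ j) = S $ i $ j"
        by (simp add: if_distrib[of "\<lambda>a. a * _"] cong: if_cong)
      finally show ?thesis
        by (simp add: z_def transpose_def matrix_vector_mult_def sum_distrib_left mult_ac)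
    qed
    moreover have "(S ** R) $ i $ j = S $ i $ j - x $ i * z $ j" for i j
    proof -
      have "(S ** R) $ i $ j = (\<Sum>l\<in>UNIV. S $ i $ l * (if l = j then 1 else 0)) - (\<Sum>l\<in>UNIV. S $ i $ l * (if l = k then z $ j else 0))"
        by (simp add: R_def matrix_matrix_mult_def right_diff_distrib sum_subtractf)
      also have "\<dots> = S $ i $ j - S $ i $ k * z $ j"
        by (simp add: if_distrib cong: if_cong)
      finally show ?thesis by (simp add: S_def)
    qed
    ultimately show ?thesis by (simp add: vec_eq_iff)
  qed
  then have "det P * det S = det S * det R" by (metis det_mul)
  then show ?thesis using k detS detR zk by (simp add: P_def)
qed

text \<open>The covector \<open>B v\<close> has coordinates \<open>G *v v\<close> with
  \<open>G\<close> the Gram matrix, so the subtracted tensor has \<open>G\<close> as a left factor.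
  Pulling \<open>G\<close> out leaves the determinant of the identity minus a rank-one
  matrix.\<close>

lemma det_form_matrix_rank_one_update:
  fixes B :: "real ^ 'm \<Rightarrow> real ^ 'm \<Rightarrow> real"
  assumes "bilinear B" and sym: "\<And>x y. B x y = B y x"
  shows "det (form_matrix (\<lambda>x y. c * (B x y - k * (B v x * B v y)))) =
    c ^ CARD('m) * ((1 - k * B v v) * det (form_matrix B))"
proof -
  let ?G = "form_matrix B"
  let ?r = "?G *v v"
  let ?E = "(\<chi> i j. (if i = j then 1 else 0) - v $ i * (k *\<^sub>R ?r) $ j) :: real ^ 'm ^ 'm"
  have r: "?r $ i = B v (axis i 1)" for i
  proof -
    have "?r $ i = axis i 1 \<bullet> ?r" by (simp add: inner_axis')
    then show ?thesis using bilinear_form_matrix[OF assms(1)] sym by metis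
  qed
  have "form_matrix (\<lambda>x y. c * (B x y - k * (B v x * B v y))) = (\<chi> i. c *s (?G ** ?E) $ i)"
  proof -
    have "(?G ** ?E) $ i $ j = ?G $ i $ j - ?r $ i * (k * ?r $ j)" for i j
    proof -
      have "(?G ** ?E) $ i $ j = (\<Sum>l\<in>UNIV. ?G $ i $ l * (if l = j then 1 else 0)) - (\<Sum>l\<in>UNIV. ?G $ i $ l * v $ l * (k * ?r $ j))"
        by (simp add: matrix_matrix_mult_def right_diff_distrib sum_subtractf mult.assoc)
      also have "\<dots> = ?G $ i $ j - ?r $ i * (k * ?r $ j)"
        by (simp add: if_distrib sum_distrib_right[symmetric] matrix_vector_mult_def[of ?G v] cong: if_cong)
      finally show ?thesis .
    qed
    then show ?thesis by (simp add: vec_eq_iff form_matrix_def r[unfolded form_matrix_def] mult_ac)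
  qed
  then have "det (form_matrix (\<lambda>x y. c * (B x y - k * (B v x * B v y)))) = c ^ CARD('m) * (det ?G * det ?E)"
    by (simp add: det_rows_mul det_mul)
  moreover have "det ?E = 1 - k * B v v"
    using bilinear_form_matrix[OF assms(1), of v v] by (subst det_identity_minus_rank_one) simp
  ultimately show ?thesis by (simp add: mult.commute)
qed

text \<open>Change of basis on both sides. \<open>volume_density\<close> accepts arbitrary tangent
  vectors, and this reduces them to the coordinate frame; linearly dependent vectors are covered,
  with both sides 0.\<close>

lemma det_gram:
  fixes B :: "real ^ 'm \<Rightarrow> real ^ 'm \<Rightarrow> real" and X :: "'m \<Rightarrow> real ^ 'm"
  assumes "bilinear B"
  shows "det (\<chi> i j. B (X i) (X j)) = (det (\<chi> i. X i))\<^sup>2 * det (form_matrix B)"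
proof -
  let ?X = "(\<chi> i. X i) :: real ^ 'm ^ 'm"
  have "(\<chi> i j. B (X i) (X j)) = ?X ** (form_matrix B ** transpose ?X)"
    by (simp add: vec_eq_iff bilinear_form_matrix[OF assms] matrix_matrix_mult_def transpose_def
        inner_vec_def matrix_vector_mult_def matrix_mul_assoc[symmetric] sum_distrib_left mult.assoc)
  then show ?thesis by (simp add: det_mul det_transpose power2_eq_square)
qed

section \<open>Tangent spaces and embeddings\<close>

lemma C1_fun_C2: "C2_fun A f \<Longrightarrow> C1_fun A f"
  unfolding C1_fun_def C2_fun_def by (auto intro: C2_on_imp_C1_on)

lemma C2_fun_const: "C2_fun A (\<lambda>_. k)"
  unfolding C2_fun_def by (auto simp: comp_def intro: C2_on_const)

lemma C2_fun_add: "C2_fun A f \<Longrightarrow> C2_fun A f' \<Longrightarrow> C2_fun A (\<lambda>b. f b + f' b)"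
  unfolding C2_fun_def by (auto simp: comp_def intro: C2_on_add)

lemma C2_fun_mult:
  fixes f f' :: "'a \<Rightarrow> real"
  shows "C2_fun A f \<Longrightarrow> C2_fun A f' \<Longrightarrow> C2_fun A (\<lambda>b. f b * f' b)"
  unfolding C2_fun_def by (auto simp: comp_def intro: C2_on_mult)

lemma C2_fun_linear_compose: "bounded_linear L \<Longrightarrow> C2_fun A f \<Longrightarrow> C2_fun A (\<lambda>b. L (f b))"
  unfolding C2_fun_def by (auto simp: comp_def intro: C2_on_linear_compose)

text \<open>Induction over the construction of a polynomial from bounded linear functions,
  constants, sums and products. These are the test functions that Stone-Weierstrass will
  supply.\<close>

lemma C2_fun_real_polynomial:
  assumes "real_polynomial_function q" "C2_fun A F"
  shows "C2_fun A (\<lambda>b. q (F b))"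
  using assms(1)
  by induction (auto intro: C2_fun_const C2_fun_add C2_fun_mult C2_fun_linear_compose assms(2))

locale manifold_with_atlas =
  fixes M :: "'a::t2_space set" and A :: "('a, 'm::finite) chart set"
  assumes compact_M: "compact M" and manifold: "C2_manifold M A"
begin

lemma chart_subset: "c \<in> A \<Longrightarrow> fst c \<subseteq> M"
  using manifold unfolding C2_manifold_def by blast

lemma chart_cover: assumes "a \<in> M" obtains c where "c \<in> A" "a \<in> fst c"
  using manifold assms unfolding C2_manifold_def by blast

lemma openin_chart: "c \<in> A \<Longrightarrow> openin (top_of_set M) (fst c)"
  using manifold unfolding C2_manifold_def by blast

lemma open_chart_image: "c \<in> A \<Longrightarrow> open (chart_image c)"
  using manifold unfolding C2_manifold_def by blast

lemma chart_homeomorphism: "c \<in> A \<Longrightarrow> homeomorphism (fst c) (chart_image c) (snd c) (chart_inv c)"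
  using manifold unfolding C2_manifold_def by blast

lemma continuous_on_chart: "c \<in> A \<Longrightarrow> continuous_on (fst c) (snd c)"
  using chart_homeomorphism by (auto simp: homeomorphism_def)

lemma continuous_on_chart_inv: "c \<in> A \<Longrightarrow> continuous_on (chart_image c) (chart_inv c)"
  using chart_homeomorphism by (auto simp: homeomorphism_def)

lemma chart_inv_chart [simp]: "c \<in> A \<Longrightarrow> a \<in> fst c \<Longrightarrow> chart_inv c (snd c a) = a"
  using chart_homeomorphism by (auto simp: homeomorphism_def)

lemma chart_chart_inv [simp]: "y \<in> chart_image c \<Longrightarrow> snd c (chart_inv c y) = y"
  by (rule f_inv_into_f)

lemma chart_inv_in [simp]: "y \<in> chart_image c \<Longrightarrow> chart_inv c y \<in> fst c"
  by (rule inv_into_into)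

lemma chart_inv_in_M [simp]: "c \<in> A \<Longrightarrow> y \<in> chart_image c \<Longrightarrow> chart_inv c y \<in> M"
  using chart_subset by (blast intro: chart_inv_in)

lemma continuous_on_via_charts:
  assumes "\<And>c. c \<in> A \<Longrightarrow> continuous_on (chart_image c) (\<lambda>y. f (chart_inv c y))"
  shows "continuous_on M f"
  unfolding continuous_on_eq_continuous_within
proof
  fix a assume "a \<in> M"
  then obtain c where c: "c \<in> A" "a \<in> fst c" by (rule chart_cover)
  have "continuous_on (fst c) (\<lambda>b. f (chart_inv c (snd c b)))"
    by (rule continuous_on_compose2[OF assms[OF c(1)] continuous_on_chart[OF c(1)]]) auto
  then have "continuous_on (fst c) f"
    by (rule continuous_on_eq) (use c in auto)
  then have "continuous (at a within fst c) f"
    using c by (simp add: continuous_on_eq_continuous_within)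
  moreover obtain T where "open T" "fst c = M \<inter> T"
    using openin_chart[OF c(1)] by (auto simp: openin_open)
  ultimately show "continuous (at a within M) f"
    using c(2) at_within_nhd[of a T M "fst c"] by auto
qed

lemma continuous_on_comp_chart_inv:
  "c \<in> A \<Longrightarrow> continuous_on M f \<Longrightarrow> continuous_on (chart_image c) (\<lambda>y. f (chart_inv c y))"
  by (rule continuous_on_compose2[of M f, OF _ continuous_on_chart_inv]) (use chart_subset in fastforce)+

lemma C1_fun_continuous: "C1_fun A f \<Longrightarrow> continuous_on M f"
  unfolding C1_fun_def comp_def by (blast intro: continuous_on_via_charts C1_on_imp_continuous_on)

lemma C1_fun_has_derivative:
  assumes "C1_fun A f" "c \<in> A" "a \<in> fst c"
  shows "((f \<circ> chart_inv c) has_derivative frechet_derivative (f \<circ> chart_inv c) (at (snd c a))) (at (snd c a))"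
  using assms unfolding C1_fun_def by (intro frechet_derivative_works[THEN iffD1]) (auto intro: C1_on_imp_differentiable)

lemma coord_tvec_linear:
  assumes "c \<in> A" "a \<in> fst c"
  shows "linear (\<lambda>x. coord_tvec A c a x f)"
proof (cases "C1_fun A f")
  case True
  then show ?thesis
    using has_derivative_linear[OF C1_fun_has_derivative[OF True assms]] by (simp add: coord_tvec_def)
qed (simp add: coord_tvec_def linear_iff)

lemma open_chart_overlap:
  assumes "c \<in> A" "d \<in> A" shows "open (snd c ` (fst c \<inter> fst d))"
proof -
  have "openin (top_of_set (fst c)) (fst c \<inter> fst d)"
    using openin_chart[OF assms(1)] openin_chart[OF assms(2)] chart_subset[OF assms(1)]
    by (metis openin_Int openin_subset_trans inf_le1)
  then have "openin (top_of_set (chart_image c)) (snd c ` (fst c \<inter> fst d))"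
    by (rule homeomorphism_imp_open_map[OF chart_homeomorphism[OF assms(1)]])
  then show ?thesis using open_chart_image[OF assms(1)] openin_open_trans by blast
qed

text \<open>The chain rule for the transition map; on functions that are not C1 both sides are 0 by
  convention. Consequently one chart around a point already yields its whole tangent space.\<close>

lemma coord_tvec_change:
  assumes c: "c \<in> A" "a \<in> fst c" and d: "d \<in> A" "a \<in> fst d"
  shows "coord_tvec A d a x = coord_tvec A c a (frechet_derivative (snd c \<circ> chart_inv d) (at (snd d a)) x)"
proof
  fix f
  show "coord_tvec A d a x f = coord_tvec A c a (frechet_derivative (snd c \<circ> chart_inv d) (at (snd d a)) x) f"
  proof (cases "C1_fun A f")
    case True
    let ?y = "snd d a" and ?U = "snd d ` (fst d \<inter> fst c)"
    have y: "?y \<in> ?U" using assms by auto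
    have "C2_on ?U (snd c \<circ> chart_inv d)"
      using manifold c d unfolding C2_manifold_def by blast
    then have t: "((snd c \<circ> chart_inv d) has_derivative frechet_derivative (snd c \<circ> chart_inv d) (at ?y)) (at ?y)"
      using y by (intro frechet_derivative_works[THEN iffD1] C1_on_imp_differentiable[OF C2_on_imp_C1_on])
    have "((f \<circ> chart_inv c) has_derivative frechet_derivative (f \<circ> chart_inv c) (at (snd c a))) (at ((snd c \<circ> chart_inv d) ?y))"
      using C1_fun_has_derivative[OF True c] d by simp
    from diff_chain_at[OF t this]
    have "((f \<circ> chart_inv c) \<circ> (snd c \<circ> chart_inv d) has_derivative
        frechet_derivative (f \<circ> chart_inv c) (at (snd c a)) \<circ> frechet_derivative (snd c \<circ> chart_inv d) (at ?y)) (at ?y)" .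
    then have "((f \<circ> chart_inv d) has_derivative
        frechet_derivative (f \<circ> chart_inv c) (at (snd c a)) \<circ> frechet_derivative (snd c \<circ> chart_inv d) (at ?y)) (at ?y)"
      by (rule has_derivative_transform_within_open[OF _ open_chart_overlap[OF d(1) c(1)] y])
         (use c d in auto)
    from frechet_derivative_at[OF this] show ?thesis
      using True by (simp add: coord_tvec_def comp_def fun_eq_iff)
  qed (simp add: coord_tvec_def)
qed

lemma tangent_space_eq:
  assumes "c \<in> A" "a \<in> fst c"
  shows "tangent_space A a = range (coord_tvec A c a)"
  using coord_tvec_change[OF assms] assms unfolding tangent_space_def by blast

lemma tangent_space_coord: "c \<in> A \<Longrightarrow> a \<in> fst c \<Longrightarrow> coord_tvec A c a x \<in> tangent_space A a"
  by (simp add: tangent_space_eq)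

lemma C1_form_differential:
  assumes "C2_fun A f" shows "C1_form A (differential f)"
  unfolding C1_form_def differential_def
proof (intro ballI conjI allI)
  fix c a assume "c \<in> A" "a \<in> fst c"
  then show "linear (\<lambda>x. coord_tvec A c a x f)" by (rule coord_tvec_linear)
next
  fix c x assume c: "c \<in> A"
  then have "C1_on (chart_image c) (\<lambda>y. frechet_derivative (f \<circ> chart_inv c) (at y) x)"
    using assms by (intro C1_on_frechet_derivative open_chart_image) (auto simp: C2_fun_def)
  then show "C1_on (chart_image c) (\<lambda>y. coord_tvec A c (chart_inv c y) x f)"
    by (rule C1_on_cong[OF open_chart_image[OF c], rotated])
       (use C1_fun_C2[OF assms] in \<open>simp add: coord_tvec_def\<close>)
qed

lemma tangent_vector_mult:
  assumes "C1_fun A f" "C1_fun A f'" "C1_fun A (\<lambda>b. f b * f' b)" "a \<in> M" "u \<in> tangent_space A a"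
  shows "u (\<lambda>b. f b * f' b) = f a * u f' + f' a * u f"
proof -
  obtain c where c: "c \<in> A" "a \<in> fst c" using assms(4) by (rule chart_cover)
  then obtain x where u: "u = coord_tvec A c a x" using assms(5) by (auto simp: tangent_space_eq)
  have "((\<lambda>y. (f \<circ> chart_inv c) y * (f' \<circ> chart_inv c) y) has_derivative
     (\<lambda>x. (f \<circ> chart_inv c) (snd c a) * frechet_derivative (f' \<circ> chart_inv c) (at (snd c a)) x +
          frechet_derivative (f \<circ> chart_inv c) (at (snd c a)) x * (f' \<circ> chart_inv c) (snd c a))) (at (snd c a))"
    by (intro has_derivative_mult C1_fun_has_derivative assms c)
  from frechet_derivative_at[OF this] show ?thesis
    using assms c unfolding u coord_tvec_def by (simp add: comp_def fun_eq_iff algebra_simps)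
qed

end

section \<open>Manifolds embedded by an observation map\<close>

locale embedded_manifold = manifold_with_atlas M A
  for M :: "'a::t2_space set" and A :: "('a, 'm::finite) chart set" +
  fixes F :: "'a \<Rightarrow> 'b::euclidean_space"
  assumes embedding: "C2_embedding M A F"
begin

lemma C2_F: "C2_fun A F" and inj_F: "inj_on F M"
  using embedding by (auto simp: C2_embedding_def)

lemma C1_F: "C1_fun A F"
  by (rule C1_fun_C2[OF C2_F])

lemma continuous_on_F: "continuous_on M F"
  by (rule C1_fun_continuous[OF C1_F])

lemma C2_F_component: "C2_fun A (\<lambda>b. F b \<bullet> e)"
  by (rule C2_fun_linear_compose[OF bounded_linear_inner_left C2_F])

lemma C1_F_component: "C1_fun A (\<lambda>b. F b \<bullet> e)"
  by (rule C1_fun_C2[OF C2_F_component])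

definition DF :: "('a, 'm) chart \<Rightarrow> real ^ 'm \<Rightarrow> real ^ 'm \<Rightarrow> 'b" where
  "DF c y = frechet_derivative (F \<circ> chart_inv c) (at y)"

lemma DF_derivative:
  "c \<in> A \<Longrightarrow> y \<in> chart_image c \<Longrightarrow> ((F \<circ> chart_inv c) has_derivative DF c y) (at y)"
  unfolding DF_def using C1_fun_has_derivative[OF C1_F, of c] by auto

lemma DF_linear: "c \<in> A \<Longrightarrow> y \<in> chart_image c \<Longrightarrow> linear (DF c y)"
  by (rule has_derivative_linear[OF DF_derivative])

lemma DF_inj: "c \<in> A \<Longrightarrow> y \<in> chart_image c \<Longrightarrow> inj (DF c y)"
  using embedding unfolding C2_embedding_def DF_def by auto

lemma DF_C1: "c \<in> A \<Longrightarrow> C1_on (chart_image c) (\<lambda>y. DF c y x)"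
  unfolding DF_def using C2_F open_chart_image
  by (intro C1_on_frechet_derivative) (auto simp: C2_fun_def)

lemma coord_tvec_F:
  assumes "c \<in> A" "a \<in> fst c"
  shows "coord_tvec A c a x (\<lambda>b. F b \<bullet> e) = DF c (snd c a) x \<bullet> e"
proof -
  have "((\<lambda>y. (F \<circ> chart_inv c) y \<bullet> e) has_derivative (\<lambda>x. DF c (snd c a) x \<bullet> e)) (at (snd c a))"
    using DF_derivative[OF assms(1), of "snd c a"] assms by (intro has_derivative_inner_left) (auto simp: comp_def)
  from frechet_derivative_at[OF this] show ?thesis
    by (simp add: coord_tvec_def C1_F_component comp_def fun_eq_iff)
qed

lemma pushforward_coord:
  assumes "c \<in> A" "a \<in> fst c"
  shows "pushforward F (coord_tvec A c a x) = DF c (snd c a) x"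
  unfolding pushforward_def by (simp add: coord_tvec_F[OF assms] euclidean_representation)

lemma pushforward_component:
  assumes "a \<in> M" "u \<in> tangent_space A a"
  shows "pushforward F u \<bullet> e = u (\<lambda>b. F b \<bullet> e)"
proof -
  obtain c where c: "c \<in> A" "a \<in> fst c" using assms(1) by (rule chart_cover)
  then obtain x where "u = coord_tvec A c a x" using assms(2) by (auto simp: tangent_space_eq)
  then show ?thesis using c by (simp add: pushforward_coord coord_tvec_F)
qed

lemma coord_tvec_zero:
  assumes "c \<in> A" "a \<in> fst c" shows "coord_tvec A c a 0 = (\<lambda>_. 0)"
  using linear_0[OF coord_tvec_linear[OF assms]] by auto

text \<open>Tangent vectors are functionals, so a nonzero one has to be detected by some C1
  function. The components of \<open>F\<close> do this, by the full rank of the embedding.\<close>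

lemma coord_tvec_nonzero:
  assumes "c \<in> A" "a \<in> fst c" "x \<noteq> 0" shows "coord_tvec A c a x \<noteq> (\<lambda>_. 0)"
proof
  assume "coord_tvec A c a x = (\<lambda>_. 0)"
  then have "DF c (snd c a) x = 0"
    using pushforward_coord[OF assms(1,2), of x] by (simp add: pushforward_def)
  then show False
    using assms DF_inj[of c "snd c a"] DF_linear[of c "snd c a"] by (auto simp: linear_injective_0)
qed

lemma pushforward_nonzero:
  assumes "a \<in> M" "u \<in> tangent_space A a" "u \<noteq> (\<lambda>_. 0)" shows "pushforward F u \<noteq> 0"
proof -
  obtain c where c: "c \<in> A" "a \<in> fst c" using assms(1) by (rule chart_cover)
  then obtain x where x: "u = coord_tvec A c a x" using assms(2) by (auto simp: tangent_space_eq)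
  with assms(3) coord_tvec_zero[OF c] have "x \<noteq> 0" by auto
  then show ?thesis using c DF_inj[of c "snd c a"] DF_linear[of c "snd c a"]
    unfolding x by (auto simp: pushforward_coord linear_injective_0)
qed

lemma riemannian_metric_ambient: "riemannian_metric A (ambient_metric F)"
  unfolding riemannian_metric_def
proof (intro ballI conjI allI impI)
  fix c a assume c: "c \<in> A" "a \<in> fst c"
  have l: "linear (DF c (snd c a))" using c by (intro DF_linear) auto
  show "bilinear (\<lambda>x y. ambient_metric F a (coord_tvec A c a x) (coord_tvec A c a y))"
    using c l by (auto simp: ambient_metric_def pushforward_coord bilinear_def linear_iff inner_simps)
next
  fix c x x' assume c: "c \<in> A"
  have "C1_on (chart_image c) (\<lambda>y. DF c y x \<bullet> DF c y x')"
    by (intro C1_on_inner DF_C1 c)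
  then show "C1_on (chart_image c) (\<lambda>y. ambient_metric F (chart_inv c y)
       (coord_tvec A c (chart_inv c y) x) (coord_tvec A c (chart_inv c y) x'))"
    by (rule C1_on_cong[OF open_chart_image[OF c], rotated])
       (use c in \<open>simp add: ambient_metric_def pushforward_coord\<close>)
next
  fix c a u u' assume "c \<in> A" "a \<in> fst c" 
  show "ambient_metric F a u u' = ambient_metric F a u' u"
    by (simp add: ambient_metric_def inner_commute)
next
  fix c a u assume "c \<in> A" "a \<in> fst c" "u \<in> tangent_space A a" "u \<noteq> (\<lambda>_. 0)"
  then have "pushforward F u \<noteq> 0" using pushforward_nonzero chart_subset by blast
  then show "0 < ambient_metric F a u u" by (simp add: ambient_metric_def)
qed

end

section \<open>Metrics and volume measures in charts\<close>

context embedded_manifold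
begin

definition coord_form :: "'a metric_tensor \<Rightarrow> ('a, 'm) chart \<Rightarrow> real ^ 'm \<Rightarrow> real ^ 'm \<Rightarrow> real ^ 'm \<Rightarrow> real" where
  "coord_form h c y x x' = h (chart_inv c y) (coord_tvec A c (chart_inv c y) x) (coord_tvec A c (chart_inv c y) x')"

definition coord_volume :: "'a metric_tensor \<Rightarrow> ('a, 'm) chart \<Rightarrow> real ^ 'm \<Rightarrow> real" where
  "coord_volume h c y = sqrt (det (form_matrix (coord_form h c y)))"

lemma pos_def_coord_form:
  assumes h: "riemannian_metric A h" and c: "c \<in> A" "y \<in> chart_image c"
  shows "pos_def_form (coord_form h c y)"
  unfolding pos_def_form_def coord_form_def
proof (intro conjI allI impI)
  let ?a = "chart_inv c y"
  have a: "?a \<in> fst c" using c by simp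
  show "bilinear (\<lambda>x x'. h ?a (coord_tvec A c ?a x) (coord_tvec A c ?a x'))"
    using h c(1) a unfolding riemannian_metric_def by blast
  show "h ?a (coord_tvec A c ?a x) (coord_tvec A c ?a x') = h ?a (coord_tvec A c ?a x') (coord_tvec A c ?a x)" for x x'
    using h c(1) a tangent_space_coord[OF c(1) a] unfolding riemannian_metric_def by blast
  show "h ?a (coord_tvec A c ?a x) (coord_tvec A c ?a x) > 0" if "x \<noteq> 0" for x
    using h c(1) a tangent_space_coord[OF c(1) a] coord_tvec_nonzero[OF c(1) a that]
    unfolding riemannian_metric_def by blast
qed

lemma continuous_on_coord_form:
  "riemannian_metric A h \<Longrightarrow> c \<in> A \<Longrightarrow> continuous_on (chart_image c) (\<lambda>y. coord_form h c y x x')"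
  unfolding riemannian_metric_def coord_form_def by (blast intro: C1_on_imp_continuous_on)

lemma coord_volume_pos:
  "riemannian_metric A h \<Longrightarrow> c \<in> A \<Longrightarrow> y \<in> chart_image c \<Longrightarrow> coord_volume h c y > 0"
  unfolding coord_volume_def using det_form_matrix_pos[OF pos_def_coord_form] by simp

lemma continuous_on_coord_volume:
  "riemannian_metric A h \<Longrightarrow> c \<in> A \<Longrightarrow> continuous_on (chart_image c) (coord_volume h c)"
  unfolding coord_volume_def det_def form_matrix_def
  by (auto intro!: continuous_intros continuous_on_coord_form)

lemma volume_density_coord:
  "volume_density h (chart_inv c y) (\<lambda>i::'m. coord_tvec A c (chart_inv c y) (axis i 1)) = coord_volume h c y"
  by (simp add: volume_density_def coord_volume_def form_matrix_def coord_form_def)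

text \<open>In a chart the metric is a positive definite form, so the definite description in
  \<open>sharp\<close> has exactly one solution. By symmetry the inverse metric at
  \<open>df\<close>, \<open>df'\<close> equals \<open>df'\<close> evaluated at the sharp of
  \<open>df\<close>, which is the expression covered by Cramer's rule.\<close>

lemma continuous_on_inverse_metric:
  assumes h: "riemannian_metric A h" and f: "C2_fun A f" "C2_fun A f'"
  shows "continuous_on M (\<lambda>a. inverse_metric A h a (differential f a) (differential f' a))" 
    and "\<And>a. a \<in> M \<Longrightarrow> \<exists>u\<in>tangent_space A a. sharp A h a (differential f a) = u \<and> (\<forall>u'\<in>tangent_space A a. h a u u' = u' f)"
proof -
  have sharp: "\<exists>x. sharp A h (chart_inv c y) (differential f (chart_inv c y)) = coord_tvec A c (chart_inv c y) x \<and>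
      (\<forall>x'. coord_form h c y x x' = coord_tvec A c (chart_inv c y) x' f)"
    if c: "c \<in> A" "y \<in> chart_image c" for c y and f :: "'a \<Rightarrow> real"
  proof -
    let ?a = "chart_inv c y"
    have a: "?a \<in> fst c" using c by simp
    have T: "tangent_space A ?a = range (coord_tvec A c ?a)" by (rule tangent_space_eq[OF c(1) a])
    obtain x where x: "\<forall>x'. coord_form h c y x x' = coord_tvec A c ?a x' f"
      and uniq: "\<And>z. \<forall>x'. coord_form h c y z x' = coord_tvec A c ?a x' f \<Longrightarrow> z = x"
      using pos_def_form_representation[OF pos_def_coord_form[OF h c] coord_tvec_linear[OF c(1) a], of f] by metis
    have "sharp A h ?a (differential f ?a) = coord_tvec A c ?a x"
      unfolding sharp_def differential_def T
    proof (rule the_equality)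
      show "coord_tvec A c ?a x \<in> range (coord_tvec A c ?a) \<and>
          (\<forall>u'\<in>range (coord_tvec A c ?a). h ?a (coord_tvec A c ?a x) u' = u' f)"
        using x unfolding coord_form_def by blast
      fix u assume u: "u \<in> range (coord_tvec A c ?a) \<and> (\<forall>u'\<in>range (coord_tvec A c ?a). h ?a u u' = u' f)"
      then obtain z where z: "u = coord_tvec A c ?a z" by blast
      then have "z = x" using u by (intro uniq) (simp add: coord_form_def)
      then show "u = coord_tvec A c ?a x" using z by simp
    qed
    with x show ?thesis by blast
  qed
  show "continuous_on M (\<lambda>a. inverse_metric A h a (differential f a) (differential f' a))"
  proof (rule continuous_on_via_charts)
    fix c assume c: "c \<in> A"
    let ?l = "\<lambda>f y x. coord_tvec A c (chart_inv c y) x f"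
    have lin: "linear (?l f y)" if "y \<in> chart_image c" for y and f :: "'a \<Rightarrow> real"
      using c that by (intro coord_tvec_linear) auto
    have cont: "continuous_on (chart_image c) (\<lambda>y. ?l f y x)" if "C2_fun A f" for f :: "'a \<Rightarrow> real" and x
      using C1_form_differential[OF that] c
      unfolding C1_form_def differential_def by (blast intro: C1_on_imp_continuous_on)
    obtain u where u: "\<And>y. y \<in> chart_image c \<Longrightarrow> sharp A h (chart_inv c y) (differential f (chart_inv c y)) = coord_tvec A c (chart_inv c y) (u y)"
      "\<And>y x'. y \<in> chart_image c \<Longrightarrow> coord_form h c y (u y) x' = ?l f y x'"
      using sharp[OF c, of _ f] by metis
    obtain u' where u': "\<And>y. y \<in> chart_image c \<Longrightarrow> sharp A h (chart_inv c y) (differential f' (chart_inv c y)) = coord_tvec A c (chart_inv c y) (u' y)"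
      "\<And>y x'. y \<in> chart_image c \<Longrightarrow> coord_form h c y (u' y) x' = ?l f' y x'"
      using sharp[OF c, of _ f'] by metis
    have "continuous_on (chart_image c) (\<lambda>y. ?l f' y (u y))"
      by (rule continuous_on_form_inverse[where B="coord_form h c" and l="?l f"])
         (use u h c f lin cont pos_def_coord_form continuous_on_coord_form in auto)
    moreover have "inverse_metric A h (chart_inv c y) (differential f (chart_inv c y)) (differential f' (chart_inv c y)) = ?l f' y (u y)"
      if y: "y \<in> chart_image c" for y
    proof -
      have "inverse_metric A h (chart_inv c y) (differential f (chart_inv c y)) (differential f' (chart_inv c y)) = coord_form h c y (u y) (u' y)"
        unfolding inverse_metric_def u(1)[OF y] u'(1)[OF y] coord_form_def ..
      also have "\<dots> = coord_form h c y (u' y) (u y)"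
        using pos_def_coord_form[OF h c y] by (simp add: pos_def_form_def)
      finally show ?thesis by (simp add: u'(2)[OF y])
    qed
    ultimately show "continuous_on (chart_image c) (\<lambda>y. inverse_metric A h (chart_inv c y) (differential f (chart_inv c y)) (differential f' (chart_inv c y)))"
      by (simp cong: continuous_on_cong_simp)
  qed
  fix a assume "a \<in> M"
  then obtain c where c: "c \<in> A" "a \<in> fst c" by (rule chart_cover)
  then have "\<exists>x. sharp A h a (differential f a) = coord_tvec A c a x \<and> (\<forall>x'. coord_form h c (snd c a) x x' = coord_tvec A c a x' f)"
    using sharp[of c "snd c a" f] by simp
  then show "\<exists>u\<in>tangent_space A a. sharp A h a (differential f a) = u \<and> (\<forall>u'\<in>tangent_space A a. h a u u' = u' f)"
    using c by (auto simp: tangent_space_eq coord_form_def)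
qed

end

section \<open>Measures determined by their restrictions to charts\<close>

context manifold_with_atlas
begin

lemma finite_chart_cover: obtains C where "finite C" "C \<subseteq> A" "M = (\<Union>c\<in>C. fst c)"
proof -
  have "\<forall>c\<in>A. \<exists>T. open T \<and> fst c = M \<inter> T"
    using openin_chart by (auto simp: openin_open)
  from bchoice[OF this] obtain T where T: "\<And>c. c \<in> A \<Longrightarrow> open (T c) \<and> fst c = M \<inter> T c" by blast
  have "M \<subseteq> (\<Union>c\<in>A. T c)"
  proof
    fix a assume "a \<in> M"
    then obtain c where "c \<in> A" "a \<in> fst c" by (rule chart_cover)
    then show "a \<in> (\<Union>c\<in>A. T c)" using T[of c] by auto
  qed
  moreover have "\<And>c. c \<in> A \<Longrightarrow> open (T c)" using T by blast
  ultimately obtain C where C: "C \<subseteq> A" "finite C" "M \<subseteq> (\<Union>c\<in>C. T c)"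
    using compactE_image[OF compact_M, of A T] by metis
  have "fst c = M \<inter> T c" if "c \<in> C" for c using T C that by blast
  then have "M = (\<Union>c\<in>C. fst c)" using C(3) by auto
  with C show ?thesis by (intro that[of C])
qed

lemma openin_sets_borel: "openin (top_of_set M) U \<Longrightarrow> U \<in> sets (restrict_space borel M)"
  unfolding openin_open sets_restrict_space by auto

text \<open>Charts overlap, so a set is cut into its part inside one chart of a finite cover and the
  remainder, which the other charts cover. Only additivity is used, so neither measure has to be
  finite.\<close>

lemma measure_eqI_charts:
  assumes sets: "sets N = sets (restrict_space borel M)" "sets N' = sets (restrict_space borel M)"
    and eq: "\<And>c B. c \<in> A \<Longrightarrow> B \<in> sets N \<Longrightarrow> B \<subseteq> fst c \<Longrightarrow> emeasure N B = emeasure N' B"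
  shows "N = N'"
proof (rule measure_eqI)
  show "sets N = sets N'" using sets by simp
  fix B assume B: "B \<in> sets N"
  obtain C where C: "finite C" "C \<subseteq> A" "M = (\<Union>c\<in>C. fst c)" by (rule finite_chart_cover)
  have chart: "fst c \<in> sets N" if "c \<in> A" for c
    unfolding sets(1) by (rule openin_sets_borel[OF openin_chart[OF that]])
  have "emeasure N B = emeasure N' B" if "B \<in> sets N" "B \<subseteq> (\<Union>c\<in>C. fst c)" for B
    using C(1,2) that
  proof (induction C arbitrary: B)
    case (insert c C)
    have 1: "B \<inter> fst c \<in> sets N" "B - fst c \<in> sets N" using insert.prems chart by auto
    have "emeasure N (B \<inter> fst c) = emeasure N' (B \<inter> fst c)"
      using insert.prems 1 by (intro eq[of c]) auto
    moreover have "emeasure N (B - fst c) = emeasure N' (B - fst c)"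
      using insert.prems 1 by (intro insert.IH) auto
    moreover have "emeasure L B = emeasure L (B \<inter> fst c) + emeasure L (B - fst c)" if "sets L = sets N" for L
      using 1 that plus_emeasure[of "B \<inter> fst c" L "B - fst c"] by (simp add: Int_Diff_Un Int_Diff_disjoint)
    ultimately show ?case using sets by simp
  qed auto
  moreover have "B \<subseteq> M"
    using sets.sets_into_space[OF B] sets_eq_imp_space_eq[OF sets(1)] by (simp add: space_restrict_space)
  ultimately show "emeasure N B = emeasure N' B" using B C(3) by simp
qed

end

section \<open>Integration against a volume measure\<close>

locale manifold_with_volume = embedded_manifold M A F
  for M :: "'a::t2_space set" and A :: "('a, 'm::finite) chart set" and F :: "'a \<Rightarrow> 'b::euclidean_space" +
  fixes h :: "'a metric_tensor" and N :: "'a measure"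
  assumes metric: "riemannian_metric A h" and volume: "volume_measure M A h N"
begin

lemma sets_N: "sets N = sets (restrict_space borel M)"
  using volume by (simp add: volume_measure_def)

lemma space_N: "space N = M"
  using sets_eq_imp_space_eq[OF sets_N] by (simp add: space_restrict_space)

lemma sets_chart: "c \<in> A \<Longrightarrow> fst c \<in> sets N"
  unfolding sets_N by (rule openin_sets_borel[OF openin_chart])

lemma sets_openin: "openin (top_of_set M) U \<Longrightarrow> U \<in> sets N"
  unfolding sets_N by (rule openin_sets_borel)

lemma measurable_continuous: "continuous_on M f \<Longrightarrow> f \<in> borel_measurable N"
  using borel_measurable_continuous_on_restrict measurable_cong_sets[OF sets_N refl] by blast

lemma sets_chart_image [measurable]: "c \<in> A \<Longrightarrow> chart_image c \<in> sets borel"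
  by (simp add: open_chart_image)

lemma measurable_chart_inv: "c \<in> A \<Longrightarrow> chart_inv c \<in> measurable (restrict_space lborel (chart_image c)) N"
proof -
  assume c: "c \<in> A"
  have "chart_inv c \<in> measurable (restrict_space borel (chart_image c)) (restrict_space borel M)"
    using continuous_on_chart_inv[OF c] c chart_inv_in_M[OF c]
    by (intro measurable_restrict_space2 borel_measurable_continuous_on_restrict)
       (auto simp: space_restrict_space simp del: chart_inv_chart)
  then show ?thesis
    by (subst measurable_cong_sets[OF _ sets_N]) (auto simp: sets_restrict_space)
qed

lemma measurable_coord_volume: "c \<in> A \<Longrightarrow> coord_volume h c \<in> borel_measurable (restrict_space lborel (chart_image c))"
  using borel_measurable_continuous_on_restrict[OF continuous_on_coord_volume[OF metric]]
    measurable_cong_sets[OF sets_restrict_space_cong[OF sets_lborel] refl] by blast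

text \<open>\<open>volume_measure\<close> prescribes values on sets. Read as an equality of
  measures, namely that \<open>N\<close> on a chart domain is the image of a weighted Lebesgue
  measure, it gives access to the transformation rules for integrals.\<close>

lemma density_chart:
  assumes c: "c \<in> A"
  shows "density N (indicator (fst c)) =
    distr (density (restrict_space lborel (chart_image c)) (\<lambda>y. ennreal (coord_volume h c y))) N (chart_inv c)"
    (is "_ = distr (density ?R _) N _")
proof (rule measure_eqI)
  note [measurable] = measurable_chart_inv[OF c] measurable_coord_volume[OF c]
  have sp: "space ?R = chart_image c" by (simp add: space_restrict_space)
  fix B assume "B \<in> sets (density N (indicator (fst c)))"
  then have B[measurable]: "B \<in> sets N" by simp
  \<comment> \<open>The image under the chart is a preimage under its inverse, which is how the
    emeasure of a \<open>distr\<close> is expressed.\<close>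
  have image: "snd c ` (B \<inter> fst c) = chart_inv c -` B \<inter> chart_image c"
  proof (intro subset_antisym subsetI)
    fix y assume y: "y \<in> chart_inv c -` B \<inter> chart_image c"
    then have "y = snd c (chart_inv c y)" "chart_inv c y \<in> B \<inter> fst c" by auto
    then show "y \<in> snd c ` (B \<inter> fst c)" by (rule image_eqI)
  qed (use c in auto)
  have "emeasure (density N (indicator (fst c))) B = emeasure N (B \<inter> fst c)"
    using sets_chart[OF c] B by (subst emeasure_density) (auto simp: nn_integral_indicator[symmetric] indicator_inter_arith mult.commute)
  also have "\<dots> = (\<integral>\<^sup>+y. ennreal (coord_volume h c y) * indicator (snd c ` (B \<inter> fst c)) y \<partial>lborel)"
    using volume c B sets_chart[OF c] unfolding volume_measure_def by (simp add: volume_density_coord)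
  also have "\<dots> = (\<integral>\<^sup>+y. (ennreal (coord_volume h c y) * indicator (chart_inv c -` B \<inter> space ?R) y) * indicator (chart_image c) y \<partial>lborel)"
    unfolding image sp by (intro nn_integral_cong) (auto split: split_indicator)
  also have "\<dots> = (\<integral>\<^sup>+y. ennreal (coord_volume h c y) * indicator (chart_inv c -` B \<inter> space ?R) y \<partial>?R)"
    using c by (subst nn_integral_restrict_space) auto
  also have "\<dots> = emeasure (density ?R (\<lambda>y. ennreal (coord_volume h c y))) (chart_inv c -` B \<inter> space ?R)"
    by (subst emeasure_density) auto
  also have "\<dots> = emeasure (distr (density ?R (\<lambda>y. ennreal (coord_volume h c y))) N (chart_inv c)) B"
    by (subst emeasure_distr) auto
  finally show "emeasure (density N (indicator (fst c))) B = \<dots>" .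
qed simp

lemma nn_integral_chart:
  assumes c: "c \<in> A" and f[measurable]: "f \<in> borel_measurable N"
  shows "(\<integral>\<^sup>+b. indicator (fst c) b * f b \<partial>N) =
    (\<integral>\<^sup>+y. ennreal (coord_volume h c y) * f (chart_inv c y) * indicator (chart_image c) y \<partial>lborel)"
proof -
  note [measurable] = measurable_chart_inv[OF c] measurable_coord_volume[OF c] sets_chart[OF c]
  have "(\<integral>\<^sup>+b. indicator (fst c) b * f b \<partial>N) = (\<integral>\<^sup>+b. f b \<partial>density N (indicator (fst c)))"
    by (subst nn_integral_density) auto
  then show ?thesis unfolding density_chart[OF c] using c
    by (simp add: nn_integral_distr nn_integral_density nn_integral_restrict_space)
qed

lemma integral_chart:
  fixes f :: "'a \<Rightarrow> real"
  assumes c: "c \<in> A" and f[measurable]: "f \<in> borel_measurable N"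
  shows "(\<integral>b. indicator (fst c) b * f b \<partial>N) =
    (\<integral>y. indicator (chart_image c) y * (coord_volume h c y * f (chart_inv c y)) \<partial>lborel)"
proof -
  note [measurable] = measurable_chart_inv[OF c] measurable_coord_volume[OF c] sets_chart[OF c]
  have "(\<integral>b. indicator (fst c) b * f b \<partial>N) = (\<integral>b. f b \<partial>density N (\<lambda>b. ennreal (indicator (fst c) b)))"
    by (subst integral_density) auto
  also have "density N (\<lambda>b. ennreal (indicator (fst c) b)) = density N (indicator (fst c))"
    by (simp add: ennreal_indicator)
  also have "(\<integral>b. f b \<partial>density N (indicator (fst c))) =
      (\<integral>y. f (chart_inv c y) \<partial>density (restrict_space lborel (chart_image c)) (\<lambda>y. ennreal (coord_volume h c y)))"
    unfolding density_chart[OF c] by (rule integral_distr) auto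
  also have "\<dots> = (\<integral>y. coord_volume h c y *\<^sub>R f (chart_inv c y) \<partial>restrict_space lborel (chart_image c))"
  proof (rule integral_density)
    show "AE y in restrict_space lborel (chart_image c). 0 \<le> coord_volume h c y"
      using coord_volume_pos[OF metric c] by (intro AE_I2) (simp add: space_restrict_space less_imp_le)
  qed auto
  also have "\<dots> = (\<integral>y. indicator (chart_image c) y *\<^sub>R (coord_volume h c y *\<^sub>R f (chart_inv c y)) \<partial>lborel)"
    by (rule integral_restrict_space) (simp add: open_chart_image[OF c])
  finally show ?thesis unfolding real_scaleR_def .
qed

text \<open>The coordinate volume is bounded on a closed ball inside a chart image, so every point
  has a neighbourhood of finite measure, and compactness reduces \<open>M\<close> to finitely many
  of these.\<close>

lemma emeasure_finite: "emeasure N M < \<infinity>"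
proof -
  have "\<exists>T. open T \<and> a \<in> T \<and> emeasure N (M \<inter> T) < \<infinity>" if "a \<in> M" for a
  proof -
    obtain c where c: "c \<in> A" "a \<in> fst c" using \<open>a \<in> M\<close> by (rule chart_cover)
    then have "snd c a \<in> chart_image c" by simp
    then obtain r where r: "r > 0" "cball (snd c a) r \<subseteq> chart_image c"
      using open_chart_image[OF c(1)] open_contains_cball by blast
    have "openin (top_of_set (fst c)) (fst c \<inter> snd c -` ball (snd c a) r)"
      by (rule continuous_openin_preimage_gen[OF continuous_on_chart[OF c(1)] open_ball])
    then have "openin (top_of_set M) (fst c \<inter> snd c -` ball (snd c a) r)"
      using openin_chart[OF c(1)] openin_trans by blast
    then obtain T where T: "open T" "fst c \<inter> snd c -` ball (snd c a) r = M \<inter> T" by (auto simp: openin_open)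
    have "compact (coord_volume h c ` cball (snd c a) r)"
      by (intro compact_continuous_image continuous_on_subset[OF continuous_on_coord_volume[OF metric c(1)]] r) auto
    then obtain K where K: "\<And>y. y \<in> cball (snd c a) r \<Longrightarrow> coord_volume h c y \<le> K"
      using compact_imp_bounded bounded_imp_bdd_above by (metis bdd_above.E imageI)
    have "emeasure N (M \<inter> T) = (\<integral>\<^sup>+y. ennreal (coord_volume h c y) * indicator (snd c ` (M \<inter> T)) y \<partial>lborel)"
    proof -
      have "M \<inter> T \<in> sets N" "M \<inter> T \<subseteq> fst c"
        using T by (auto intro!: sets_openin)
      then show ?thesis using volume c unfolding volume_measure_def by (simp add: volume_density_coord)
    qed
    also have "\<dots> \<le> (\<integral>\<^sup>+y. ennreal K * indicator (cball (snd c a) r) y \<partial>lborel)"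
      unfolding T(2)[symmetric]
      using K by (intro nn_integral_mono) (auto split: split_indicator simp: ennreal_leI less_imp_le)
    also have "\<dots> = ennreal K * emeasure lborel (cball (snd c a) r)"
      by (rule nn_integral_cmult_indicator) simp
    also have "\<dots> < \<infinity>"
      using emeasure_lborel_cball_finite[of "snd c a" r] by (auto simp: ennreal_mult_less_top)
    finally show ?thesis using T c r(1) \<open>a \<in> M\<close> by (intro exI[of _ T]) auto
  qed
  then obtain T where T: "\<And>a. a \<in> M \<Longrightarrow> open (T a) \<and> a \<in> T a \<and> emeasure N (M \<inter> T a) < \<infinity>" by metis
  have "M \<subseteq> (\<Union>a\<in>M. T a)" using T by blast
  then obtain C where C: "C \<subseteq> M" "finite C" "M \<subseteq> (\<Union>a\<in>C. T a)"
    using compactE_image[OF compact_M, of M T] T by blast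
  have "emeasure N M \<le> emeasure N (\<Union>a\<in>C. M \<inter> T a)"
    using C T by (intro emeasure_mono sets.finite_UN) (auto intro!: sets_openin simp: openin_open)
  also have "\<dots> \<le> (\<Sum>a\<in>C. emeasure N (M \<inter> T a))"
    using C T by (intro emeasure_subadditive_finite) (auto intro!: sets_openin simp: openin_open)
  also have "\<dots> < \<infinity>" using C T by (auto simp: less_top[symmetric])
  finally show ?thesis .
qed

lemma finite_measure_N: "finite_measure N"
  by (rule finite_measureI) (use emeasure_finite space_N in auto)

lemma integrable_continuous:
  fixes f :: "'a \<Rightarrow> real"
  assumes "continuous_on M f" shows "integrable N f"
proof -
  interpret finite_measure N by (rule finite_measure_N)
  have "compact (f ` M)" by (rule compact_continuous_image[OF assms compact_M])
  then obtain K where "\<And>a. a \<in> M \<Longrightarrow> norm (f a) \<le> K"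
    using compact_imp_bounded bounded_iff by (metis imageI)
  then show ?thesis
    by (intro integrable_const_bound[where B=K] measurable_continuous assms AE_I2) (auto simp: space_N)
qed

text \<open>Charts map open sets to open sets, nonempty open sets are not Lebesgue negligible, and
  the coordinate volume is positive. Full support is what turns integral identities between
  continuous functions into pointwise ones.\<close>

lemma emeasure_open_pos:
  assumes U: "openin (top_of_set M) U" "U \<noteq> {}" shows "emeasure N U \<noteq> 0"
proof
  assume 0: "emeasure N U = 0"
  obtain a where a: "a \<in> U" using U by blast
  then have "a \<in> M" using U openin_imp_subset by blast
  then obtain c where c: "c \<in> A" "a \<in> fst c" by (rule chart_cover)
  let ?V = "U \<inter> fst c"
  have V: "openin (top_of_set M) ?V" using U openin_chart[OF c(1)] by blast
  have "openin (top_of_set (fst c)) ?V"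
    by (rule openin_subset_trans[OF V]) (use chart_subset[OF c(1)] in auto)
  then have "openin (top_of_set (chart_image c)) (snd c ` ?V)"
    by (rule homeomorphism_imp_open_map[OF chart_homeomorphism[OF c(1)]])
  then have o: "open (snd c ` ?V)" using open_chart_image[OF c(1)] openin_open_trans by blast
  have "emeasure N ?V = 0"
    using emeasure_mono[of ?V U N] sets_openin[OF U(1)] 0 by auto
  then have "(\<integral>\<^sup>+y. ennreal (coord_volume h c y) * indicator (snd c ` ?V) y \<partial>lborel) = 0"
    using volume c sets_openin[OF V] unfolding volume_measure_def by (simp add: volume_density_coord)
  moreover have "(\<lambda>y. ennreal (coord_volume h c y) * indicator (snd c ` ?V) y) \<in> borel_measurable lborel"
  proof -
    have "(\<lambda>y. indicator (snd c ` ?V) y *\<^sub>R coord_volume h c y) \<in> borel_measurable borel"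
      using continuous_on_subset[OF continuous_on_coord_volume[OF metric c(1)], of "snd c ` ?V"] o
      by (intro borel_measurable_continuous_on_indicator) auto
    then have "(\<lambda>y. ennreal (indicator (snd c ` ?V) y *\<^sub>R coord_volume h c y)) \<in> borel_measurable borel"
      by measurable
    moreover have "ennreal (indicator (snd c ` ?V) y *\<^sub>R coord_volume h c y) = ennreal (coord_volume h c y) * indicator (snd c ` ?V) y" for y
      by (simp split: split_indicator)
    ultimately show ?thesis by simp
  qed
  ultimately have "AE y in lborel. ennreal (coord_volume h c y) * indicator (snd c ` ?V) y = 0"
    by (simp add: nn_integral_0_iff_AE)
  then have "AE y in lborel. y \<notin> snd c ` ?V"
  proof eventually_elim
    case (elim y)
    show ?case
    proof
      assume y: "y \<in> snd c ` ?V"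
      then have "coord_volume h c y > 0" using coord_volume_pos[OF metric c(1), of y] by blast
      then show False using elim y by simp
    qed
  qed
  then have "emeasure lborel (snd c ` ?V) = 0"
    using o AE_iff_measurable[of "snd c ` ?V" lborel "\<lambda>y. y \<notin> snd c ` ?V"] by simp
  moreover have "snd c a \<in> snd c ` ?V" using a c by auto
  then have "snd c ` ?V \<noteq> {}" by fast
  moreover have "snd c ` ?V \<in> null_sets lborel" using o \<open>emeasure lborel (snd c ` ?V) = 0\<close> by (intro null_setsI) simp_all
  then have "negligible (snd c ` ?V)"
    unfolding negligible_iff_null_sets by (rule null_sets_completionI)
  ultimately show False
    using open_not_negligible[OF o] by simp
qed

lemma continuous_zero_of_integral_zero:
  fixes f :: "'a \<Rightarrow> real"
  assumes f: "continuous_on M f" "\<And>a. a \<in> M \<Longrightarrow> f a \<ge> 0" "(\<integral>a. f a \<partial>N) = 0" and a: "a \<in> M"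
  shows "f a = 0"
proof (rule ccontr)
  assume "f a \<noteq> 0"
  let ?U = "{a\<in>M. f a > 0}"
  have "openin (top_of_set M) (M \<inter> f -` {0<..})"
    by (rule continuous_openin_preimage_gen[OF f(1)]) auto
  moreover have "M \<inter> f -` {0<..} = ?U" by auto
  ultimately have U: "openin (top_of_set M) ?U" by simp
  have "AE x in N. 0 \<le> f x" using f(2) by (intro AE_I2) (simp add: space_N)
  then have "AE x in N. f x = 0"
    using integral_nonneg_eq_0_iff_AE[OF integrable_continuous[OF f(1)]] f(3) by blast
  then have "AE x in N. x \<notin> ?U" by eventually_elim simp
  moreover have "{x \<in> space N. \<not> x \<notin> ?U} = ?U" by (auto simp: space_N)
  ultimately have "emeasure N ?U = 0"
    using AE_iff_measurable[OF sets_openin[OF U], of "\<lambda>x. x \<notin> ?U"] by simp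
  moreover have "a \<in> ?U" using a f(2)[OF a] \<open>f a \<noteq> 0\<close> by simp
  then have "?U \<noteq> {}" by fast
  ultimately show False using emeasure_open_pos[OF U] by simp
qed

end

section \<open>Finite-difference velocities\<close>

context embedded_manifold
begin

lemma continuous_on_inv_F: "continuous_on (F ` M) (inv_into M F)"
  by (rule continuous_on_inv[OF continuous_on_F compact_M]) (simp add: inj_F)

text \<open>\<open>M\<close> has no metric of its own. Since \<open>F\<close> is a homeomorphism
  from the compact \<open>M\<close> onto its image, \<open>V\<close> can be moved there, where
  uniform continuity makes sense.\<close>

lemma uniformly_continuous_in_F:
  fixes V :: "'a \<Rightarrow> 'c::metric_space"
  assumes V: "continuous_on M V" and e: "e > 0"
  obtains d where "d > 0" "\<And>a b. a \<in> M \<Longrightarrow> b \<in> M \<Longrightarrow> norm (F b - F a) < d \<Longrightarrow> dist (V b) (V a) < e"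
proof -
  have "continuous_on (F ` M) (\<lambda>z. V (inv_into M F z))"
    by (rule continuous_on_compose2[OF V continuous_on_inv_F]) (auto simp: inv_into_f_f[OF inj_F])
  then have "uniformly_continuous_on (F ` M) (\<lambda>z. V (inv_into M F z))"
    by (rule compact_uniformly_continuous) (rule compact_continuous_image[OF continuous_on_F compact_M])
  then obtain d where d: "d > 0" "\<And>x x'. x \<in> F ` M \<Longrightarrow> x' \<in> F ` M \<Longrightarrow> dist x' x < d \<Longrightarrow>
      dist (V (inv_into M F x')) (V (inv_into M F x)) < e"
    using e unfolding uniformly_continuous_on_def by metis
  show ?thesis
  proof (rule that[OF d(1)])
    fix a b assume ab: "a \<in> M" "b \<in> M" "norm (F b - F a) < d"
    then show "dist (V b) (V a) < e"
      using d(2)[of "F a" "F b"] by (simp add: dist_norm inv_into_f_f[OF inj_F])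
  qed
qed

end

locale manifold_with_flow = embedded_manifold M A F
  for M :: "'a::t2_space set" and A :: "('a, 'm::finite) chart set" and F :: "'a \<Rightarrow> 'b::euclidean_space" +
  fixes \<Phi> :: "real \<Rightarrow> 'a \<Rightarrow> 'a" and v :: "'a \<Rightarrow> 'a tvec"
  assumes flow: "is_flow \<Phi>" and invariant: "\<And>t. \<Phi> t ` M = M"
    and field: "dynamical_vector_field M A \<Phi> v" and field_nonzero: "\<And>a. a \<in> M \<Longrightarrow> v a \<noteq> (\<lambda>_. 0)"
begin

definition velocity :: "'a \<Rightarrow> 'b" where "velocity a = pushforward F (v a)"

lemma v_tangent: "a \<in> M \<Longrightarrow> v a \<in> tangent_space A a"
  using field by (auto simp: dynamical_vector_field_def C1_vector_field_def)

lemma velocity_nonzero: "a \<in> M \<Longrightarrow> velocity a \<noteq> 0"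
  unfolding velocity_def using pushforward_nonzero v_tangent field_nonzero by blast

lemma continuous_on_velocity: "continuous_on M velocity"
proof -
  have "continuous_on M (\<lambda>a. v a (\<lambda>b. F b \<bullet> e))" for e
    using field C2_F_component[of e] C1_fun_continuous
    unfolding dynamical_vector_field_def C1_vector_field_def by blast
  then show ?thesis
    unfolding velocity_def pushforward_def by (intro continuous_intros)
qed

lemma flow_in_M: "a \<in> M \<Longrightarrow> \<Phi> t a \<in> M"
  using invariant by blast

text \<open>The vector field is defined by a limit at time 0 only; the flow law moves it to time t
  by restarting the orbit at \<open>\<Phi> t a\<close>. Components are used because tangent vectors
  act on scalar functions.\<close>

lemma orbit_has_vector_derivative:
  assumes "a \<in> M"
  shows "((\<lambda>t. F (\<Phi> t a)) has_vector_derivative velocity (\<Phi> t a)) (at t)"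
  unfolding has_vector_derivative_def
proof (subst has_derivative_componentwise_within, rule ballI)
  fix e :: 'b assume "e \<in> Basis"
  let ?f = "\<lambda>b. F b \<bullet> e"
  have "((\<lambda>s. (?f (\<Phi> s (\<Phi> t a)) - ?f (\<Phi> t a)) / s) \<longlongrightarrow> v (\<Phi> t a) ?f) (at 0)"
    using field C1_F_component[of e] flow_in_M[OF assms, of t] unfolding dynamical_vector_field_def by blast
  moreover have "\<Phi> s (\<Phi> t a) = \<Phi> (t + s) a" for s
    using flow unfolding is_flow_def by (metis add.commute comp_apply)
  ultimately have "((\<lambda>t. ?f (\<Phi> t a)) has_field_derivative v (\<Phi> t a) ?f) (at t)"
    by (simp add: DERIV_def)
  moreover have "v (\<Phi> t a) ?f = velocity (\<Phi> t a) \<bullet> e"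
    unfolding velocity_def
    by (rule pushforward_component[OF flow_in_M[OF assms] v_tangent[OF flow_in_M[OF assms]], symmetric])
  ultimately show "((\<lambda>x. F (\<Phi> x a) \<bullet> e) has_derivative (\<lambda>x. (x *\<^sub>R velocity (\<Phi> t a)) \<bullet> e)) (at t)"
    by (simp add: has_field_derivative_def mult.commute[of _ "velocity _ \<bullet> _"])
qed

lemma velocity_bound: obtains B where "B > 0" "\<And>a. a \<in> M \<Longrightarrow> norm (velocity a) \<le> B"
  using compact_imp_bounded[OF compact_continuous_image[OF continuous_on_velocity compact_M]]
  unfolding bounded_pos by auto

text \<open>The mean value inequality is applied twice: to the orbit, for a common Lipschitz
  constant, and to its deviation from the tangent line, whose derivative is
  \<open>velocity (\<Phi> t a) - velocity a\<close>. Uniform continuity of the velocity makes the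
  bound independent of \<open>a\<close>.\<close>

lemma orbit_uniform_linearization:
  assumes "e > 0"
  obtains d where "d > 0" "\<And>a t. a \<in> M \<Longrightarrow> \<bar>t\<bar> < d \<Longrightarrow> norm (F (\<Phi> t a) - F a - t *\<^sub>R velocity a) \<le> e * \<bar>t\<bar>"
proof -
  obtain B where B: "B > 0" "\<And>a. a \<in> M \<Longrightarrow> norm (velocity a) \<le> B" using velocity_bound by blast
  obtain d where d: "d > 0" "\<And>a b. a \<in> M \<Longrightarrow> b \<in> M \<Longrightarrow> norm (F b - F a) < d \<Longrightarrow> dist (velocity b) (velocity a) < e"
    using uniformly_continuous_in_F[OF continuous_on_velocity assms] by metis
  have zero: "\<Phi> 0 a = a" for a using flow by (simp add: is_flow_def)
  have lip: "norm (F (\<Phi> t a) - F a) \<le> B * \<bar>t\<bar>" if "a \<in> M" for a t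
  proof -
    have "norm (F (\<Phi> t a) - F (\<Phi> 0 a)) \<le> B * norm (t - 0)"
    proof (rule differentiable_bound[where S=UNIV and f'="\<lambda>t h. h *\<^sub>R velocity (\<Phi> t a)"])
      fix x :: real
      show "((\<lambda>t. F (\<Phi> t a)) has_derivative (\<lambda>h. h *\<^sub>R velocity (\<Phi> x a))) (at x within UNIV)"
        using orbit_has_vector_derivative[OF that, of x] by (simp add: has_vector_derivative_def)
      show "onorm (\<lambda>h. h *\<^sub>R velocity (\<Phi> x a)) \<le> B"
        using B(2)[OF flow_in_M[OF that, of x]] by (intro onorm_bound) (auto simp: mult.commute[of B] B less_imp_le intro!: mult_left_mono)
    qed auto
    then show ?thesis by (simp add: zero)
  qed
  show ?thesis
  \<comment> \<open>By the Lipschitz bound an orbit moves less than \<open>d\<close> within time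
    \<open>d / B\<close>, so the velocity along it changes by less than \<open>e\<close>.\<close>
  proof (rule that[of "d / B"])
    show "d / B > 0" using d B by simp
    fix a t assume a: "a \<in> M" and t: "\<bar>t\<bar> < d / B"
    have "norm ((F (\<Phi> t a) - t *\<^sub>R velocity a) - (F (\<Phi> 0 a) - 0 *\<^sub>R velocity a)) \<le> e * norm (t - 0)"
    proof (rule differentiable_bound[where S="{-\<bar>t\<bar>..\<bar>t\<bar>}" and f'="\<lambda>t h. h *\<^sub>R (velocity (\<Phi> t a) - velocity a)"])
      fix x :: real assume x: "x \<in> {-\<bar>t\<bar>..\<bar>t\<bar>}"
      have "((\<lambda>t. F (\<Phi> t a) - t *\<^sub>R velocity a) has_derivative (\<lambda>h. h *\<^sub>R velocity (\<Phi> x a) - h *\<^sub>R velocity a)) (at x)"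
        using orbit_has_vector_derivative[OF a, of x]
        by (auto intro!: derivative_eq_intros simp: has_vector_derivative_def)
      then show "((\<lambda>t. F (\<Phi> t a) - t *\<^sub>R velocity a) has_derivative (\<lambda>h. h *\<^sub>R (velocity (\<Phi> x a) - velocity a))) (at x within {-\<bar>t\<bar>..\<bar>t\<bar>})"
        by (simp add: scaleR_diff_right has_derivative_at_withinI)
      have "norm (F (\<Phi> x a) - F a) \<le> B * \<bar>x\<bar>" by (rule lip[OF a])
      also have "\<dots> \<le> B * \<bar>t\<bar>" using x B(1) by (intro mult_left_mono) auto
      also have "\<dots> < d" using t B(1) by (simp add: field_simps)
      finally have "dist (velocity (\<Phi> x a)) (velocity a) < e" by (intro d(2) a flow_in_M)
      then show "onorm (\<lambda>h. h *\<^sub>R (velocity (\<Phi> x a) - velocity a)) \<le> e"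
        by (intro onorm_bound) (auto simp: mult.commute[of e] dist_norm less_imp_le assms intro!: mult_left_mono)
    qed auto
    then show "norm (F (\<Phi> t a) - F a - t *\<^sub>R velocity a) \<le> e * \<bar>t\<bar>"
      by (simp add: zero algebra_simps)
  qed
qed

text \<open>The vanishing sum of weights cancels \<open>F a\<close>, the unit first moment leaves
  exactly \<open>t *\<^sub>R velocity a\<close>, and what remains is a finite sum of linearization
  errors at the sample times.\<close>

lemma fd_velocity_uniform_limit:
  assumes J: "finite J" and w: "(\<Sum>j\<in>J. w j) = 0" "(\<Sum>j\<in>J. w j * of_int j) = 1" and e: "e > 0"
  shows "\<forall>\<^sub>F t in at_right 0. \<forall>a\<in>M. norm (fd_velocity J w \<Phi> F t a /\<^sub>R t - velocity a) \<le> e"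
proof -
  \<comment> \<open>Adding 1 here and in \<open>L\<close> ensures positive divisors without
    inspecting the scheme. \<open>L\<close> bounds the sample indices, so \<open>t < d / L\<close>
    keeps every sample time below \<open>d\<close>.\<close>
  define W where "W = (\<Sum>j\<in>J. \<bar>w j\<bar> * \<bar>of_int j\<bar>) + 1"
  have W: "W > 0" unfolding W_def by (intro add_nonneg_pos sum_nonneg) auto
  have "e / W > 0" using e W by simp
  then obtain d where d: "d > 0" "\<And>a t. a \<in> M \<Longrightarrow> \<bar>t\<bar> < d \<Longrightarrow> norm (F (\<Phi> t a) - F a - t *\<^sub>R velocity a) \<le> e / W * \<bar>t\<bar>"
    using orbit_uniform_linearization by metis
  define L where "L = (\<Sum>j\<in>J. \<bar>of_int j\<bar>) + (1::real)"
  have L: "L > 0" unfolding L_def by (intro add_nonneg_pos sum_nonneg) auto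
  have jL: "\<bar>of_int j\<bar> \<le> L" if "j \<in> J" for j
    unfolding L_def using member_le_sum[OF that, of "\<lambda>j. \<bar>of_int j\<bar> :: real"] J by auto
  have "norm (fd_velocity J w \<Phi> F t a /\<^sub>R t - velocity a) \<le> e" if a: "a \<in> M" and t: "0 < t" "t < d / L" for a t
  proof -
    have "fd_velocity J w \<Phi> F t a - t *\<^sub>R velocity a =
        (\<Sum>j\<in>J. w j *\<^sub>R F (\<Phi> (of_int j * t) a)) - (\<Sum>j\<in>J. w j) *\<^sub>R F a - ((\<Sum>j\<in>J. w j * of_int j) * t) *\<^sub>R velocity a"
      by (simp add: w fd_velocity_def)
    also have "\<dots> = (\<Sum>j\<in>J. w j *\<^sub>R (F (\<Phi> (of_int j * t) a) - F a - (of_int j * t) *\<^sub>R velocity a))"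
      by (simp add: scaleR_diff_right sum_subtractf scaleR_sum_left sum_distrib_right mult.assoc)
    also have "norm \<dots> \<le> (\<Sum>j\<in>J. \<bar>w j\<bar> * (e / W * (\<bar>of_int j\<bar> * t)))"
    proof (rule order_trans[OF norm_sum], rule sum_mono)
      fix j assume j: "j \<in> J"
      have "\<bar>of_int j * t\<bar> < d"
      proof -
        have "\<bar>of_int j * t\<bar> \<le> L * t" using jL[OF j] t by (simp add: abs_mult mult_right_mono)
        also have "\<dots> < d" using t L by (simp add: field_simps)
        finally show ?thesis .
      qed
      from mult_left_mono[OF d(2)[OF a this] abs_ge_zero] show "norm (w j *\<^sub>R (F (\<Phi> (of_int j * t) a) - F a - (of_int j * t) *\<^sub>R velocity a)) \<le> \<bar>w j\<bar> * (e / W * (\<bar>of_int j\<bar> * t))"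
        using t by (simp add: abs_mult)
    qed
    also have "\<dots> = e / W * t * (\<Sum>j\<in>J. \<bar>w j\<bar> * \<bar>of_int j\<bar>)"
      by (simp add: sum_distrib_left mult_ac)
    also have "\<dots> \<le> e / W * t * W"
      using e W t by (intro mult_left_mono) (auto simp: W_def)
    also have "\<dots> = e * t" using W by simp
    finally have "norm (fd_velocity J w \<Phi> F t a - t *\<^sub>R velocity a) / t \<le> e" using t by (simp add: field_simps)
    moreover have "fd_velocity J w \<Phi> F t a /\<^sub>R t - velocity a = (fd_velocity J w \<Phi> F t a - t *\<^sub>R velocity a) /\<^sub>R t"
      using t by (simp add: scaleR_diff_right)
    ultimately show ?thesis using t by (simp add: divide_inverse mult.commute)
  qed
  moreover have "\<forall>\<^sub>F t in at_right 0. 0 < t \<and> t < d / L"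
    using d L by (auto simp: eventually_at_right_field intro: divide_pos_pos exI[of _ "d / L"])
  ultimately show ?thesis by (auto elim: eventually_mono)
qed

end

section \<open>The codifferential of a square\<close>

context embedded_manifold
begin

lemma C2_functions_dense:
  fixes G :: "'a \<Rightarrow> real"
  assumes "continuous_on M G" "e > 0"
  obtains \<phi> where "C2_fun A \<phi>" "\<And>a. a \<in> M \<Longrightarrow> \<bar>G a - \<phi> a\<bar> < e"
proof -
  have "continuous_on (F ` M) (\<lambda>z. G (inv_into M F z))"
    by (rule continuous_on_compose2[OF assms(1) continuous_on_inv_F]) (auto simp: inv_into_f_f[OF inj_F])
  from Stone_Weierstrass_real_polynomial_function[OF compact_continuous_image[OF continuous_on_F compact_M] this assms(2)]
  obtain q where q: "real_polynomial_function q" "\<And>x. x \<in> F ` M \<Longrightarrow> \<bar>G (inv_into M F x) - q x\<bar> < e"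
    by metis
  show ?thesis
  proof (rule that)
    show "C2_fun A (\<lambda>b. q (F b))" by (rule C2_fun_real_polynomial[OF q(1) C2_F])
    show "\<bar>G a - q (F a)\<bar> < e" if "a \<in> M" for a
      using q(2)[of "F a"] that by (simp add: inv_into_f_f[OF inj_F])
  qed
qed

end

context manifold_with_volume
begin

text \<open>\<open>G\<close> itself need not be an admissible test function. Testing with a uniform
  approximation \<phi> gives that the integral of \<open>G\<^sup>2\<close> equals that of
  \<open>G * (G - \<phi>)\<close>, which is arbitrarily small; full support then gives vanishing at
  every point.\<close>

lemma zero_if_orthogonal_to_C2:
  fixes G :: "'a \<Rightarrow> real"
  assumes G: "continuous_on M G"
    and orth: "\<And>\<phi>. C2_fun A \<phi> \<Longrightarrow> (\<integral>a. G a * \<phi> a \<partial>N) = 0"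
    and a: "a \<in> M"
  shows "G a = 0"
proof -
  have I: "integrable N (\<lambda>a. \<bar>G a\<bar>)" "integrable N (\<lambda>a. G a * G a)"
    by (intro integrable_continuous continuous_intros G)+
  have "(\<integral>a. G a * G a \<partial>N) \<le> 0 + e" if e: "e > 0" for e
  proof -
    define S where "S = (\<integral>a. \<bar>G a\<bar> \<partial>N)"
    have S: "S \<ge> 0" unfolding S_def by simp
    define d where "d = e / (S + 1)"
    have d: "d > 0" "d * S \<le> e" using e S by (auto simp: d_def field_simps)
    obtain \<phi> where \<phi>: "C2_fun A \<phi>" "\<And>a. a \<in> M \<Longrightarrow> \<bar>G a - \<phi> a\<bar> < d"
      using C2_functions_dense[OF G d(1)] by metis
    have c\<phi>: "continuous_on M \<phi>" using C1_fun_continuous C1_fun_C2 \<phi>(1) by blast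
    have I\<phi>: "integrable N (\<lambda>a. G a * \<phi> a)" by (intro integrable_continuous continuous_intros G c\<phi>)
    have "(\<integral>a. G a * G a \<partial>N) = (\<integral>a. G a * G a \<partial>N) - (\<integral>a. G a * \<phi> a \<partial>N)"
      using orth[OF \<phi>(1)] by simp
    also have "\<dots> = (\<integral>a. G a * G a - G a * \<phi> a \<partial>N)"
      by (rule Bochner_Integration.integral_diff[OF I(2) I\<phi>, symmetric])
    also have "\<dots> \<le> (\<integral>a. d * \<bar>G a\<bar> \<partial>N)"
    proof (rule integral_mono)
      fix a assume "a \<in> space N"
      then have "\<bar>G a - \<phi> a\<bar> \<le> d" using \<phi>(2) by (simp add: space_N less_imp_le)
      have "G a * G a - G a * \<phi> a \<le> \<bar>G a * (G a - \<phi> a)\<bar>" by (simp add: algebra_simps)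
      also have "\<dots> \<le> d * \<bar>G a\<bar>"
        using \<open>\<bar>G a - \<phi> a\<bar> \<le> d\<close> by (simp add: abs_mult mult.commute[of d] mult_left_mono)
      finally show "G a * G a - G a * \<phi> a \<le> d * \<bar>G a\<bar>" .
    qed (use I I\<phi> in auto)
    also have "\<dots> \<le> e" using d(2) by (simp add: S_def)
    finally show ?thesis by simp
  qed
  then have "(\<integral>a. G a * G a \<partial>N) \<le> 0" by (rule field_le_epsilon)
  moreover have "(\<integral>a. G a * G a \<partial>N) \<ge> 0" by (intro integral_nonneg_AE) simp
  ultimately have "(\<integral>a. G a * G a \<partial>N) = 0" by simp
  then have "G a * G a = 0"
    by (intro continuous_zero_of_integral_zero[where f="\<lambda>a. G a * G a"] continuous_intros G a) auto
  then show ?thesis by simp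
qed

lemma inverse_metric_eq:
  assumes a: "a \<in> M" and f: "C2_fun A f" "C2_fun A f'"
  shows "inverse_metric A h a (differential f a) (differential f' a) = sharp A h a (differential f a) f'"
    and "inverse_metric A h a (differential f a) (differential f' a) = sharp A h a (differential f' a) f"
    and "sharp A h a (differential f a) \<in> tangent_space A a"
    and "\<And>u. u \<in> tangent_space A a \<Longrightarrow> h a (sharp A h a (differential f a)) u = u f"
proof -
  obtain c where c: "c \<in> A" "a \<in> fst c" using a by (rule chart_cover)
  have s: "sharp A h a (differential f a) \<in> tangent_space A a"
    "\<And>u. u \<in> tangent_space A a \<Longrightarrow> h a (sharp A h a (differential f a)) u = u f" if "C2_fun A f" for f :: "'a \<Rightarrow> real"
    using continuous_on_inverse_metric(2)[OF metric that that a] by auto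
  have sym: "\<And>u u'. u \<in> tangent_space A a \<Longrightarrow> u' \<in> tangent_space A a \<Longrightarrow> h a u u' = h a u' u"
    using metric c unfolding riemannian_metric_def by blast
  show "inverse_metric A h a (differential f a) (differential f' a) = sharp A h a (differential f a) f'"
    unfolding inverse_metric_def using s[OF f(1)] s[OF f(2)] sym by metis
  show "inverse_metric A h a (differential f a) (differential f' a) = sharp A h a (differential f' a) f"
    unfolding inverse_metric_def using s[OF f(1)] s[OF f(2)] by metis
  show "sharp A h a (differential f a) \<in> tangent_space A a"
    "\<And>u. u \<in> tangent_space A a \<Longrightarrow> h a (sharp A h a (differential f a)) u = u f"
    using s[OF f(1)] by auto
qed

text \<open>Test the identity against \<phi>: the product rule turns \<open>d (f\<^sup>2)\<close>
  paired with \<open>d\<phi>\<close> into \<open>2 * f\<close> times the pairing of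
  \<open>df\<close> and \<open>d\<phi>\<close>, and \<open>df\<close> paired with
  \<open>d (f * \<phi>)\<close> contributes the same cross term plus \<phi> times the square of
  \<open>df\<close>. The cross terms cancel. The density is only a common factor, never
  differentiated, and being positive it divides out.\<close>

lemma codifferential_square:
  assumes s: "C1_fun A s" "\<And>a. a \<in> M \<Longrightarrow> s a > 0"
    and D: "codifferential M A h (density N (\<lambda>a. ennreal (s a))) D"
    and f: "C2_fun A f" and a: "a \<in> M"
  shows "D (differential (\<lambda>b. f b * f b)) a - 2 * f a * D (differential f) a =
    - 2 * inverse_metric A h a (differential f a) (differential f a)"
proof -
  let ?f2 = "\<lambda>b. f b * f b"
  let ?g = "\<lambda>f f' a. inverse_metric A h a (differential f a) (differential f' a)"
  have f2: "C2_fun A ?f2" by (rule C2_fun_mult[OF f f])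
  have cs: "continuous_on M s" by (rule C1_fun_continuous[OF s(1)])
  have cC2: "continuous_on M \<phi>" if "C2_fun A \<phi>" for \<phi> :: "'a \<Rightarrow> real"
    by (rule C1_fun_continuous[OF C1_fun_C2[OF that]])
  have cD: "continuous_on M (D (differential \<phi>))" if "C2_fun A \<phi>" for \<phi>
    using D C1_form_differential[OF that] unfolding codifferential_def by blast
  have int: "(\<integral>a. f a \<partial>density N (\<lambda>a. ennreal (s a))) = (\<integral>a. s a * f a \<partial>N)" if "continuous_on M f" for f :: "'a \<Rightarrow> real"
    using s(2) by (subst integral_density) (auto intro!: measurable_continuous that cs AE_I2 simp: space_N less_imp_le)
  have weak: "(\<integral>a. s a * ?g \<phi> \<psi> a \<partial>N) = (\<integral>a. s a * (D (differential \<phi>) a * \<psi> a) \<partial>N)"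
    if "C2_fun A \<phi>" "C2_fun A \<psi>" for \<phi> \<psi>
  proof -
    have "(\<integral>a. ?g \<phi> \<psi> a \<partial>density N (\<lambda>a. ennreal (s a))) = (\<integral>a. D (differential \<phi>) a * \<psi> a \<partial>density N (\<lambda>a. ennreal (s a)))"
      using D C1_form_differential[OF that(1)] that(2) unfolding codifferential_def by blast
    then show ?thesis
      by (simp add: int continuous_on_inverse_metric(1)[OF metric that] continuous_on_mult cD cC2 that)
  qed
  define G where "G = (\<lambda>a. s a * (D (differential ?f2) a - 2 * f a * D (differential f) a + 2 * ?g f f a))"
  have "G a = 0"
  proof (rule zero_if_orthogonal_to_C2[OF _ _ a])
    show "continuous_on M G"
      unfolding G_def by (intro continuous_intros cs cD f f2 cC2 continuous_on_inverse_metric(1)[OF metric])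
    fix \<phi> :: "'a \<Rightarrow> real" assume \<phi>: "C2_fun A \<phi>"
    have f\<phi>: "C2_fun A (\<lambda>b. f b * \<phi> b)" by (rule C2_fun_mult[OF f \<phi>])
    note cont = cs cD[OF f] cD[OF f2] cC2[OF f] cC2[OF \<phi>] continuous_on_inverse_metric(1)[OF metric]
    have I: "integrable N (\<lambda>a. s a * (D (differential ?f2) a * \<phi> a))"
      "integrable N (\<lambda>a. s a * (D (differential f) a * (f a * \<phi> a)))"
      "integrable N (\<lambda>a. s a * (?g f f a * \<phi> a))" "integrable N (\<lambda>a. s a * ?g ?f2 \<phi> a)"
      "integrable N (\<lambda>a. s a * ?g f (\<lambda>b. f b * \<phi> b) a)"
      by (intro integrable_continuous continuous_intros cont f \<phi> f2 f\<phi>)+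
    have "(\<integral>a. G a * \<phi> a \<partial>N) = (\<integral>a. s a * (D (differential ?f2) a * \<phi> a)
        - 2 * (s a * (D (differential f) a * (f a * \<phi> a))) + 2 * (s a * (?g f f a * \<phi> a)) \<partial>N)"
      by (intro Bochner_Integration.integral_cong) (auto simp: G_def algebra_simps)
    also have "\<dots> = (\<integral>a. s a * (D (differential ?f2) a * \<phi> a) \<partial>N)
        - 2 * (\<integral>a. s a * (D (differential f) a * (f a * \<phi> a)) \<partial>N) + 2 * (\<integral>a. s a * (?g f f a * \<phi> a) \<partial>N)"
      using I by simp
    also have "\<dots> = (\<integral>a. s a * ?g ?f2 \<phi> a \<partial>N)
        - 2 * (\<integral>a. s a * ?g f (\<lambda>b. f b * \<phi> b) a \<partial>N) + 2 * (\<integral>a. s a * (?g f f a * \<phi> a) \<partial>N)"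
      using weak[OF f2 \<phi>] weak[OF f f\<phi>] by simp
    also have "\<dots> = (\<integral>a. s a * ?g ?f2 \<phi> a - 2 * (s a * ?g f (\<lambda>b. f b * \<phi> b) a) + 2 * (s a * (?g f f a * \<phi> a)) \<partial>N)"
      using I by simp
    also have "\<dots> = (\<integral>a. 0 \<partial>N)"
    proof (rule Bochner_Integration.integral_cong[OF refl])
      fix b assume "b \<in> space N"
      then have b: "b \<in> M" by (simp add: space_N)
      have "?g ?f2 \<phi> b = 2 * f b * ?g f \<phi> b"
        using tangent_vector_mult[OF C1_fun_C2[OF f] C1_fun_C2[OF f] C1_fun_C2[OF f2] b inverse_metric_eq(3)[OF b \<phi> \<phi>]]
        unfolding inverse_metric_eq(2)[OF b f2 \<phi>] inverse_metric_eq(2)[OF b f \<phi>] by simp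
      moreover have "?g f (\<lambda>b. f b * \<phi> b) b = f b * ?g f \<phi> b + \<phi> b * ?g f f b"
        using tangent_vector_mult[OF C1_fun_C2[OF f] C1_fun_C2[OF \<phi>] C1_fun_C2[OF f\<phi>] b inverse_metric_eq(3)[OF b f f]]
        unfolding inverse_metric_eq(1)[OF b f f\<phi>] inverse_metric_eq(1)[OF b f \<phi>] inverse_metric_eq(1)[OF b f f] by simp
      ultimately show "s b * ?g ?f2 \<phi> b - 2 * (s b * ?g f (\<lambda>b. f b * \<phi> b) b) + 2 * (s b * (?g f f b * \<phi> b)) = 0"
        by (simp add: algebra_simps)
    qed
    finally show "(\<integral>a. G a * \<phi> a \<partial>N) = 0" by simp
  qed
  then show ?thesis using s(2)[OF a] by (simp add: G_def)
qed

end

section \<open>Small-scale limit of cone kernel integrals\<close>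

definition cone_exponent :: "real \<Rightarrow> 'b::euclidean_space \<Rightarrow> 'b \<Rightarrow> 'b \<Rightarrow> real" where
  "cone_exponent \<zeta> x y w = (norm w)\<^sup>2 / (norm x * norm y) *
     sqrt ((1 - \<zeta> * (cos_angle x w)\<^sup>2) * (1 - \<zeta> * (cos_angle y w)\<^sup>2))"

text \<open>The asserted metric transported to the observation space, with \<open>x\<close> in the
  role of the velocity. Its diagonal is the cone exponent with both velocities equal to
  \<open>x\<close>.\<close>

definition cone_form :: "real \<Rightarrow> 'b::euclidean_space \<Rightarrow> 'b \<Rightarrow> 'b \<Rightarrow> real" where
  "cone_form \<zeta> x w w' = 1 / (norm x)\<^sup>2 * (w \<bullet> w' - \<zeta> * ((x \<bullet> w) * (x \<bullet> w') / (norm x)\<^sup>2))"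

text \<open>For \<open>a = b\<close> the displacement is 0 and the exponent vanishes, so the case
  distinction disappears.\<close>

lemma cone_kernel_eq: "cone_kernel \<xi> F \<zeta> t a b = exp (- cone_exponent \<zeta> (\<xi> t a) (\<xi> t b) (F b - F a))"
  unfolding cone_kernel_def cone_exponent_def Let_def by simp

lemma cos_angle_sq_le: "(cos_angle x w)\<^sup>2 \<le> 1"
proof -
  have "\<bar>cos_angle x w\<bar> \<le> 1"
    using Cauchy_Schwarz_ineq2[of x w]
    by (cases "x = 0 \<or> w = 0") (auto simp: cos_angle_def divide_le_eq_1_pos)
  then show ?thesis by (simp add: abs_square_le_1)
qed

lemma cone_factor_bounds:
  assumes "0 \<le> \<zeta>" "\<zeta> < 1"
  shows "1 - \<zeta> \<le> 1 - \<zeta> * (cos_angle x w)\<^sup>2" "1 - \<zeta> * (cos_angle x w)\<^sup>2 \<le> 1"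
  using assms cos_angle_sq_le[of x w] mult_left_le[of "(cos_angle x w)\<^sup>2" \<zeta>] by auto

text \<open>Each angular factor is at least \<open>1 - \<zeta>\<close> by Cauchy-Schwarz, hence so
  is the root of their product. As \<zeta> < 1, the kernel keeps a Gaussian decay in every
  direction, including that of the flow.\<close>

lemma cone_exponent_lower:
  assumes \<zeta>: "0 \<le> \<zeta>" "\<zeta> < 1"
  shows "(1 - \<zeta>) * ((norm w)\<^sup>2 / (norm x * norm y)) \<le> cone_exponent \<zeta> x y w"
proof -
  have "(1 - \<zeta>)\<^sup>2 \<le> (1 - \<zeta> * (cos_angle x w)\<^sup>2) * (1 - \<zeta> * (cos_angle y w)\<^sup>2)"
    unfolding power2_eq_square[of "1 - \<zeta>"] using cone_factor_bounds[OF \<zeta>, of x w] cone_factor_bounds[OF \<zeta>, of y w] \<zeta>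
    by (intro mult_mono) auto
  then have "1 - \<zeta> \<le> sqrt ((1 - \<zeta> * (cos_angle x w)\<^sup>2) * (1 - \<zeta> * (cos_angle y w)\<^sup>2))"
    by (rule real_le_rsqrt)
  then show ?thesis unfolding cone_exponent_def
    by (subst mult.commute) (intro mult_left_mono, auto)
qed

lemma cone_exponent_upper:
  assumes \<zeta>: "0 \<le> \<zeta>" "\<zeta> < 1"
  shows "cone_exponent \<zeta> x y w \<le> (norm w)\<^sup>2 / (norm x * norm y)"
proof -
  have "(1 - \<zeta> * (cos_angle x w)\<^sup>2) * (1 - \<zeta> * (cos_angle y w)\<^sup>2) \<le> 1"
    using cone_factor_bounds[OF \<zeta>, of x w] cone_factor_bounds[OF \<zeta>, of y w] \<zeta>
    by (intro mult_le_one) auto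
  then have "sqrt ((1 - \<zeta> * (cos_angle x w)\<^sup>2) * (1 - \<zeta> * (cos_angle y w)\<^sup>2)) \<le> 1" by simp
  then show ?thesis unfolding cone_exponent_def by (intro mult_left_le) auto
qed

text \<open>Angles do not see scaling, and numerator and denominator are both quadratic. Velocities
  and displacement can therefore be divided by the sampling interval at once, which brings all three
  to order one.\<close>

lemma cone_exponent_scale:
  assumes t: "t > 0"
  shows "cone_exponent \<zeta> (x /\<^sub>R t) (y /\<^sub>R t) (w /\<^sub>R t) = cone_exponent \<zeta> x y w"
proof -
  have "cos_angle (x /\<^sub>R t) (w /\<^sub>R t) = cos_angle x w" for x w :: 'a
    using t by (simp add: cos_angle_def field_simps)
  then show ?thesis
    unfolding cone_exponent_def using t by (simp add: power_mult_distrib field_simps power2_eq_square)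
qed

lemma cone_exponent_diagonal:
  assumes \<zeta>: "0 \<le> \<zeta>" "\<zeta> < 1"
  shows "cone_exponent \<zeta> x x w = cone_form \<zeta> x w w"
proof -
  have "sqrt ((1 - \<zeta> * (cos_angle x w)\<^sup>2) * (1 - \<zeta> * (cos_angle x w)\<^sup>2)) = 1 - \<zeta> * (cos_angle x w)\<^sup>2"
    using cone_factor_bounds[OF \<zeta>, of x w] \<zeta> by simp
  then show ?thesis
    by (cases "w = 0"; cases "x = 0")
       (auto simp: cone_exponent_def cone_form_def cos_angle_def power2_norm_eq_inner[symmetric] field_simps power2_eq_square)
qed

text \<open>Angles with \<open>w\<close> are discontinuous at \<open>w = 0\<close>, so a zero limit
  displacement is treated apart: there the exponent is squeezed between 0 and a multiple of the
  squared norm.\<close>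

lemma tendsto_cone_exponent:
  assumes \<zeta>: "0 \<le> \<zeta>" "\<zeta> < 1" and lim: "(x \<longlongrightarrow> x0) G" "(y \<longlongrightarrow> x0) G" "(w \<longlongrightarrow> w0) G" and x0: "x0 \<noteq> 0"
  shows "((\<lambda>n. cone_exponent \<zeta> (x n) (y n) (w n)) \<longlongrightarrow> cone_form \<zeta> x0 w0 w0) G"
proof (cases "w0 = 0")
  case False
  have "((\<lambda>n. cone_exponent \<zeta> (x n) (y n) (w n)) \<longlongrightarrow> cone_exponent \<zeta> x0 x0 w0) G"
    unfolding cone_exponent_def cos_angle_def
    using x0 False by (intro tendsto_intros lim) auto
  then show ?thesis by (simp add: cone_exponent_diagonal[OF \<zeta>])
next
  case True
  have "((\<lambda>n. (norm (w n))\<^sup>2 / (norm (x n) * norm (y n))) \<longlongrightarrow> (norm w0)\<^sup>2 / (norm x0 * norm x0)) G"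
    using x0 by (intro tendsto_intros lim) auto
  then have u: "((\<lambda>n. (norm (w n))\<^sup>2 / (norm (x n) * norm (y n))) \<longlongrightarrow> 0) G" using True by simp
  have "((\<lambda>n. cone_exponent \<zeta> (x n) (y n) (w n)) \<longlongrightarrow> 0) G"
  proof (rule tendsto_sandwich[OF _ _ tendsto_const u])
    have "0 \<le> cone_exponent \<zeta> x y w" for x y w :: 'b
      unfolding cone_exponent_def using cone_factor_bounds[OF \<zeta>, of x w] cone_factor_bounds[OF \<zeta>, of y w] \<zeta>
      by (intro mult_nonneg_nonneg real_sqrt_ge_zero) auto
    then show "\<forall>\<^sub>F n in G. 0 \<le> cone_exponent \<zeta> (x n) (y n) (w n)" by simp
    show "\<forall>\<^sub>F n in G. cone_exponent \<zeta> (x n) (y n) (w n) \<le> (norm (w n))\<^sup>2 / (norm (x n) * norm (y n))"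
      by (intro always_eventually allI cone_exponent_upper[OF \<zeta>])
  qed
  then show ?thesis using True by (simp add: cone_form_def)
qed

lemma cone_form_lower:
  assumes \<zeta>: "0 \<le> \<zeta>" "\<zeta> < 1"
  shows "(1 - \<zeta>) * ((norm w)\<^sup>2 / (norm x)\<^sup>2) \<le> cone_form \<zeta> x w w"
  using cone_exponent_lower[OF \<zeta>, of w x x] unfolding cone_exponent_diagonal[OF \<zeta>] by (simp add: power2_eq_square)

section \<open>Dilations and Laplace's method\<close>

lemma lborel_integral_affine:
  fixes f :: "'e::euclidean_space \<Rightarrow> real"
  assumes f: "f \<in> borel_measurable borel" and c: "c > 0"
  shows "(\<integral>y. f y \<partial>lborel) = c ^ DIM('e) * (\<integral>x. f (z + c *\<^sub>R x) \<partial>lborel)"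
proof -
  have "(\<integral>y. f y \<partial>lborel) = (\<integral>y. f y \<partial>density (distr lborel borel (\<lambda>x. z + c *\<^sub>R x)) (\<lambda>_. ennreal (\<bar>c\<bar> ^ DIM('e))))"
    using lborel_affine[of c z] c by simp
  also have "\<dots> = (\<integral>y. \<bar>c\<bar> ^ DIM('e) *\<^sub>R f y \<partial>distr lborel borel (\<lambda>x. z + c *\<^sub>R x))"
    using f by (intro integral_density) auto
  also have "\<dots> = (\<integral>x. \<bar>c\<bar> ^ DIM('e) *\<^sub>R f (z + c *\<^sub>R x) \<partial>lborel)"
    using f by (intro integral_distr) auto
  finally show ?thesis using c by simp
qed

text \<open>In the variable \<open>z = c / t\<^sup>2\<close>, which tends to infinity, everything is
  bounded by a multiple of \<open>z ^ (m + 1) / exp z\<close>. The factor with \<open>k\<close> is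
  room for the quadratic growth of the integrand.\<close>

lemma gaussian_beats_inverse_power:
  fixes t :: "nat \<Rightarrow> real"
  assumes t: "\<And>n. 0 < t n" "\<And>n. t n \<le> 1" "t \<longlonglongrightarrow> 0" and c: "c > 0" and k: "k \<ge> 0"
  shows "(\<lambda>n. 1 / t n ^ m * (exp (- c / (t n)\<^sup>2) * (1 + k / (t n)\<^sup>2))) \<longlonglongrightarrow> 0"
proof (rule tendsto_sandwich[OF _ _ tendsto_const])
  define z where "z = (\<lambda>n. c / (t n)\<^sup>2)"
  have zpos: "z n > 0" for n unfolding z_def using c t(1)[of n] by simp
  have "filterlim (\<lambda>n. (t n)\<^sup>2) (at_right 0) sequentially"
    using tendsto_power[OF t(3), of 2] t(1)
    by (auto simp: filterlim_at intro!: always_eventually less_imp_neq[symmetric])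
  then have "filterlim z at_top sequentially"
    unfolding z_def divide_inverse using c
    by (intro filterlim_tendsto_pos_mult_at_top[OF tendsto_const] filterlim_compose[OF filterlim_inverse_at_top_right]) auto
  then have "(\<lambda>n. z n ^ (m + 1) / exp (z n)) \<longlonglongrightarrow> 0"
    by (rule filterlim_compose[OF tendsto_power_div_exp_0])
  then show "(\<lambda>n. (1 + k) / c ^ (m + 1) * (z n ^ (m + 1) / exp (z n))) \<longlonglongrightarrow> 0"
    by (rule tendsto_mult_right_zero)
  show "\<forall>\<^sub>F n in sequentially. 0 \<le> 1 / t n ^ m * (exp (- c / (t n)\<^sup>2) * (1 + k / (t n)\<^sup>2))"
    using t(1) k by (auto intro!: always_eventually mult_nonneg_nonneg add_nonneg_nonneg simp: less_imp_le)
  show "\<forall>\<^sub>F n in sequentially. 1 / t n ^ m * (exp (- c / (t n)\<^sup>2) * (1 + k / (t n)\<^sup>2))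
      \<le> (1 + k) / c ^ (m + 1) * (z n ^ (m + 1) / exp (z n))"
  proof (intro always_eventually allI)
    fix n
    have t2: "0 < (t n)\<^sup>2" "(t n)\<^sup>2 \<le> 1" using t(1,2)[of n] by (auto simp: power_le_one)
    \<comment> \<open>Doubling the exponent only enlarges the reciprocal, as t is at most 1, and
      leaves pure powers of \<open>t\<^sup>2\<close>, hence of \<open>z\<close>.\<close>
    have "1 / t n ^ m \<le> 1 / (t n)\<^sup>2 ^ m"
      using t(1,2)[of n] by (intro divide_left_mono) (auto simp: power_mult[symmetric] intro!: power_decreasing)
    moreover have "1 + k / (t n)\<^sup>2 \<le> (1 + k) / (t n)\<^sup>2"
      using t2 by (simp add: add_divide_distrib)
    ultimately have "1 / t n ^ m * (exp (- z n) * (1 + k / (t n)\<^sup>2)) \<le> 1 / (t n)\<^sup>2 ^ m * (exp (- z n) * ((1 + k) / (t n)\<^sup>2))"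
      using t2 k t(1)[of n] by (intro mult_mono mult_left_mono mult_nonneg_nonneg add_nonneg_nonneg) auto
    also have "\<dots> = (1 + k) / c ^ (m + 1) * (z n ^ (m + 1) / exp (z n))"
      using c t2 unfolding z_def by (simp add: exp_minus field_simps power_divide)
    finally show "1 / t n ^ m * (exp (- c / (t n)\<^sup>2) * (1 + k / (t n)\<^sup>2)) \<le> (1 + k) / c ^ (m + 1) * (z n ^ (m + 1) / exp (z n))"
      by (simp add: z_def)
  qed
qed

context manifold_with_volume
begin

lemma measurable_in_chart:
  fixes f :: "'a \<Rightarrow> real"
  assumes c: "c \<in> A" and f[measurable]: "f \<in> borel_measurable N"
  shows "(\<lambda>y. indicator (chart_image c) y * (coord_volume h c y * f (chart_inv c y))) \<in> borel_measurable borel"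
proof -
  note [measurable] = measurable_chart_inv[OF c] measurable_coord_volume[OF c]
  have "(\<lambda>y. coord_volume h c y * f (chart_inv c y)) \<in> borel_measurable (restrict_space lborel (chart_image c))"
    by measurable
  then show ?thesis
    by (subst (asm) borel_measurable_restrict_space_iff) (auto simp: open_chart_image[OF c])
qed

text \<open>Away from \<open>a\<close> the kernel is smaller than any power of \<open>t n\<close>.
  Near \<open>a\<close> the substitution \<open>y = y0 + t n *\<^sub>R x\<close> cancels the
  prefactor exactly and leaves integrands with a common Gaussian bound, so dominated convergence
  applies; that is why the limit runs along a sequence. Quadratic growth of \<Psi> is allowed so
  that second moments are included.\<close>

lemma kernel_integral_limit:
  fixes \<xi> :: "real \<Rightarrow> 'a \<Rightarrow> 'b" and V :: "'a \<Rightarrow> 'b" and \<Psi> :: "'b \<Rightarrow> real" and t :: "nat \<Rightarrow> real"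
  assumes \<zeta>: "0 \<le> \<zeta>" "\<zeta> < 1" and c: "c \<in> A" "a \<in> fst c"
    and V: "continuous_on M V" "V a \<noteq> 0"
    and t: "\<And>n. 0 < t n" "\<And>n. t n \<le> 1" "t \<longlonglongrightarrow> 0"
    and unif: "\<And>e. e > 0 \<Longrightarrow> \<forall>\<^sub>F n in sequentially. \<forall>b\<in>M. norm (\<xi> (t n) b /\<^sub>R t n - V b) \<le> e"
    and \<xi>: "\<And>n b. b \<in> M \<Longrightarrow> \<xi> (t n) b \<noteq> 0" "\<And>n b. b \<in> M \<Longrightarrow> norm (\<xi> (t n) b /\<^sub>R t n) \<le> C"
    and meas: "\<And>n. (\<lambda>b. cone_kernel \<xi> F \<zeta> (t n) a b) \<in> borel_measurable N"
    and \<Psi>: "continuous_on UNIV \<Psi>" "\<And>w. \<bar>\<Psi> w\<bar> \<le> R * (1 + (norm w)\<^sup>2)"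
  shows "(\<lambda>n. 1 / t n ^ CARD('m) * (\<integral>b. cone_kernel \<xi> F \<zeta> (t n) a b * \<Psi> ((F b - F a) /\<^sub>R t n) \<partial>N)) \<longlonglongrightarrow>
    coord_volume h c (snd c a) * (\<integral>x. exp (- cone_form \<zeta> (V a) (DF c (snd c a) x) (DF c (snd c a) x)) * \<Psi> (DF c (snd c a) x) \<partial>lborel)"
proof -
  interpret finite_measure N by (rule finite_measure_N)
  define y0 where "y0 = snd c a"
  define K where "K = (\<lambda>n b. cone_kernel \<xi> F \<zeta> (t n) a b)"
  define g where "g = (\<lambda>n b. K n b * \<Psi> ((F b - F a) /\<^sub>R t n))"
  define f where "f = F \<circ> chart_inv c"
  have a: "a \<in> M" using c chart_subset by blast
  have y0: "y0 \<in> chart_image c" "chart_inv c y0 = a" using c by (auto simp: y0_def)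
  have R: "R \<ge> 0" using \<Psi>(2)[of 0] abs_ge_zero[of "\<Psi> 0"] by simp
  have C: "C > 0" using \<xi>(2)[OF a, of 0] \<xi>(1)[OF a, of 0] t(1)[of 0] norm_ge_zero
    by (metis inverse_nonzero_iff_nonzero less_le_trans less_numeral_extra(3) scaleR_eq_0_iff zero_less_norm_iff)
  \<comment> \<open>Gaussian rate in the rescaled displacement: \<open>C\<close> bounds both
    rescaled velocities, and the angular part costs at most the factor
    \<open>1 - \<zeta>\<close>.\<close>
  define \<kappa> where "\<kappa> = (1 - \<zeta>) / C\<^sup>2"
  have \<kappa>: "\<kappa> > 0" using \<zeta> C by (simp add: \<kappa>_def)
  have K: "0 \<le> K n b" "K n b \<le> exp (- \<kappa> * (norm ((F b - F a) /\<^sub>R t n))\<^sup>2)" if b: "b \<in> M" for n b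
  proof -
    show "0 \<le> K n b" by (simp add: K_def cone_kernel_eq)
    let ?x = "\<xi> (t n) a /\<^sub>R t n" and ?y = "\<xi> (t n) b /\<^sub>R t n" and ?w = "(F b - F a) /\<^sub>R t n"
    have pos: "norm ?x * norm ?y > 0" using \<xi>(1)[OF a] \<xi>(1)[OF b] t(1)[of n] by simp
    have "norm ?x * norm ?y \<le> C\<^sup>2" unfolding power2_eq_square
      using \<xi>(2)[OF a, of n] \<xi>(2)[OF b, of n] C by (intro mult_mono) auto
    then have "(1 - \<zeta>) * ((norm ?w)\<^sup>2 / C\<^sup>2) \<le> (1 - \<zeta>) * ((norm ?w)\<^sup>2 / (norm ?x * norm ?y))"
      using pos C \<zeta> by (intro mult_left_mono divide_left_mono) auto
    also have "\<dots> \<le> cone_exponent \<zeta> ?x ?y ?w" by (rule cone_exponent_lower[OF \<zeta>])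
    also have "\<dots> = cone_exponent \<zeta> (\<xi> (t n) a) (\<xi> (t n) b) (F b - F a)" by (rule cone_exponent_scale[OF t(1)])
    finally show "K n b \<le> exp (- \<kappa> * (norm ?w)\<^sup>2)"
      unfolding K_def cone_kernel_eq exp_le_cancel_iff \<kappa>_def by simp
  qed
  have gbound: "\<bar>g n b\<bar> \<le> exp (- \<kappa> * (norm ((F b - F a) /\<^sub>R t n))\<^sup>2) * (R * (1 + (norm ((F b - F a) /\<^sub>R t n))\<^sup>2))"
    if "b \<in> M" for n b
    unfolding g_def abs_mult using K[OF that, of n] \<Psi>(2)[of "(F b - F a) /\<^sub>R t n"] by (intro mult_mono) auto
  have gmeas[measurable]: "g n \<in> borel_measurable N" for n
  proof -
    have "continuous_on M (\<lambda>b. \<Psi> ((F b - F a) /\<^sub>R t n))"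
      by (rule continuous_on_compose2[OF \<Psi>(1)]) (auto intro!: continuous_intros continuous_on_F)
    from measurable_continuous[OF this] meas[of n] show ?thesis
      unfolding g_def K_def by (rule borel_measurable_times[rotated])
  qed
  have fd: "(f has_derivative DF c y0) (at y0)" unfolding f_def by (rule DF_derivative[OF c(1) y0(1)])
  have lin: "linear (DF c y0)" by (rule DF_linear[OF c(1) y0(1)])
  obtain B where B: "B > 0" "\<And>x. B * norm x \<le> norm (DF c y0 x)"
    using linear_inj_bounded_below_pos[OF lin DF_inj[OF c(1) y0(1)]] by metis
  obtain B' where B': "B' > 0" "\<And>x. norm (DF c y0 x) \<le> B' * norm x"
    using linear_bounded_pos[OF lin] by metis
  have approx: "\<exists>d>0. \<forall>y. norm (y - y0) < d \<longrightarrow> norm (f y - f y0 - DF c y0 (y - y0)) \<le> e * norm (y - y0)" if "e > 0" for e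
    using fd that unfolding has_derivative_at_alt by blast
  \<comment> \<open>An error of half the lower bound \<open>B\<close> of the derivative keeps
    \<open>f\<close> bi-Lipschitz around \<open>y0\<close>. The lower estimate gives the Gaussian
    decay in \<open>x\<close>, the upper one controls the growth of \<Psi>.\<close>
  obtain d where d: "d > 0" "\<And>y. norm (y - y0) < d \<Longrightarrow> norm (f y - f y0 - DF c y0 (y - y0)) \<le> B / 2 * norm (y - y0)"
    using approx[of "B / 2"] B by auto
  obtain r0 where r0: "r0 > 0" "cball y0 r0 \<subseteq> chart_image c"
    using open_chart_image[OF c(1)] y0(1) by (meson open_contains_cball)
  define r where "r = min d r0"
  have r: "r > 0" "ball y0 r \<subseteq> chart_image c" "cball y0 r \<subseteq> chart_image c"
    using d r0 by (auto simp: r_def)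
  define L where "L = B' + B / 2"
  have two_sided: "B / 2 * norm (y - y0) \<le> norm (f y - f y0)" "norm (f y - f y0) \<le> L * norm (y - y0)"
    if "y \<in> ball y0 r" for y
  proof -
    have "norm (y - y0) < d" using that by (auto simp: r_def dist_norm norm_minus_commute)
    note * = d(2)[OF this] B(2)[of "y - y0"] B'(2)[of "y - y0"]
    have "norm (DF c y0 (y - y0)) \<le> norm (f y - f y0) + norm (f y - f y0 - DF c y0 (y - y0))"
      by (metis norm_triangle_sub norm_minus_commute)
    then show "B / 2 * norm (y - y0) \<le> norm (f y - f y0)" using * by (simp add: algebra_simps)
    have "norm (f y - f y0) \<le> norm (DF c y0 (y - y0)) + norm (f y - f y0 - DF c y0 (y - y0))"
      by (rule norm_triangle_sub)
    then show "norm (f y - f y0) \<le> L * norm (y - y0)" using * by (simp add: L_def algebra_simps)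
  qed
  define U where "U = fst c \<inter> snd c -` ball y0 r"
  have "openin (top_of_set (fst c)) U"
    unfolding U_def by (rule continuous_openin_preimage_gen[OF continuous_on_chart[OF c(1)] open_ball])
  then have U: "openin (top_of_set M) U" using openin_chart[OF c(1)] openin_trans by blast
  then have [measurable]: "U \<in> sets N" by (rule sets_openin)
  have "a \<in> U" using c r(1) by (simp add: U_def y0_def)
  have compl: "M - U \<in> sets N" using sets.compl_sets[OF \<open>U \<in> sets N\<close>] by (simp add: space_N)
  note [measurable] = compl
  \<comment> \<open>\<open>M - U\<close> is compact and \<open>F\<close> is injective, so the
    distance to \<open>F a\<close> has a positive minimum there; if \<open>M - U\<close> is empty,
    any positive number will do.\<close>
  obtain \<delta> where \<delta>: "\<delta> > 0" "\<And>b. b \<in> M - U \<Longrightarrow> \<delta> \<le> norm (F b - F a)"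
  proof (cases "M - U = {}")
    case False
    obtain T where "open T" "U = M \<inter> T" using U by (auto simp: openin_open)
    then have "M - U = M - T" by auto
    then have "compact (M - U)" using compact_diff[OF compact_M \<open>open T\<close>] by simp
    moreover have "continuous_on (M - U) (\<lambda>b. norm (F b - F a))"
      by (intro continuous_intros continuous_on_subset[OF continuous_on_F]) auto
    ultimately obtain b0 where b0: "b0 \<in> M - U" "\<And>b. b \<in> M - U \<Longrightarrow> norm (F b0 - F a) \<le> norm (F b - F a)"
      using continuous_attains_inf False by metis
    have "F b0 \<noteq> F a" using b0(1) \<open>a \<in> U\<close> a inj_F by (auto simp: inj_on_def)
    then show ?thesis using b0 by (intro that[of "norm (F b0 - F a)"]) auto
  qed (use that[of 1] in auto)
  have "compact ((\<lambda>b. F b - F a) ` M)"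
    by (intro compact_continuous_image continuous_intros continuous_on_F compact_M)
  from compact_imp_bounded[OF this]
  obtain D where D: "\<And>b. b \<in> M \<Longrightarrow> norm (F b - F a) \<le> D"
    unfolding bounded_iff by auto
  have "compact (coord_volume h c ` cball y0 r)"
    by (rule compact_continuous_image[OF continuous_on_subset[OF continuous_on_coord_volume[OF metric c(1)] r(3)] compact_cball])
  from compact_imp_bounded[OF this]
  obtain Vm where Vm: "\<And>y. y \<in> cball y0 r \<Longrightarrow> \<bar>coord_volume h c y\<bar> \<le> Vm"
    unfolding bounded_iff ball_simps real_norm_def by blast
  have Vm0: "Vm \<ge> 0" using Vm[of y0] r(1) by auto
  have gint: "integrable N (g n)" for n
  proof (rule integrable_const_bound[where B="R * (1 + (norm (inverse (t n)) * D)\<^sup>2)"])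
    show "AE b in N. norm (g n b) \<le> R * (1 + (norm (inverse (t n)) * D)\<^sup>2)"
    proof (rule AE_I2)
      fix b assume "b \<in> space N"
      then have b: "b \<in> M" by (simp add: space_N)
      have "norm ((F b - F a) /\<^sub>R t n) \<le> norm (inverse (t n)) * D"
        using D[OF b] by (simp add: mult_left_mono)
      then have "(norm ((F b - F a) /\<^sub>R t n))\<^sup>2 \<le> (norm (inverse (t n)) * D)\<^sup>2" by (intro power_mono) auto
      have "\<bar>g n b\<bar> \<le> 1 * (R * (1 + (norm (inverse (t n)) * D)\<^sup>2))"
      proof (rule order_trans[OF gbound[OF b] mult_mono])
        show "exp (- \<kappa> * (norm ((F b - F a) /\<^sub>R t n))\<^sup>2) \<le> 1" using \<kappa> by simp
        show "R * (1 + (norm ((F b - F a) /\<^sub>R t n))\<^sup>2) \<le> R * (1 + (norm (inverse (t n)) * D)\<^sup>2)"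
          using R \<open>(norm ((F b - F a) /\<^sub>R t n))\<^sup>2 \<le> _\<close> by (intro mult_left_mono) auto
      qed (use R in auto)
      then show "norm (g n b) \<le> R * (1 + (norm (inverse (t n)) * D)\<^sup>2)" by simp
    qed
  qed simp
  have split: "(\<integral>b. g n b \<partial>N) = (\<integral>b. indicator U b * g n b \<partial>N) + (\<integral>b. indicator (M - U) b * g n b \<partial>N)" for n
  proof -
    have "integrable N (\<lambda>b. indicator U b *\<^sub>R g n b)" "integrable N (\<lambda>b. indicator (M - U) b *\<^sub>R g n b)"
      by (rule integrable_mult_indicator[OF \<open>U \<in> sets N\<close> gint] integrable_mult_indicator[OF compl gint])+
    then have "(\<integral>b. indicator U b * g n b \<partial>N) + (\<integral>b. indicator (M - U) b * g n b \<partial>N) = (\<integral>b. indicator U b * g n b + indicator (M - U) b * g n b \<partial>N)"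
      by simp
    also have "\<dots> = (\<integral>b. g n b \<partial>N)"
      by (intro Bochner_Integration.integral_cong) (auto simp: space_N split: split_indicator)
    finally show ?thesis by simp
  qed
  have far: "(\<lambda>n. 1 / t n ^ CARD('m) * (\<integral>b. indicator (M - U) b * g n b \<partial>N)) \<longlonglongrightarrow> 0"
  proof (rule Lim_null_comparison)
    have "(\<lambda>n. 1 / t n ^ CARD('m) * (exp (- (\<kappa> * \<delta>\<^sup>2) / (t n)\<^sup>2) * (1 + D\<^sup>2 / (t n)\<^sup>2))) \<longlonglongrightarrow> 0"
      using \<kappa> \<delta>(1) by (intro gaussian_beats_inverse_power t) auto
    then show "(\<lambda>n. R * measure N M * (1 / t n ^ CARD('m) * (exp (- (\<kappa> * \<delta>\<^sup>2) / (t n)\<^sup>2) * (1 + D\<^sup>2 / (t n)\<^sup>2)))) \<longlonglongrightarrow> 0"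
      by (rule tendsto_mult_right_zero)
    show "\<forall>\<^sub>F n in sequentially. norm (1 / t n ^ CARD('m) * (\<integral>b. indicator (M - U) b * g n b \<partial>N)) \<le>
        R * measure N M * (1 / t n ^ CARD('m) * (exp (- (\<kappa> * \<delta>\<^sup>2) / (t n)\<^sup>2) * (1 + D\<^sup>2 / (t n)\<^sup>2)))"
    proof (intro always_eventually allI)
      fix n
      let ?E = "exp (- (\<kappa> * \<delta>\<^sup>2) / (t n)\<^sup>2) * (R * (1 + D\<^sup>2 / (t n)\<^sup>2))"
      have bd: "norm (indicator (M - U) b * g n b) \<le> ?E" if b: "b \<in> M" for b
      proof (cases "b \<in> U")
        case False
        have nrm: "(norm ((F b - F a) /\<^sub>R t n))\<^sup>2 = (norm (F b - F a))\<^sup>2 / (t n)\<^sup>2"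
          using t(1)[of n] by (simp add: power_mult_distrib divide_inverse power_inverse mult.commute)
        have "\<delta>\<^sup>2 \<le> (norm (F b - F a))\<^sup>2" "(norm (F b - F a))\<^sup>2 \<le> D\<^sup>2"
          using \<delta> D[OF b] b False by (auto intro!: power_mono)
        then have "\<kappa> * \<delta>\<^sup>2 / (t n)\<^sup>2 \<le> \<kappa> * ((norm (F b - F a))\<^sup>2 / (t n)\<^sup>2)"
          "(norm (F b - F a))\<^sup>2 / (t n)\<^sup>2 \<le> D\<^sup>2 / (t n)\<^sup>2"
          using \<kappa> by (auto intro!: divide_right_mono)
        then have "\<bar>g n b\<bar> \<le> ?E"
          using R by (intro order_trans[OF gbound[OF b, of n, unfolded nrm]] mult_mono mult_left_mono) auto
        then show ?thesis using b False by simp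
      qed (use R in simp)
      have "\<bar>\<integral>b. indicator (M - U) b * g n b \<partial>N\<bar> \<le> (\<integral>b. ?E \<partial>N)"
      proof (rule order_trans[OF integral_abs_bound integral_mono])
        have "integrable N (\<lambda>b. indicator (M - U) b *\<^sub>R g n b)"
          by (rule integrable_mult_indicator[OF compl gint])
        then show "integrable N (\<lambda>b. \<bar>indicator (M - U) b * g n b\<bar>)" by simp
      qed (use bd in \<open>auto simp: space_N\<close>)
      also have "(\<integral>b. ?E \<partial>N) = measure N M * ?E" by (simp add: space_N)
      finally have "1 / t n ^ CARD('m) * \<bar>\<integral>b. indicator (M - U) b * g n b \<partial>N\<bar> \<le> 1 / t n ^ CARD('m) * (measure N M * ?E)"
        using t(1)[of n] by (intro mult_left_mono) auto
      then show "norm (1 / t n ^ CARD('m) * (\<integral>b. indicator (M - U) b * g n b \<partial>N)) \<le>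
        R * measure N M * (1 / t n ^ CARD('m) * (exp (- (\<kappa> * \<delta>\<^sup>2) / (t n)\<^sup>2) * (1 + D\<^sup>2 / (t n)\<^sup>2)))"
        using t(1)[of n] by (simp add: abs_mult mult_ac)
    qed
  qed
  \<comment> \<open>The chart integrand extended by 0 outside the ball, so that after the dilation
    all integrals run over the whole space.\<close>
  define H where "H = (\<lambda>n y. indicator (ball y0 r) y * (coord_volume h c y * g n (chart_inv c y)))"
  have H_eq: "indicator (chart_image c) y * (coord_volume h c y * (indicator U (chart_inv c y) * g n (chart_inv c y))) = H n y" for n y
  proof (cases "y \<in> chart_image c")
    case True
    then have "chart_inv c y \<in> U \<longleftrightarrow> y \<in> ball y0 r" by (auto simp: U_def)
    then show ?thesis using True by (simp add: H_def indicator_def)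
  next
    case False
    then show ?thesis using r(2) by (auto simp: H_def indicator_def)
  qed
  have Hmeas[measurable]: "H n \<in> borel_measurable borel" for n
    using measurable_in_chart[OF c(1), of "\<lambda>b. indicator U b * g n b"] unfolding H_eq by simp
  have near_eq: "1 / t n ^ CARD('m) * (\<integral>b. indicator U b * g n b \<partial>N) = (\<integral>x. H n (y0 + t n *\<^sub>R x) \<partial>lborel)" for n
  proof -
    have "(\<integral>b. indicator U b * g n b \<partial>N) = (\<integral>b. indicator (fst c) b * (indicator U b * g n b) \<partial>N)"
      by (intro Bochner_Integration.integral_cong) (auto simp: U_def split: split_indicator)
    also have "\<dots> = (\<integral>y. H n y \<partial>lborel)"
      by (subst integral_chart[OF c(1)]) (auto simp: H_eq)
    also have "\<dots> = t n ^ CARD('m) * (\<integral>x. H n (y0 + t n *\<^sub>R x) \<partial>lborel)"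
      using lborel_integral_affine[OF Hmeas t(1), of n n y0] by simp
    finally show ?thesis using t(1)[of n] by simp
  qed
  define l where "l = (\<lambda>x. coord_volume h c y0 * (exp (- cone_form \<zeta> (V a) (DF c y0 x) (DF c y0 x)) * \<Psi> (DF c y0 x)))"
  have pointwise: "(\<lambda>n. H n (y0 + t n *\<^sub>R x)) \<longlonglongrightarrow> l x" for x
  proof -
    define y where "y = (\<lambda>n. y0 + t n *\<^sub>R x)"
    have ylim: "y \<longlonglongrightarrow> y0"
      unfolding y_def using tendsto_add[OF tendsto_const tendsto_scaleR[OF t(3) tendsto_const]] by auto
    then have yev: "\<forall>\<^sub>F n in sequentially. y n \<in> ball y0 r"
      using r(1) by (intro topological_tendstoD) auto
    have img: "\<forall>\<^sub>F n in sequentially. y n \<in> chart_image c"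
      using yev by eventually_elim (use r(2) in blast)
    have along: "(\<lambda>n. q (y n)) \<longlonglongrightarrow> q y0" if "continuous_on (chart_image c) q" for q :: "real ^ 'm \<Rightarrow> 'z::topological_space"
      using that open_chart_image[OF c(1)] y0(1) ylim
      by (metis continuous_on_eq_continuous_at isCont_tendsto_compose)
    have volume: "(\<lambda>n. coord_volume h c (y n)) \<longlonglongrightarrow> coord_volume h c y0"
      by (rule along[OF continuous_on_coord_volume[OF metric c(1)]])
    have w: "(\<lambda>n. (f (y n) - f y0) /\<^sub>R t n) \<longlonglongrightarrow> DF c y0 x"
    proof (rule metric_LIMSEQ_I)
      fix e :: real assume e: "e > 0"
      define e' where "e' = e / (norm x + 1)"
      have e': "e' > 0" "e' * norm x < e" using e by (auto simp: e'_def field_simps add_pos_nonneg)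
      from approx[OF e'(1)] obtain d where d: "d > 0" "\<And>y. norm (y - y0) < d \<Longrightarrow> norm (f y - f y0 - DF c y0 (y - y0)) \<le> e' * norm (y - y0)"
        by blast
      have "\<forall>\<^sub>F n in sequentially. dist (y n) y0 < d" using ylim d(1) by (rule tendstoD)
      then have "\<forall>\<^sub>F n in sequentially. dist ((f (y n) - f y0) /\<^sub>R t n) (DF c y0 x) < e"
      proof eventually_elim
        case (elim n)
        have "DF c y0 (y n - y0) = t n *\<^sub>R DF c y0 x" using lin by (simp add: y_def linear_scale)
        then have "(f (y n) - f y0) /\<^sub>R t n - DF c y0 x = (f (y n) - f y0 - DF c y0 (y n - y0)) /\<^sub>R t n"
          using t(1)[of n] by (simp add: scaleR_diff_right)
        then have "dist ((f (y n) - f y0) /\<^sub>R t n) (DF c y0 x) = norm (f (y n) - f y0 - DF c y0 (y n - y0)) / t n"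
          using t(1)[of n] by (simp add: dist_norm divide_inverse mult.commute)
        also have "\<dots> \<le> e' * norm (y n - y0) / t n"
          using d(2)[of "y n"] elim t(1)[of n] by (intro divide_right_mono) (auto simp: dist_norm)
        also have "\<dots> = e' * norm x" using t(1)[of n] by (simp add: y_def)
        finally show ?case using e'(2) by simp
      qed
      then show "\<exists>no. \<forall>n\<ge>no. dist ((f (y n) - f y0) /\<^sub>R t n) (DF c y0 x) < e"
        by (simp add: eventually_sequentially)
    qed
    have \<xi>a: "(\<lambda>n. \<xi> (t n) a /\<^sub>R t n) \<longlonglongrightarrow> V a"
    proof (rule Lim_null[THEN iffD2, OF tendsto_norm_zero_cancel, OF tendstoI])
      fix e :: real assume "e > 0"
      then have "e / 2 > 0" by simp
      from unif[OF this] show "\<forall>\<^sub>F n in sequentially. dist (norm (\<xi> (t n) a /\<^sub>R t n - V a)) 0 < e"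
        by eventually_elim (use a \<open>e > 0\<close> in force)
    qed
    \<comment> \<open>Here the base point moves with n, so convergence at a single point is not
      enough: uniform convergence on \<open>M\<close> is combined with continuity of
      \<open>V\<close>.\<close>
    have \<xi>b: "(\<lambda>n. \<xi> (t n) (chart_inv c (y n)) /\<^sub>R t n) \<longlonglongrightarrow> V a"
    proof -
      have 1: "(\<lambda>n. V (chart_inv c (y n))) \<longlonglongrightarrow> V a"
        using along[OF continuous_on_comp_chart_inv[OF c(1) V(1)]] y0(2) by simp
      have "(\<lambda>n. \<xi> (t n) (chart_inv c (y n)) /\<^sub>R t n - V (chart_inv c (y n))) \<longlonglongrightarrow> 0"
      proof (rule tendsto_norm_zero_cancel, rule tendstoI)
        fix e :: real assume "e > 0"
        then have "e / 2 > 0" by simp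
        from unif[OF this] img show "\<forall>\<^sub>F n in sequentially. dist (norm (\<xi> (t n) (chart_inv c (y n)) /\<^sub>R t n - V (chart_inv c (y n)))) 0 < e"
        proof eventually_elim
          case (elim n)
          then have "norm (\<xi> (t n) (chart_inv c (y n)) /\<^sub>R t n - V (chart_inv c (y n))) \<le> e / 2" using c(1) by simp
          then show ?case using \<open>e > 0\<close> by simp
        qed
      qed
      from tendsto_add[OF this 1] show ?thesis by simp
    qed
    have "(\<lambda>n. K n (chart_inv c (y n))) \<longlonglongrightarrow> exp (- cone_form \<zeta> (V a) (DF c y0 x) (DF c y0 x))"
    proof -
      have "K n (chart_inv c (y n)) = exp (- cone_exponent \<zeta> (\<xi> (t n) a /\<^sub>R t n) (\<xi> (t n) (chart_inv c (y n)) /\<^sub>R t n) ((f (y n) - f y0) /\<^sub>R t n))" for n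
        unfolding K_def cone_kernel_eq cone_exponent_scale[OF t(1)] f_def comp_def y0(2) ..
      then show ?thesis
        using tendsto_cone_exponent[OF \<zeta> \<xi>a \<xi>b w V(2)] by (simp add: tendsto_exp tendsto_minus)
    qed
    moreover have "(\<lambda>n. \<Psi> ((F (chart_inv c (y n)) - F a) /\<^sub>R t n)) \<longlonglongrightarrow> \<Psi> (DF c y0 x)"
      using w \<Psi>(1) y0(2) unfolding f_def by (auto simp: continuous_on_eq_continuous_at intro: isCont_tendsto_compose)
    ultimately have "(\<lambda>n. coord_volume h c (y n) * g n (chart_inv c (y n))) \<longlonglongrightarrow> l x"
      unfolding l_def g_def by (intro tendsto_mult volume)
    moreover have "\<forall>\<^sub>F n in sequentially. coord_volume h c (y n) * g n (chart_inv c (y n)) = H n (y n)"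
      using yev by eventually_elim (simp add: H_def)
    ultimately show ?thesis unfolding y_def by (rule Lim_transform_eventually)
  qed
  \<comment> \<open>Decay rate in \<open>x\<close>: the rescaled displacement has norm at least
    \<open>B / 2 * norm x\<close>.\<close>
  define k where "k = \<kappa> * (B / 2)\<^sup>2"
  have k: "k > 0" using \<kappa> B by (simp add: k_def)
  have Hbound: "\<bar>H n (y0 + t n *\<^sub>R x)\<bar> \<le> Vm * (exp (- k * (norm x)\<^sup>2) * (R * (1 + L\<^sup>2 * (norm x)\<^sup>2)))" for n x
  proof (cases "y0 + t n *\<^sub>R x \<in> ball y0 r")
    case True
    let ?y = "y0 + t n *\<^sub>R x"
    let ?w = "(f ?y - f y0) /\<^sub>R t n"
    have y: "?y \<in> chart_image c" using True r(2) by blast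
    have nw: "norm ?w = norm (f ?y - f y0) / t n" using t(1)[of n] by (simp add: divide_inverse mult.commute)
    have lo: "B / 2 * norm x \<le> norm ?w" and hi: "norm ?w \<le> L * norm x"
      using two_sided[OF True] t(1)[of n] unfolding nw by (simp_all add: field_simps)
    have "\<bar>g n (chart_inv c ?y)\<bar> \<le> exp (- \<kappa> * (norm ?w)\<^sup>2) * (R * (1 + (norm ?w)\<^sup>2))"
      using gbound[of "chart_inv c ?y" n] c(1) y y0(2) by (simp add: f_def)
    also have "\<dots> \<le> exp (- k * (norm x)\<^sup>2) * (R * (1 + L\<^sup>2 * (norm x)\<^sup>2))"
    proof (intro mult_mono mult_left_mono add_left_mono)
      have "(B / 2 * norm x)\<^sup>2 \<le> (norm ?w)\<^sup>2" using lo B(1) by (intro power_mono) auto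
      then have "\<kappa> * (B / 2 * norm x)\<^sup>2 \<le> \<kappa> * (norm ?w)\<^sup>2" using \<kappa> by (intro mult_left_mono) auto
      then show "exp (- \<kappa> * (norm ?w)\<^sup>2) \<le> exp (- k * (norm x)\<^sup>2)"
        unfolding exp_le_cancel_iff k_def power_mult_distrib by (simp add: mult.assoc)
      show "(norm ?w)\<^sup>2 \<le> L\<^sup>2 * (norm x)\<^sup>2"
        using power_mono[OF hi norm_ge_zero, of 2] by (simp only: power_mult_distrib)
    qed (use R in auto)
    finally have "\<bar>g n (chart_inv c ?y)\<bar> \<le> exp (- k * (norm x)\<^sup>2) * (R * (1 + L\<^sup>2 * (norm x)\<^sup>2))" .
    moreover have "\<bar>coord_volume h c ?y\<bar> \<le> Vm" using Vm True by simp
    ultimately show ?thesis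
      unfolding H_def using True Vm0 by (simp add: abs_mult mult_mono)
  next
    case False
    have "0 \<le> Vm * (exp (- k * (norm x)\<^sup>2) * (R * (1 + L\<^sup>2 * (norm x)\<^sup>2)))"
      using Vm0 R by (intro mult_nonneg_nonneg add_nonneg_nonneg) auto
    then show ?thesis using False by (simp add: H_def)
  qed
  have dom: "integrable lborel (\<lambda>x::real ^ 'm. Vm * (exp (- k * (norm x)\<^sup>2) * (R * (1 + L\<^sup>2 * (norm x)\<^sup>2))))"
  proof -
    obtain Q where Q: "Q \<ge> 0" "\<And>r. r \<ge> 0 \<Longrightarrow> r\<^sup>2 * exp (0 * r) * exp (- k * r\<^sup>2) \<le> Q * exp (- (k / 2) * r\<^sup>2)"
      using gaussian_absorbs[OF k, of 0] by metis
    have "integrable lborel (\<lambda>x::real ^ 'm. Q * exp (- (k / 2) * (norm x)\<^sup>2))"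
      using k by (intro integrable_mult_right integrable_gaussian) simp
    then have "integrable lborel (\<lambda>x::real ^ 'm. (norm x)\<^sup>2 * exp (- k * (norm x)\<^sup>2))"
      by (rule Bochner_Integration.integrable_bound) (use Q in \<open>auto intro!: AE_I2 order_trans[OF _ abs_ge_self]\<close>)
    then have "integrable lborel (\<lambda>x::real ^ 'm. (Vm * R) * exp (- k * (norm x)\<^sup>2) + (Vm * R * L\<^sup>2) * ((norm x)\<^sup>2 * exp (- k * (norm x)\<^sup>2)))"
      using k by (intro Bochner_Integration.integrable_add integrable_mult_right integrable_gaussian)
    then show ?thesis by (simp add: algebra_simps)
  qed
  have "(\<lambda>n. \<integral>x. H n (y0 + t n *\<^sub>R x) \<partial>lborel) \<longlonglongrightarrow> (\<integral>x. l x \<partial>lborel)"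
  proof (rule integral_dominated_convergence[OF _ _ dom])
    show "l \<in> borel_measurable lborel"
      by (rule borel_measurable_LIMSEQ_metric[where f="\<lambda>n x. H n (y0 + t n *\<^sub>R x)"]) (auto intro: pointwise)
  qed (use Hbound pointwise in auto)
  then have "(\<lambda>n. 1 / t n ^ CARD('m) * (\<integral>b. indicator U b * g n b \<partial>N)) \<longlonglongrightarrow> (\<integral>x. l x \<partial>lborel)"
    by (simp only: near_eq)
  from tendsto_add[OF this far]
  have "(\<lambda>n. 1 / t n ^ CARD('m) * (\<integral>b. g n b \<partial>N)) \<longlonglongrightarrow> (\<integral>x. l x \<partial>lborel)"
    unfolding split by (simp add: distrib_left)
  then show ?thesis unfolding g_def K_def l_def y0_def by simp
qed

end

section \<open>The induced metric\<close>

text \<open>Dominated convergence needs a sequence, and the kernel is under control only for small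
  intervals; all members are chosen within that range.\<close>

lemma obtain_null_sequence:
  assumes "eventually P (at_right (0::real))"
  obtains t :: "nat \<Rightarrow> real" where "\<And>n. 0 < t n" "\<And>n. t n \<le> 1" "t \<longlonglongrightarrow> 0" "\<And>n. P (t n)"
    "filterlim t (at_right 0) sequentially"
proof -
  obtain b where b: "b > 0" "\<And>y. 0 < y \<Longrightarrow> y < b \<Longrightarrow> P y"
    using assms unfolding eventually_at_right_field by blast
  define t where "t = (\<lambda>n. min b 1 / (real n + 2))"
  have pos: "0 < t n" for n using b by (simp add: t_def)
  have less: "t n < min b 1" for n
  proof -
    have "min b 1 * 1 < min b 1 * (real n + 2)" using b by (intro mult_strict_left_mono) auto
    then show ?thesis unfolding t_def by (subst divide_less_eq) (simp add: add_pos_pos)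
  qed
  have lim: "t \<longlonglongrightarrow> 0"
  proof -
    have "(\<lambda>n. min b 1 * (1 / real (n + 2))) \<longlonglongrightarrow> 0"
      by (intro tendsto_mult_right_zero LIMSEQ_ignore_initial_segment lim_1_over_n)
    then show ?thesis by (simp add: t_def add.commute)
  qed
  show ?thesis
  proof (rule that[of t])
    show "t n \<le> 1" "P (t n)" for n using less[of n] pos[of n] b(2) by auto
    show "filterlim t (at_right 0) sequentially"
      using lim pos by (simp add: filterlim_at less_imp_neq[symmetric])
  qed (fact pos lim)+
qed

lemma integral_exp_pos:
  fixes q :: "'e::euclidean_space \<Rightarrow> real"
  assumes "integrable lborel (\<lambda>x. exp (q x))" shows "(\<integral>x. exp (q x) \<partial>lborel) > 0"
proof -
  have "(\<integral>x. exp (q x) \<partial>lborel) \<noteq> 0"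
  proof
    assume "(\<integral>x. exp (q x) \<partial>lborel) = 0"
    then have "AE x in lborel. exp (q x) = 0"
      using integral_nonneg_eq_0_iff_AE[OF assms] by simp
    then have "AE x in (lborel :: 'e measure). False" by simp
    then have "emeasure lborel (UNIV :: 'e set) = 0"
      using AE_iff_measurable[of UNIV "lborel :: 'e measure" "\<lambda>_. False"] by simp
    then show False by simp
  qed
  moreover have "(\<integral>x. exp (q x) \<partial>lborel) \<ge> 0" by (intro integral_nonneg_AE) simp
  ultimately show ?thesis by argo
qed

context manifold_with_flow
begin

definition cone_coord_form :: "real \<Rightarrow> ('a, 'm) chart \<Rightarrow> real ^ 'm \<Rightarrow> real ^ 'm \<Rightarrow> real ^ 'm \<Rightarrow> real" where
  "cone_coord_form \<zeta> c y x x' = cone_form \<zeta> (velocity (chart_inv c y)) (DF c y x) (DF c y x')"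

lemma cone_coord_form_bound:
  assumes \<zeta>: "0 \<le> \<zeta>" "\<zeta> < 1" and c: "c \<in> A" "y \<in> chart_image c"
  obtains k where "k > 0" "\<And>x. k * (norm x)\<^sup>2 \<le> cone_coord_form \<zeta> c y x x"
proof -
  let ?V = "velocity (chart_inv c y)"
  have V: "?V \<noteq> 0" using c by (intro velocity_nonzero) simp
  obtain B where B: "B > 0" "\<And>x. B * norm x \<le> norm (DF c y x)"
    using linear_inj_bounded_below_pos[OF DF_linear[OF c] DF_inj[OF c]] by metis
  show ?thesis
  proof (rule that[of "(1 - \<zeta>) * (B\<^sup>2 / (norm ?V)\<^sup>2)"])
    show "(1 - \<zeta>) * (B\<^sup>2 / (norm ?V)\<^sup>2) > 0" using \<zeta> V B by simp
    fix x
    have "(B * norm x)\<^sup>2 \<le> (norm (DF c y x))\<^sup>2" using B by (intro power_mono) auto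
    then have "(1 - \<zeta>) * ((B * norm x)\<^sup>2 / (norm ?V)\<^sup>2) \<le> (1 - \<zeta>) * ((norm (DF c y x))\<^sup>2 / (norm ?V)\<^sup>2)"
      using \<zeta> by (intro mult_left_mono divide_right_mono) auto
    also have "\<dots> \<le> cone_coord_form \<zeta> c y x x" unfolding cone_coord_form_def by (rule cone_form_lower[OF \<zeta>])
    finally show "(1 - \<zeta>) * (B\<^sup>2 / (norm ?V)\<^sup>2) * (norm x)\<^sup>2 \<le> cone_coord_form \<zeta> c y x x"
      by (simp add: power_mult_distrib)
  qed
qed

lemma pos_def_cone_coord_form:
  assumes \<zeta>: "0 \<le> \<zeta>" "\<zeta> < 1" and c: "c \<in> A" "y \<in> chart_image c"
  shows "pos_def_form (cone_coord_form \<zeta> c y)"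
  unfolding pos_def_form_def
proof (intro conjI allI impI)
  have lin: "DF c y (x + x') = DF c y x + DF c y x'" "DF c y (r *\<^sub>R x) = r *\<^sub>R DF c y x" for x x' r
    using DF_linear[OF c] by (auto simp: linear_iff)
  show "bilinear (cone_coord_form \<zeta> c y)"
    unfolding bilinear_def cone_coord_form_def cone_form_def linear_iff
    by (auto simp: lin inner_simps add_divide_distrib algebra_simps)
  show "cone_coord_form \<zeta> c y x x' = cone_coord_form \<zeta> c y x' x" for x x'
    unfolding cone_coord_form_def cone_form_def by (simp add: inner_commute mult.commute)
  fix x :: "real ^ 'm" assume "x \<noteq> 0"
  moreover obtain k where "k > 0" "\<And>x. k * (norm x)\<^sup>2 \<le> cone_coord_form \<zeta> c y x x"
    using cone_coord_form_bound[OF assms] by metis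
  ultimately show "0 < cone_coord_form \<zeta> c y x x"
    by (meson less_le_trans mult_pos_pos zero_less_norm_iff zero_less_power)
qed

text \<open>The combination is, for each interval, exactly minus the kernel average of
  \<open>((f - f a) / dt)\<^sup>2\<close> with \<open>f = F \<bullet> e\<close>. Numerator and
  normalization have limits with the same coordinate volume, which cancels, and the quotient is a
  Gaussian second moment. As \<open>u\<close> represents the differential of \<open>f\<close> in the
  cone form, \<open>DF c (snd c a) u \<bullet> e\<close> is the inverse form at that
  differential.\<close>

lemma carre_du_champ_limit:
  assumes \<zeta>: "0 \<le> \<zeta>" "\<zeta> < 1" and J: "finite J"
    and w: "(\<Sum>j\<in>J. w j) = 0" "(\<Sum>j\<in>J. w j * of_int j) = 1"
    and mu: "volume_measure M A (ambient_metric F) \<mu>"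
    and lim: "\<And>f. C2_fun A f \<Longrightarrow>
      ((\<lambda>dt. diffusion_L CARD('m) \<mu> (cone_kernel (fd_velocity J w \<Phi> F) F \<zeta>) dt f a) \<longlongrightarrow> L f) (at_right 0)"
    and c: "c \<in> A" "a \<in> fst c"
    and u: "\<And>x. cone_coord_form \<zeta> c (snd c a) u x = DF c (snd c a) x \<bullet> e"
  shows "L (\<lambda>b. (F b \<bullet> e) * (F b \<bullet> e)) - 2 * (F a \<bullet> e) * L (\<lambda>b. F b \<bullet> e) = - (DF c (snd c a) u \<bullet> e) / 2"
proof -
  interpret g: manifold_with_volume M A F "ambient_metric F" \<mu>
    by unfold_locales (rule riemannian_metric_ambient, rule mu)
  define \<xi> where "\<xi> = fd_velocity J w \<Phi> F"
  define K where "K = cone_kernel \<xi> F \<zeta>"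
  let ?y = "snd c a"
  let ?B = "cone_coord_form \<zeta> c ?y"
  have y: "?y \<in> chart_image c" "chart_inv c ?y = a" using c by auto
  have a: "a \<in> M" using c chart_subset by blast
  \<comment> \<open>A kernel without integrable section at \<open>a\<close> has integral 0, so that \<open>diffusion_L\<close> maps 1 to
    \<open>1 / t\<^sup>2\<close>; this is excluded by convergence for \<open>f = 1\<close>.\<close>
  have kernel_integrable: "\<forall>\<^sub>F t in at_right 0. integrable \<mu> (K t a) \<and> (\<integral>b. K t a b \<partial>\<mu>) \<noteq> 0"
  proof -
    have one: "C2_fun A (\<lambda>_. 1 :: real)" by (rule C2_fun_const)
    have "((\<lambda>t. t\<^sup>2 * diffusion_L CARD('m) \<mu> K t (\<lambda>_. 1) a) \<longlongrightarrow> 0\<^sup>2 * L (\<lambda>_. 1)) (at_right 0)"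
      using lim[OF one] unfolding K_def \<xi>_def by (intro tendsto_intros)
    then have "\<forall>\<^sub>F t in at_right 0. t\<^sup>2 * diffusion_L CARD('m) \<mu> K t (\<lambda>_. 1) a < 1"
      by (rule order_tendstoD(2)) simp
    moreover have "\<forall>\<^sub>F t in at_right 0. (0::real) < t" by (rule eventually_at_right_less)
    ultimately show ?thesis
    proof eventually_elim
      case (elim t)
      have "(\<integral>b. K t a b \<partial>\<mu>) \<noteq> 0"
      proof
        assume "(\<integral>b. K t a b \<partial>\<mu>) = 0"
        then have "diffusion_L CARD('m) \<mu> K t (\<lambda>_. 1) a = 1 / t\<^sup>2"
          by (simp add: diffusion_L_def diffusion_P_def diffusion_H_def)
        then show False using elim by simp
      qed
      moreover from this have "integrable \<mu> (K t a)"
        using not_integrable_integral_eq by blast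
      ultimately show ?case by simp
    qed
  qed
  have cn: "continuous_on M (\<lambda>b. norm (velocity b))" by (intro continuous_intros continuous_on_velocity)
  obtain b0 where b0: "b0 \<in> M" "\<And>b. b \<in> M \<Longrightarrow> norm (velocity b0) \<le> norm (velocity b)"
    using continuous_attains_inf[OF compact_M _ cn] a by blast
  \<comment> \<open>Half the minimal speed: velocities within \<epsilon> of the true ones cannot
    vanish.\<close>
  define \<epsilon> where "\<epsilon> = norm (velocity b0) / 2"
  have \<epsilon>: "\<epsilon> > 0" using velocity_nonzero[OF b0(1)] by (simp add: \<epsilon>_def)
  obtain Bv where Bv: "\<And>b. b \<in> M \<Longrightarrow> norm (velocity b) \<le> Bv" using velocity_bound by metis
  have "\<forall>\<^sub>F t in at_right 0. (\<forall>b\<in>M. norm (\<xi> t b /\<^sub>R t - velocity b) \<le> \<epsilon>) \<and>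
      (integrable \<mu> (K t a) \<and> (\<integral>b. K t a b \<partial>\<mu>) \<noteq> 0)"
    using fd_velocity_uniform_limit[OF J w \<epsilon>] kernel_integrable unfolding \<xi>_def by (rule eventually_conj)
  then obtain t where t: "\<And>n. 0 < t n" "\<And>n. t n \<le> 1" "t \<longlonglongrightarrow> 0" "filterlim t (at_right 0) sequentially"
    and \<xi>: "\<And>n b. b \<in> M \<Longrightarrow> norm (\<xi> (t n) b /\<^sub>R t n - velocity b) \<le> \<epsilon>"
    and K: "\<And>n. integrable \<mu> (K (t n) a)" "\<And>n. (\<integral>b. K (t n) a b \<partial>\<mu>) \<noteq> 0"
    by (rule obtain_null_sequence) blast
  define \<Psi> where "\<Psi> = (\<lambda>w. (w \<bullet> e)\<^sup>2)"
  have limit: "(\<lambda>n. 1 / t n ^ CARD('m) * (\<integral>b. K (t n) a b * \<Psi> ((F b - F a) /\<^sub>R t n) \<partial>\<mu>)) \<longlonglongrightarrow>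
      coord_volume (ambient_metric F) c ?y * (\<integral>x. exp (- ?B x x) * \<Psi> (DF c ?y x) \<partial>lborel)"
    if "continuous_on UNIV \<Psi>" "\<And>w. \<bar>\<Psi> w\<bar> \<le> R * (1 + (norm w)\<^sup>2)" for \<Psi> R
    unfolding K_def cone_coord_form_def y(2)
  proof (rule g.kernel_integral_limit[OF \<zeta> c continuous_on_velocity velocity_nonzero[OF a] t(1-3) _ _ _ _ that, where C="Bv + \<epsilon>"])
    show "\<forall>\<^sub>F n in sequentially. \<forall>b\<in>M. norm (\<xi> (t n) b /\<^sub>R t n - velocity b) \<le> \<epsilon>" if "\<epsilon> > 0" for \<epsilon>
      using t(4) fd_velocity_uniform_limit[OF J w that] unfolding \<xi>_def filterlim_iff by blast
    fix n b assume b: "b \<in> M"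
    have "norm (velocity b) \<ge> 2 * \<epsilon>" using b0(2)[OF b] by (simp add: \<epsilon>_def)
    then show "\<xi> (t n) b \<noteq> 0" using \<xi>[OF b, of n] \<epsilon> by auto
    show "norm (\<xi> (t n) b /\<^sub>R t n) \<le> Bv + \<epsilon>"
      using \<xi>[OF b, of n] Bv[OF b] norm_triangle_sub[of "\<xi> (t n) b /\<^sub>R t n" "velocity b"] by simp
  next
    show "(\<lambda>b. cone_kernel \<xi> F \<zeta> (t n) a b) \<in> borel_measurable \<mu>" for n
      using K(1)[of n] unfolding K_def by (rule borel_measurable_integrable)
  qed
  have "(\<lambda>n. 1 / t n ^ CARD('m) * (\<integral>b. K (t n) a b * 1 \<partial>\<mu>)) \<longlonglongrightarrow>
      coord_volume (ambient_metric F) c ?y * (\<integral>x. exp (- ?B x x) * 1 \<partial>lborel)"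
    by (rule limit[where R=1]) auto
  then have lim1: "(\<lambda>n. 1 / t n ^ CARD('m) * (\<integral>b. K (t n) a b \<partial>\<mu>)) \<longlonglongrightarrow>
      coord_volume (ambient_metric F) c ?y * (\<integral>x. exp (- ?B x x) \<partial>lborel)" by simp
  have lim2: "(\<lambda>n. 1 / t n ^ CARD('m) * (\<integral>b. K (t n) a b * \<Psi> ((F b - F a) /\<^sub>R t n) \<partial>\<mu>)) \<longlonglongrightarrow>
      coord_volume (ambient_metric F) c ?y * (\<integral>x. exp (- ?B x x) * \<Psi> (DF c ?y x) \<partial>lborel)"
  proof (rule limit[where R="(norm e)\<^sup>2"])
    show "continuous_on UNIV \<Psi>" unfolding \<Psi>_def by (intro continuous_intros)
    fix w
    have "(w \<bullet> e)\<^sup>2 \<le> (norm w * norm e)\<^sup>2"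
      using power_mono[OF Cauchy_Schwarz_ineq2[of w e] abs_ge_zero, of 2] by simp
    then show "\<bar>\<Psi> w\<bar> \<le> (norm e)\<^sup>2 * (1 + (norm w)\<^sup>2)"
      by (simp add: \<Psi>_def power_mult_distrib algebra_simps add_increasing)
  qed
  obtain k where k: "k > 0" "\<And>x. k * (norm x)\<^sup>2 \<le> ?B x x" using cone_coord_form_bound[OF \<zeta> c(1) y(1)] by metis
  have B: "bilinear ?B" "\<And>x x'. ?B x x' = ?B x' x"
    using pos_def_cone_coord_form[OF \<zeta> c(1) y(1)] by (auto simp: pos_def_form_def)
  note gauss = gaussian_second_moment[OF B k]
  define Z where "Z = (\<integral>x. exp (- ?B x x) \<partial>lborel)"
  have Z: "Z > 0" unfolding Z_def by (rule integral_exp_pos[OF gauss(1)])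
  have vol: "coord_volume (ambient_metric F) c ?y > 0"
    by (rule coord_volume_pos[OF riemannian_metric_ambient c(1) y(1)])
  \<comment> \<open>By the choice of \<open>u\<close>, the integrand contains
    \<open>(?B u x)\<^sup>2\<close>, and \<open>?B u u = DF c ?y u \<bullet> e\<close>.\<close>
  have moment: "(\<integral>x. exp (- ?B x x) * \<Psi> (DF c ?y x) \<partial>lborel) = (DF c ?y u \<bullet> e) / 2 * Z"
    using gauss(3)[of u] unfolding \<Psi>_def Z_def u .
  have ratio: "(\<lambda>n. (1 / t n ^ CARD('m) * (\<integral>b. K (t n) a b * \<Psi> ((F b - F a) /\<^sub>R t n) \<partial>\<mu>)) /
      (1 / t n ^ CARD('m) * (\<integral>b. K (t n) a b \<partial>\<mu>))) \<longlonglongrightarrow> (DF c ?y u \<bullet> e) / 2"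
    using tendsto_divide[OF lim2 lim1] Z vol unfolding moment Z_def[symmetric] by simp
  let ?f = "\<lambda>b. F b \<bullet> e" and ?f2 = "\<lambda>b. (F b \<bullet> e) * (F b \<bullet> e)"
  have f: "C2_fun A ?f" "C2_fun A ?f2" by (auto intro: C2_F_component C2_fun_mult)
  have seq: "(\<lambda>n. diffusion_L CARD('m) \<mu> K (t n) f a) \<longlonglongrightarrow> L f" if "C2_fun A f" for f
    using filterlim_compose[OF lim[OF that] t(4)] unfolding K_def \<xi>_def .
  have "(\<lambda>n. diffusion_L CARD('m) \<mu> K (t n) ?f2 a - 2 * ?f a * diffusion_L CARD('m) \<mu> K (t n) ?f a)
      \<longlonglongrightarrow> L ?f2 - 2 * ?f a * L ?f"
    by (intro tendsto_intros seq f)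
  \<comment> \<open>Pure algebra in the three kernel moments: the terms without an integral combine
    to minus the square of \<open>f a\<close>, which completes the square under the average.\<close>
  moreover have "diffusion_L CARD('m) \<mu> K (t n) ?f2 a - 2 * ?f a * diffusion_L CARD('m) \<mu> K (t n) ?f a =
      - ((1 / t n ^ CARD('m) * (\<integral>b. K (t n) a b * \<Psi> ((F b - F a) /\<^sub>R t n) \<partial>\<mu>)) /
      (1 / t n ^ CARD('m) * (\<integral>b. K (t n) a b \<partial>\<mu>)))" for n
  proof -
    have Kint: "integrable \<mu> (\<lambda>b. K (t n) a b * q b)" if q: "continuous_on M q" for q :: "'a \<Rightarrow> real"
    proof -
      obtain Q where Q: "\<forall>x\<in>q ` M. norm x \<le> Q"
        using compact_imp_bounded[OF compact_continuous_image[OF q compact_M]] bounded_iff by blast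
      have "integrable \<mu> (\<lambda>b. Q * K (t n) a b)" using K(1)[of n] by simp
      then show ?thesis
      proof (rule Bochner_Integration.integrable_bound)
        show "(\<lambda>b. K (t n) a b * q b) \<in> borel_measurable \<mu>"
          using K(1)[of n] g.measurable_continuous[OF q] by (intro borel_measurable_times) auto
        show "AE b in \<mu>. norm (K (t n) a b * q b) \<le> norm (Q * K (t n) a b)"
        proof (rule AE_I2)
          fix b assume "b \<in> space \<mu>"
          then have "\<bar>q b\<bar> \<le> \<bar>Q\<bar>" using Q by (force simp: g.space_N)
          then show "norm (K (t n) a b * q b) \<le> norm (Q * K (t n) a b)"
            by (simp add: abs_mult mult.commute[of "\<bar>Q\<bar>"] mult_left_mono)
        qed
      qed
    qed
    have int: "integrable \<mu> (\<lambda>b. K (t n) a b * ?f b)" "integrable \<mu> (\<lambda>b. K (t n) a b * ?f2 b)"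
      by (intro Kint continuous_intros continuous_on_F)+
    let ?I0 = "\<integral>b. K (t n) a b \<partial>\<mu>" and ?I1 = "\<integral>b. K (t n) a b * ?f b \<partial>\<mu>" and ?I2 = "\<integral>b. K (t n) a b * ?f2 b \<partial>\<mu>"
    have "(\<integral>b. K (t n) a b * \<Psi> ((F b - F a) /\<^sub>R t n) \<partial>\<mu>) =
        (\<integral>b. (K (t n) a b * ?f2 b - 2 * ?f a * (K (t n) a b * ?f b) + (?f a)\<^sup>2 * K (t n) a b) / (t n)\<^sup>2 \<partial>\<mu>)"
      using t(1)[of n] by (intro Bochner_Integration.integral_cong)
        (auto simp: \<Psi>_def inner_simps power2_eq_square field_simps)
    also have "\<dots> = (?I2 - 2 * ?f a * ?I1 + (?f a)\<^sup>2 * ?I0) / (t n)\<^sup>2"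
      using int K(1)[of n] by simp
    finally have eq: "(\<integral>b. K (t n) a b * \<Psi> ((F b - F a) /\<^sub>R t n) \<partial>\<mu>) = (?I2 - 2 * ?f a * ?I1 + (?f a)\<^sup>2 * ?I0) / (t n)\<^sup>2" .
    show ?thesis
      using K(2)[of n] t(1)[of n] unfolding eq diffusion_L_def diffusion_P_def diffusion_H_def
      by (simp add: field_simps power2_eq_square)
  qed
  ultimately have "(\<lambda>n. - ((1 / t n ^ CARD('m) * (\<integral>b. K (t n) a b * \<Psi> ((F b - F a) /\<^sub>R t n) \<partial>\<mu>)) /
      (1 / t n ^ CARD('m) * (\<integral>b. K (t n) a b \<partial>\<mu>)))) \<longlonglongrightarrow> L ?f2 - 2 * ?f a * L ?f"
    by simp
  from LIMSEQ_unique[OF this tendsto_minus[OF ratio]] show ?thesis by simp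
qed

text \<open>Both forms are tested on an arbitrary covector \<open>l\<close>. The kernel limit gives
  \<open>- l u' / 2\<close>, where \<open>u'\<close> represents \<open>l\<close> in the cone form;
  the codifferential gives -2/4 times the inverse metric of \<open>h\<close> at \<open>l\<close>,
  that is \<open>- l u / 2\<close>. Equal inverse forms force equal forms.\<close>

lemma induced_metric_coord_form:
  assumes \<zeta>: "0 \<le> \<zeta>" "\<zeta> < 1" and J: "finite J"
    and w: "(\<Sum>j\<in>J. w j) = 0" "(\<Sum>j\<in>J. w j * of_int j) = 1"
    and mu: "volume_measure M A (ambient_metric F) \<mu>"
    and induced: "induced_metric M A \<mu> (cone_kernel (fd_velocity J w \<Phi> F) F \<zeta>) h \<nu> s"
    and c: "c \<in> A" "y \<in> chart_image c"
  shows "coord_form h c y = cone_coord_form \<zeta> c y"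
proof -
  have h: "riemannian_metric A h" "volume_measure M A h \<nu>" and s: "C1_fun A s" "\<And>a. a \<in> M \<Longrightarrow> s a > 0"
    using induced by (auto simp: induced_metric_def)
  obtain D where D: "codifferential M A h (density \<nu> (\<lambda>a. ennreal (s a))) D"
    and lim: "\<And>f a. C2_fun A f \<Longrightarrow> a \<in> M \<Longrightarrow>
      ((\<lambda>dt. diffusion_L CARD('m) \<mu> (cone_kernel (fd_velocity J w \<Phi> F) F \<zeta>) dt f a) \<longlongrightarrow> D (differential f) a / 4) (at_right 0)"
    using induced unfolding induced_metric_def by blast
  interpret h: manifold_with_volume M A F h \<nu> by unfold_locales (rule h)+
  let ?a = "chart_inv c y"
  have a: "?a \<in> fst c" "?a \<in> M" "snd c ?a = y" using c by auto
  have posB: "pos_def_form (cone_coord_form \<zeta> c y)" by (rule pos_def_cone_coord_form[OF \<zeta> c])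
  have posH: "pos_def_form (coord_form h c y)" by (rule pos_def_coord_form[OF h(1) c])
  show ?thesis
  proof (rule pos_def_form_determined[OF posH posB])
    fix l :: "real ^ 'm \<Rightarrow> real" and u u'
    assume l: "linear l" and u: "\<forall>x. coord_form h c y u x = l x" and u': "\<forall>x. cone_coord_form \<zeta> c y u' x = l x"
    \<comment> \<open>Raising \<open>l\<close> with the ambient metric produces a vector
      \<open>e\<close> for which the differential of \<open>F \<bullet> e\<close> is
      \<open>l\<close>; hence linear observables realize every covector.\<close>
    obtain x0 where x0: "\<forall>x. coord_form (ambient_metric F) c y x0 x = l x"
      using pos_def_form_representation[OF pos_def_coord_form[OF riemannian_metric_ambient c] l] by blast
    define e where "e = DF c y x0"
    have le: "DF c y x \<bullet> e = l x" for x
      using x0 a c(1) unfolding coord_form_def ambient_metric_def e_def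
      by (metis pushforward_coord inner_commute)
    let ?f = "\<lambda>b. F b \<bullet> e"
    have f: "C2_fun A ?f" by (rule C2_F_component)
    have "D (differential (\<lambda>b. ?f b * ?f b)) ?a / 4 - 2 * ?f ?a * (D (differential ?f) ?a / 4) = - (DF c (snd c ?a) u' \<bullet> e) / 2"
      by (rule carre_du_champ_limit[OF \<zeta> J w mu _ c(1) a(1), where L="\<lambda>f. D (differential f) ?a / 4"])
         (use lim a(2) u' le a(3) in auto)
    then have "D (differential (\<lambda>b. ?f b * ?f b)) ?a - 2 * ?f ?a * D (differential ?f) ?a = - 2 * l u'"
      by (simp add: a(3) le field_simps)
    then have inv: "inverse_metric A h ?a (differential ?f ?a) (differential ?f ?a) = l u'"
      using h.codifferential_square[OF s D f a(2)] by simp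
    obtain z where z: "sharp A h ?a (differential ?f ?a) = coord_tvec A c ?a z"
      using h.inverse_metric_eq(3)[OF a(2) f f] unfolding tangent_space_eq[OF c(1) a(1)] by blast
    have cl: "coord_tvec A c ?a x ?f = l x" for x
      unfolding coord_tvec_F[OF c(1) a(1)] a(3) by (rule le)
    have "\<forall>x. coord_form h c y z x = l x"
      unfolding coord_form_def z[symmetric]
      using h.inverse_metric_eq(4)[OF a(2) f f tangent_space_coord[OF c(1) a(1)]] cl by simp
    then have "z = u" using u pos_def_form_representation[OF posH l] by blast
    then have "inverse_metric A h ?a (differential ?f ?a) (differential ?f ?a) = l u"
      using h.inverse_metric_eq(1)[OF a(2) f f] z cl by simp
    then show "l u = l u'" using inv by simp
  qed
qed

section \<open>From coordinate forms to the metric tensor and the volume\<close>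

lemma field_norm_ambient: "field_norm (ambient_metric F) v a = norm (velocity a)"
  by (simp add: field_norm_def ambient_metric_def velocity_def norm_eq_sqrt_inner)

lemma cone_metric_eq:
  assumes form: "\<And>c y. c \<in> A \<Longrightarrow> y \<in> chart_image c \<Longrightarrow> coord_form h c y = cone_coord_form \<zeta> c y"
    and a: "a \<in> M" and u: "u \<in> tangent_space A a" "u' \<in> tangent_space A a"
  shows "h a u u' = 1 / (field_norm (ambient_metric F) v a)\<^sup>2 * (ambient_metric F a u u' -
    \<zeta> * ((ambient_metric F a (v a) u * ambient_metric F a (v a) u') / (field_norm (ambient_metric F) v a)\<^sup>2))"
proof -
  obtain c where c: "c \<in> A" "a \<in> fst c" using a by (rule chart_cover)
  then obtain x x' where x: "u = coord_tvec A c a x" "u' = coord_tvec A c a x'"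
    using u by (auto simp: tangent_space_eq)
  have "h a u u' = cone_coord_form \<zeta> c (snd c a) x x'"
    using form[of c "snd c a"] c by (simp add: x coord_form_def fun_eq_iff)
  then show ?thesis
    using c unfolding field_norm_ambient cone_coord_form_def cone_form_def
    by (simp add: x ambient_metric_def pushforward_coord velocity_def)
qed

text \<open>With \<open>z\<close> the coordinates of \<open>v a\<close> and n the speed,
  \<open>h\<close> is a rank-one update of \<open>?G\<close> with scale \<open>1 / n\<^sup>2\<close>
  and coefficient \<open>\<zeta> / n\<^sup>2\<close>. Since \<open>?G z z = n\<^sup>2\<close>, the
  update contributes the factor \<open>1 - \<zeta>\<close> for every speed. The frame enters both
  densities through the same squared determinant.\<close>

lemma cone_volume_density:
  assumes \<zeta>: "\<zeta> < 1"
    and form: "\<And>c y. c \<in> A \<Longrightarrow> y \<in> chart_image c \<Longrightarrow> coord_form h c y = cone_coord_form \<zeta> c y"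
    and a: "a \<in> M" and u: "\<And>i::'m. u i \<in> tangent_space A a"
  shows "volume_density h a u =
    sqrt (1 - \<zeta>) * (volume_density (ambient_metric F) a u / field_norm (ambient_metric F) v a ^ CARD('m))"
proof -
  obtain c where c: "c \<in> A" "a \<in> fst c" using a by (rule chart_cover)
  let ?y = "snd c a" and ?G = "coord_form (ambient_metric F) c (snd c a)" and ?n = "norm (velocity a)"
  have y: "?y \<in> chart_image c" "chart_inv c ?y = a" using c by auto
  have n: "?n > 0" using velocity_nonzero[OF a] by simp
  have posG: "pos_def_form ?G" by (rule pos_def_coord_form[OF riemannian_metric_ambient c(1) y(1)])
  then have G: "bilinear ?G" "\<And>x x'. ?G x x' = ?G x' x" by (auto simp: pos_def_form_def)
  have Geq: "?G x x' = DF c ?y x \<bullet> DF c ?y x'" for x x'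
    using c by (simp add: coord_form_def ambient_metric_def pushforward_coord)
  have "\<forall>i. \<exists>x. u i = coord_tvec A c a x"
    using u unfolding tangent_space_eq[OF c] by blast
  from choice[OF this] obtain X where X: "\<And>i. u i = coord_tvec A c a (X i)" by blast
  obtain z where z: "v a = coord_tvec A c a z"
    using v_tangent[OF a] unfolding tangent_space_eq[OF c] by blast
  have V: "velocity a = DF c ?y z" using c by (simp add: velocity_def z pushforward_coord)
  have Gz: "?G z z = ?n\<^sup>2" by (simp add: Geq V power2_norm_eq_inner)
  have H: "coord_form h c ?y = (\<lambda>x x'. 1 / ?n\<^sup>2 * (?G x x' - \<zeta> / ?n\<^sup>2 * (?G z x * ?G z x')))"
    unfolding form[OF c(1) y(1)] cone_coord_form_def cone_form_def y(2) Geq V by (simp add: fun_eq_iff)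
  have bilH: "bilinear (coord_form h c ?y)"
    unfolding H bilinear_def linear_iff using G(1)
    by (auto simp: bilinear_ladd bilinear_radd bilinear_lmul bilinear_rmul add_divide_distrib diff_divide_distrib algebra_simps)
  have "det (form_matrix (coord_form h c ?y)) = (1 / ?n\<^sup>2) ^ CARD('m) * ((1 - \<zeta> / ?n\<^sup>2 * ?G z z) * det (form_matrix ?G))"
    unfolding H by (rule det_form_matrix_rank_one_update[OF G])
  also have "1 - \<zeta> / ?n\<^sup>2 * ?G z z = 1 - \<zeta>" using n by (simp add: Gz)
  finally have det: "det (form_matrix (coord_form h c ?y)) = (1 / ?n\<^sup>2) ^ CARD('m) * ((1 - \<zeta>) * det (form_matrix ?G))" .
  have "sqrt ((1 / ?n\<^sup>2) ^ CARD('m)) = 1 / ?n ^ CARD('m)"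
    using n by (simp add: real_sqrt_power real_sqrt_divide power_one_over)
  moreover have "volume_density k a u = sqrt ((det (\<chi> i. X i))\<^sup>2 * det (form_matrix (coord_form k c ?y)))"
    if "bilinear (coord_form k c ?y)" for k
  proof -
    have "(\<chi> i j. k a (u i) (u j)) = (\<chi> i j. coord_form k c ?y (X i) (X j))"
      using c by (simp add: X coord_form_def)
    then show ?thesis using det_gram[OF that, of X] by (simp add: volume_density_def)
  qed
  ultimately show ?thesis
    using G(1) bilH unfolding field_norm_ambient by (simp add: det real_sqrt_mult)
qed

text \<open>The relation between densities, applied to coordinate frames, compares both measures on
  subsets of a single chart domain, which determines them. The speed is continuous and nonzero on
  \<open>M\<close>, so its inverse power is a measurable density.\<close>

lemma cone_volume_measure:
  assumes \<zeta>: "\<zeta> < 1"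
    and form: "\<And>c y. c \<in> A \<Longrightarrow> y \<in> chart_image c \<Longrightarrow> coord_form h c y = cone_coord_form \<zeta> c y"
    and mu: "volume_measure M A (ambient_metric F) \<mu>" and nu: "volume_measure M A h \<nu>"
  shows "\<nu> = scale_measure (ennreal (sqrt (1 - \<zeta>)))
    (density \<mu> (\<lambda>a. ennreal (1 / field_norm (ambient_metric F) v a ^ CARD('m))))"
proof (rule measure_eqI_charts)
  interpret g: manifold_with_volume M A F "ambient_metric F" \<mu>
    by unfold_locales (rule riemannian_metric_ambient, rule mu)
  let ?\<phi> = "\<lambda>a. 1 / norm (velocity a) ^ CARD('m)"
  show "sets \<nu> = sets (restrict_space borel M)" using nu by (simp add: volume_measure_def)
  then have sets: "sets \<nu> = sets \<mu>" by (simp add: g.sets_N)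
  show "sets (scale_measure (ennreal (sqrt (1 - \<zeta>))) (density \<mu> (\<lambda>a. ennreal (1 / field_norm (ambient_metric F) v a ^ CARD('m))))) = sets (restrict_space borel M)"
    by (simp add: g.sets_N)
  fix c B assume c: "c \<in> A" and "B \<in> sets \<nu>" and Bc: "B \<subseteq> fst c"
  then have B[measurable]: "B \<in> sets \<mu>" using sets by simp
  have "continuous_on M ?\<phi>"
    using velocity_nonzero by (intro continuous_intros continuous_on_velocity) auto
  then have [measurable]: "?\<phi> \<in> borel_measurable \<mu>" by (rule g.measurable_continuous)
  have "emeasure \<nu> B = (\<integral>\<^sup>+y. ennreal (coord_volume h c y) * indicator (snd c ` B) y \<partial>lborel)"
    using nu c Bc \<open>B \<in> sets \<nu>\<close> unfolding volume_measure_def by (simp add: volume_density_coord)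
  also have "\<dots> = (\<integral>\<^sup>+y. ennreal (coord_volume (ambient_metric F) c y) *
      (ennreal (sqrt (1 - \<zeta>)) * (ennreal (?\<phi> (chart_inv c y)) * indicator B (chart_inv c y))) * indicator (chart_image c) y \<partial>lborel)"
  proof (rule nn_integral_cong)
    fix y :: "real ^ 'm"
    show "ennreal (coord_volume h c y) * indicator (snd c ` B) y = ennreal (coord_volume (ambient_metric F) c y) *
      (ennreal (sqrt (1 - \<zeta>)) * (ennreal (?\<phi> (chart_inv c y)) * indicator B (chart_inv c y))) * indicator (chart_image c) y"
    proof (cases "y \<in> chart_image c")
      case True
      have mem: "y \<in> snd c ` B \<longleftrightarrow> chart_inv c y \<in> B"
      proof
        assume "y \<in> snd c ` B"
        then obtain b where "b \<in> B" "y = snd c b" by blast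
        then show "chart_inv c y \<in> B" using Bc c by auto
      next
        assume "chart_inv c y \<in> B"
        then show "y \<in> snd c ` B" using True by (metis chart_chart_inv imageI)
      qed
      have "coord_volume h c y = sqrt (1 - \<zeta>) * (coord_volume (ambient_metric F) c y / norm (velocity (chart_inv c y)) ^ CARD('m))"
        using cone_volume_density[OF \<zeta> form chart_inv_in_M[OF c True] tangent_space_coord[OF c chart_inv_in[OF True]], of "\<lambda>i. axis i 1"]
        unfolding volume_density_coord field_norm_ambient .
      then have "ennreal (coord_volume h c y) = ennreal (coord_volume (ambient_metric F) c y) * (ennreal (sqrt (1 - \<zeta>)) * ennreal (?\<phi> (chart_inv c y)))"
        using \<zeta> coord_volume_pos[OF riemannian_metric_ambient c True]
        by (simp add: ennreal_mult[symmetric] mult_ac)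
      then show ?thesis using True mem by (simp add: indicator_def)
    next
      case False
      then have "y \<notin> snd c ` B" using Bc by blast
      then show ?thesis using False by simp
    qed
  qed
  also have "\<dots> = (\<integral>\<^sup>+b. indicator (fst c) b * (ennreal (sqrt (1 - \<zeta>)) * (ennreal (?\<phi> b) * indicator B b)) \<partial>\<mu>)"
    by (rule g.nn_integral_chart[OF c, symmetric]) measurable
  also have "\<dots> = (\<integral>\<^sup>+b. ennreal (sqrt (1 - \<zeta>)) * (ennreal (?\<phi> b) * indicator B b) \<partial>\<mu>)"
    using Bc by (intro nn_integral_cong) (auto split: split_indicator)
  also have "\<dots> = ennreal (sqrt (1 - \<zeta>)) * emeasure (density \<mu> (\<lambda>a. ennreal (?\<phi> a))) B"
    by (subst emeasure_density) (auto simp: nn_integral_cmult)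
  finally show "emeasure \<nu> B = emeasure (scale_measure (ennreal (sqrt (1 - \<zeta>))) (density \<mu> (\<lambda>a. ennreal (1 / field_norm (ambient_metric F) v a ^ CARD('m))))) B"
    by (simp add: field_norm_ambient)
qed

end

theorem lemma3p1:
  fixes M :: "'a::t2_space set"
    and A :: "('a, 'm::finite) chart set"
    and \<Phi> :: "real \<Rightarrow> 'a \<Rightarrow> 'a"
    and v :: "'a \<Rightarrow> 'a tvec"
    and F :: "'a \<Rightarrow> 'b::euclidean_space"
    and J :: "int set" and w :: "int \<Rightarrow> real" and p :: nat
    and \<zeta> :: real
    and \<mu> \<nu> :: "'a measure"
    and g h :: "'a metric_tensor"
    and s :: "'a \<Rightarrow> real"
  assumes metric: "g = ambient_metric F"
    and manifold: "compact M" "C2_manifold M A"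
    and flow: "is_flow \<Phi>" "\<And>t. \<Phi> t ` M = M"
    and field: "dynamical_vector_field M A \<Phi> v" "\<And>a. a \<in> M \<Longrightarrow> v a \<noteq> (\<lambda>_. 0)"
    and embedding: "C2_embedding M A F"
    and scheme: "finite J" "fd_accuracy J w p" "p \<ge> 4"
    and zeta: "0 \<le> \<zeta>" "\<zeta> < 1"
    and mu: "volume_measure M A g \<mu>"
    and induced: "induced_metric M A \<mu> (cone_kernel (fd_velocity J w \<Phi> F) F \<zeta>) h \<nu> s"
  shows "(\<forall>a\<in>M. \<forall>u\<in>tangent_space A a. \<forall>u'\<in>tangent_space A a.
           h a u u' = 1 / (field_norm g v a)\<^sup>2 *
             (g a u u' - \<zeta> * ((g a (v a) u * g a (v a) u') / (field_norm g v a)\<^sup>2))) \<and>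
         (\<forall>a\<in>M. \<forall>u :: 'm \<Rightarrow> 'a tvec. (\<forall>i. u i \<in> tangent_space A a) \<longrightarrow>
           volume_density h a u =
             sqrt (1 - \<zeta>) * (volume_density g a u / field_norm g v a ^ CARD('m))) \<and>
         \<nu> = scale_measure (ennreal (sqrt (1 - \<zeta>)))
           (density \<mu> (\<lambda>a. ennreal (1 / field_norm g v a ^ CARD('m))))"
proof -
  interpret manifold_with_flow M A F \<Phi> v
    by unfold_locales (use manifold embedding flow field in auto)
  have mu': "volume_measure M A (ambient_metric F) \<mu>" using mu metric by simp
  have weights: "(\<Sum>j\<in>J. w j) = 0" "(\<Sum>j\<in>J. w j * of_int j) = 1"
    using fd_accuracy_weights[OF scheme(2)] scheme(3) by auto
  have form: "coord_form h c y = cone_coord_form \<zeta> c y" if "c \<in> A" "y \<in> chart_image c" for c y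
    by (rule induced_metric_coord_form[OF zeta scheme(1) weights mu' induced that])
  have nu: "volume_measure M A h \<nu>" using induced by (simp add: induced_metric_def)
  show ?thesis
    unfolding metric
    using cone_metric_eq[OF form] cone_volume_density[OF zeta(2) form] cone_volume_measure[OF zeta(2) form mu' nu]
    by blast
qed

end
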